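(* Let $S$ be a finite set of non-zero integers with a choice of signs $\theta:S\to\{-1,1\}$. Let $f,d$ be positive integers with $1\le f\le d$ and $(f,d)=1$. Put $i=2$ if $4\nmid d$, $i=1$ if $4\mid d$ and $8\nmid d$, and $i=0$ if $8\mid d$. Then there exist infinitely many primes $p\equiv f\ (\mathrm{mod}\ d)$ such that $S$ has residue pattern $\theta$ modulo $p$ if and only if $\theta(T)=\left(\frac{\mathrm{sqf}(T)}{f}\right)$ for every $T\in\mathcal{D}_i$. In this case, the asymptotic density (relative to the set of all primes) of the primes $p\equiv f\ (\mathrm{mod}\ d)$ for which $S$ has residue pattern $\theta$ modulo $p$ is $\frac{|\mathcal{D}_i|}{\varphi(d)2^{|S|}}$.
   Context: For a non-zero integer $n$, $\mathrm{sqf}(n)$ is its squarefree part: the unique squarefree integer $s$ (of the same sign as $n$) with $n=sm^2$ for some integer $m$. For a finite set $T$ of non-zero integers, $\mathrm{sqf}(T)=\mathrm{sqf}\left(\prod_{s\in T}s\right)$, and $\mathrm{sqf}(\emptyset)=1$. For $T\subseteq S$, $\theta(T)=\prod_{s\in T}\theta(s)$, with $\theta(\emptyset)=1$. $S$ has residue pattern $\theta$ modulo a prime $p$ if $\left(\frac{s}{p}\right)=\theta(s)$ (Legendre symbol) for all $s\in S$. For a positive integer $f$, $\left(\frac{\cdot}{f}\right)$ is the Jacobi symbol (Kronecker symbol if $f$ is even). Define $\mathcal{D}_0=\{T\subseteq S:\mathrm{sqf}(T)\mid d\}$, $\mathcal{D}_1=\{T\in\mathcal{D}_0:\mathrm{sqf}(T)\equiv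 1\text{ or }3\ (\mathrm{mod}\ 4)\}$, $\mathcal{D}_2=\{T\in\mathcal{D}_0:\mathrm{sqf}(T)\equiv 1\ (\mathrm{mod}\ 4)\}$. The density of a set $Q$ of primes is $\lim_{x\to\infty}|\{p\in Q:p\le x\}|/|\{p\text{ prime}:p\le x\}|$. *)

theory Defs
  imports Complex_Main "HOL-Computational_Algebra.Squarefree" "HOL-Number_Theory.Number_Theory"
begin

(* squarefree_part from the library is signed: for a non-zero integer it carries the sign of
   its argument, as the following lemma confirms. *)
lemma squarefree_part_int_iff:
  fixes n s :: int
  assumes "n \<noteq> 0"
  shows "s = squarefree_part n \<longleftrightarrow> squarefree s \<and> sgn s = sgn n \<and> (\<exists>m. n = s * m\<^sup>2)"
proof (intro iffI conjI)
  have dec: "n = squarefree_part n * (square_part n)\<^sup>2"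
    by (rule squarefree_decompose)
  assume s: "s = squarefree_part n"
  show "squarefree s"
    using s by simp
  show "\<exists>m. n = s * m\<^sup>2"
    using s dec by blast
  have "square_part n \<noteq> 0"
    using assms by simp
  then have pos: "sgn ((square_part n)\<^sup>2) = 1"
    by (intro sgn_pos) simp
  have "sgn n = sgn (squarefree_part n) * sgn ((square_part n)\<^sup>2)"
    using arg_cong[OF dec, of sgn] by (simp only: sgn_mult)
  then show "sgn s = sgn n"
    using s pos by simp
next
  assume "squarefree s \<and> sgn s = sgn n \<and> (\<exists>m. n = s * m\<^sup>2)"
  then obtain m where s: "squarefree s" and m: "n = s * m\<^sup>2"
    by blast
  have nz: "s \<noteq> 0" "m \<noteq> 0"
    using assms m by auto
  have "multiplicity p (square_part n) = multiplicity p m" if p: "prime p" for p :: int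
  proof -
    have "multiplicity p n = multiplicity p s + 2 * multiplicity p m"
      using prime_imp_prime_elem[OF p] nz unfolding m
      by (simp add: prime_elem_multiplicity_mult_distrib prime_elem_multiplicity_power_distrib)
    moreover have "multiplicity p s \<le> 1"
      using s p nz by (simp add: squarefree_factorial_semiring'')
    ultimately show ?thesis
      using p by (simp add: prime_multiplicity_square_part)
  qed
  then have "normalize (square_part n) = normalize m"
    using nz assms by (intro multiplicity_eq_imp_eq) auto
  then have "(square_part n)\<^sup>2 = m\<^sup>2"
    by (metis abs_eq_iff normalize_int_def power2_abs)
  then have "squarefree_part n * m\<^sup>2 = s * m\<^sup>2"
    using squarefree_decompose[of n] m by metis
  then show "s = squarefree_part n"
    using nz by simp
qed

definition sqf :: "int set \<Rightarrow> int" where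
  "sqf T = squarefree_part (\<Prod>T)"

definition residue_pattern :: "int set \<Rightarrow> (int \<Rightarrow> int) \<Rightarrow> nat \<Rightarrow> bool" where
  "residue_pattern S \<theta> p \<longleftrightarrow> (\<forall>s\<in>S. Legendre s (int p) = \<theta> s)"

(* The symbol (a/q) for a prime q; its value at q = 2 is Kronecker's, whereas the library's
   Legendre a 2 is 1 for every odd a. *)
definition kronecker_prime :: "int \<Rightarrow> nat \<Rightarrow> int" where
  "kronecker_prime a q =
     (if q = 2 then (if even a then 0 else if a mod 8 = 1 \<or> a mod 8 = 7 then 1 else -1)
      else Legendre a (int q))"

(* The Kronecker symbol (a/f) for positive f; for odd f it is the Jacobi symbol. *)
definition kronecker :: "int \<Rightarrow> nat \<Rightarrow> int" where
  "kronecker a f = (\<Prod>q\<in>prime_factors f. kronecker_prime a q ^ multiplicity q f)"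

definition D0 :: "int set \<Rightarrow> nat \<Rightarrow> int set set" where
  "D0 S d = {T. T \<subseteq> S \<and> sqf T dvd int d}"

definition D1 :: "int set \<Rightarrow> nat \<Rightarrow> int set set" where
  "D1 S d = {T \<in> D0 S d. [sqf T = 1] (mod 4) \<or> [sqf T = 3] (mod 4)}"

definition D2 :: "int set \<Rightarrow> nat \<Rightarrow> int set set" where
  "D2 S d = {T \<in> D0 S d. [sqf T = 1] (mod 4)}"

definition has_prime_density :: "nat set \<Rightarrow> real \<Rightarrow> bool" where
  "has_prime_density Q \<delta> \<longleftrightarrow>
     ((\<lambda>x :: real. real (card {p \<in> Q. real p \<le> x}) / real (card {p :: nat. prime p \<and> real p \<le> x}))
        \<longlongrightarrow> \<delta>) at_top"

end

theory Submission
  imports Defs "HOL-Complex_Analysis.Complex_Analysis" "HOL-Real_Asymp.Real_Asymp"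
    "HOL-Number_Theory.Prime_Powers"
begin

text \<open>For a prime \<open>p\<close> not dividing \<open>\<Prod>S\<close>, the indicator of the residue pattern is
  \<open>2 ^ -|S|\<close> times the sum over \<open>T \<subseteq> S\<close> of \<open>\<theta>(T) (sqf T / p)\<close>, and by quadratic reciprocity
  \<open>(sqf T / \<cdot>)\<close> is a Dirichlet character. It depends only on the class modulo \<open>d\<close> precisely when
  \<open>T\<close> lies in \<open>D\<close>; otherwise some \<open>v \<equiv> 1\<close> modulo \<open>d\<close> has \<open>(sqf T / v) = -1\<close>, and the contribution of
  \<open>T\<close> averages to zero over the primes in the class of \<open>f\<close>.

  What remains is that primes are equidistributed, in natural density, among the units modulo \<open>N\<close>. As
  only relative density is needed, it is enough that the sum of a non-principal character \<open>\<xi>\<close> over primes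
  up to \<open>x\<close> is \<open>o(x / ln x)\<close>, together with Chebyshev's lower bound; neither the prime number theorem nor a
  continuation of zeta is needed. Since \<open>L(1 + it, \<xi>) \<noteq> 0\<close>, Newman's contour argument applies to
  \<open>1 / L(s, \<xi>)\<close>, whose coefficients are bounded, so the series of \<open>\<mu>(n) \<xi>(n) / n\<close> converges. Hence
  \<open>\<mu> \<xi>\<close> has partial sums \<open>o(x)\<close>, and Dirichlet's hyperbola method for
  \<open>\<Lambda> \<xi> = \<mu> \<xi> * \<xi> ln\<close> carries this over to \<open>\<Lambda> \<xi>\<close>.\<close>

section \<open>Newman's Tauberian theorem\<close>

text \<open>Non-vanishing on the line Re s = 1 takes two arguments. The 3-4-1 inequality compares
  L(s, xi) with L(s, xi^2), and it gives nothing when xi^2 is principal and t = 0, because the third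
  factor then has a pole at the very point in question. That remaining case is a real character at s
  = 1 and is settled by a Lambert series. In the other cases upper bounds to the right of the line
  suffice: for zeta near 1 along the real axis, and near 1 + 2it with t nonzero.

  The hyperbola step works because the partial sums of xi ln are far below linear. The terms beyond
  a cutoff K cost O(x / sqrt K), and for fixed K the remaining ones are o(x) by the estimate for mu
  xi.

  On the arithmetic side, f may be even when d is odd, so reciprocity has to include the Kronecker
  symbol at 2. This is consistent because in that case only sets T with sqf T congruent to 1 modulo
  4 belong to D.\<close>

lemma right_half_circle:
  assumes "R \<ge> 0" "z \<in> path_image (part_circlepath 0 R (-(pi/2)) (pi/2))"
  shows "Re z \<ge> 0" "norm z = R"
proof -
  obtain t where t: "t \<in> {-(pi/2)..pi/2}" "z = R * exp (\<i> * t)"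
    using assms by (auto simp: path_image_part_circlepath)
  have "cos t \<ge> 0" using t by (auto intro!: cos_ge_zero)
  thus "Re z \<ge> 0" "norm z = R" using assms(1) t by (auto simp: Re_exp norm_mult)
qed

text \<open>The winding number is computed from the primitives \<open>Ln z\<close> and \<open>Ln (- z)\<close> of \<open>1 / z\<close> on the two halves.\<close>

lemma half_circle_Cauchy:
  fixes H :: "complex \<Rightarrow> complex" and R :: real
  defines "C \<equiv> part_circlepath 0 R (-(pi/2)) (pi/2)"
  assumes R: "R > 0" and S: "convex S" "open S" "0 \<in> S" "H holomorphic_on S"
    and B: "valid_path B" "path_image B \<subseteq> S" "pathstart B = \<i> * R" "pathfinish B = - (\<i> * R)"
    and Bneg: "path_image B \<subseteq> {z. - z \<notin> \<real>\<^sub>\<le>\<^sub>0}"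
    and C: "path_image C \<subseteq> S"
  shows "contour_integral C (\<lambda>z. H z / z) + contour_integral B (\<lambda>z. H z / z) = 2 * pi * \<i> * H 0"
proof -
  have ends: "pathstart C = - (\<i> * R)" "pathfinish C = \<i> * R"
    by (simp_all add: C_def exp_minus cis_conv_exp[symmetric] mult.commute
        flip: exp_of_real)
       (simp_all add: exp_eq_polar cis.ctr complex_eq_iff Re_exp Im_exp)
  have vC: "valid_path C" by (simp add: C_def)
  have CR: "z \<notin> \<real>\<^sub>\<le>\<^sub>0" if "z \<in> path_image C" for z
    using right_half_circle[of R z] that R by (auto simp: C_def complex_nonpos_Reals_iff complex_eq_iff cmod_def)
  have "((\<lambda>z. 1 / z) has_contour_integral (Ln (pathfinish C) - Ln (pathstart C))) C"
    by (rule contour_integral_primitive[of "- \<real>\<^sub>\<le>\<^sub>0"])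
       (use CR vC in \<open>auto intro!: derivative_eq_intros simp: divide_inverse\<close>)
  \<comment> \<open>As \<open>z\<close> runs along \<open>B\<close> from \<open>\<i> * R\<close> to
    \<open>- (\<i> * R)\<close>, \<open>- z\<close> runs the opposite way, so \<open>B\<close>
    contributes the same difference of logarithms as \<open>C\<close>.\<close>
  moreover have "((\<lambda>z. 1 / z) has_contour_integral (Ln (-pathfinish B) - Ln (-pathstart B))) B"
    by (rule contour_integral_primitive[of "{z. - z \<notin> \<real>\<^sub>\<le>\<^sub>0}" "\<lambda>z. Ln (-z)"])
       (use Bneg B in \<open>auto intro!: derivative_eq_intros simp: divide_inverse\<close>)
  ultimately have 1: "((\<lambda>z. 1 / z) has_contour_integral
     (Ln (\<i> * R) - Ln (-(\<i>*R))) + (Ln (\<i> * R) - Ln (-(\<i>*R)))) (C +++ B)"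
    unfolding ends B(3,4) minus_minus using vC B by (intro has_contour_integral_join) auto
  have Ln1: "Ln (\<i> * R) = ln R + \<i> * (pi/2)" 
    using R Ln_times_of_real[of R "\<i>"] by (simp add: mult.commute Ln_of_real)
  have Ln2: "Ln (-(\<i> * R)) = ln R - \<i> * (pi/2)"
    using R Ln_times_of_real[of R "-\<i>"] by (simp add: mult.commute Ln_of_real)
  have nz: "0 \<notin> path_image (C +++ B)"
    using CR[of 0] Bneg B ends by (subst path_image_join) auto
  have wn: "winding_number (C +++ B) 0 = 1"
    using contour_integral_unique[OF 1] nz vC B ends
    by (subst winding_number_valid_path) (auto simp: Ln1 Ln2 field_simps)
  have pim: "path_image (C +++ B) \<subseteq> S - {0}"
    using nz B C by (auto simp: path_image_join ends)
  have "((\<lambda>w. H w / (w - 0)) has_contour_integral 2 * pi * \<i> * winding_number (C +++ B) 0 * H 0) (C +++ B)"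
    by (rule Cauchy_integral_formula_convex_simple[where S=S])
       (use S vC B pim ends in \<open>auto simp: interior_open\<close>)
  hence int: "((\<lambda>w. H w / w) has_contour_integral 2 * pi * \<i> * H 0) (C +++ B)"
    by (simp add: wn)
  hence "contour_integral (C +++ B) (\<lambda>w. H w / w) = 2 * pi * \<i> * H 0"
    by (rule contour_integral_unique)
  moreover have "(\<lambda>w. H w / w) contour_integrable_on C" "(\<lambda>w. H w / w) contour_integrable_on B"
    using int vC B ends by (auto simp: contour_integrable_on_def has_contour_integral_integrable
       intro: contour_integrable_joinD1[unfolded contour_integrable_on_def] contour_integrable_joinD2[unfolded contour_integrable_on_def])
  ultimately show ?thesis using vC B ends by simp
qed

lemma powr_tail_step:
  fixes x :: real assumes "x > 0" "n \<ge> (1::nat)"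
  shows "x * real (Suc n) powr (-1-x) \<le> real n powr (-x) - real (Suc n) powr (-x)"
proof -
  have "\<exists>z. real n < z \<and> z < real (Suc n) \<and> real (Suc n) powr (-x) - real n powr (-x) = (real (Suc n) - real n) * (-x * z powr (-x-1))"
    by (rule MVT2) (use assms in \<open>auto intro!: derivative_eq_intros\<close>)
  then obtain z where z: "real n < z" "z < real (Suc n)" "real (Suc n) powr (-x) - real n powr (-x) = -x * z powr (-x-1)"
    by auto
  have "real (Suc n) powr (-x-1) \<le> z powr (-x-1)"
    using z assms by (intro powr_mono2') auto
  hence "x * real (Suc n) powr (-x-1) \<le> x * z powr (-x-1)" using assms by (intro mult_left_mono) auto
  moreover have "-x-1 = -1-x" by simp
  ultimately have "x * real (Suc n) powr (-1-x) \<le> x * z powr (-x-1)" by metis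
  thus ?thesis using z(3) by linarith
qed

text \<open>By the mean value theorem each term is at most a difference of consecutive powers
  divided by \<open>x\<close>, so the tail telescopes. The factor \<open>1 / x\<close> is what the
  kernel of the contour integral cancels later.\<close>

lemma powr_tail_summable:
  fixes x :: real assumes "x > 0" "M \<ge> (1::nat)"
  shows "summable (\<lambda>n. real (Suc (n + M)) powr (-1-x))" "(\<Sum>n. real (Suc (n + M)) powr (-1-x)) \<le> real M powr (-x) / x"
proof -
  have "(\<lambda>n. real n powr (-x)) \<longlonglongrightarrow> 0"
    using assms by (intro tendsto_neg_powr) (auto simp: filterlim_real_sequentially)
  hence "(\<lambda>n. real (n + M) powr (-x)) \<longlonglongrightarrow> 0" by (rule LIMSEQ_ignore_initial_segment)
  hence "(\<lambda>n. real (n + M) powr (-x) - real (Suc n + M) powr (-x)) sums (real (0 + M) powr (-x) - 0)"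
    by (rule telescope_sums')
  hence t: "(\<lambda>n. (real (n + M) powr (-x) - real (Suc n + M) powr (-x)) / x) sums (real M powr (-x) / x)"
    using sums_divide by fastforce
  have le: "real (Suc (n + M)) powr (-1-x) \<le> (real (n + M) powr (-x) - real (Suc n + M) powr (-x)) / x" for n
    using powr_tail_step[of x "n+M"] assms by (simp add: field_simps)
  show s: "summable (\<lambda>n. real (Suc (n + M)) powr (-1-x))"
    by (rule summable_comparison_test'[OF sums_summable[OF t]]) (use le in auto)
  show "(\<Sum>n. real (Suc (n + M)) powr (-1-x)) \<le> real M powr (-x) / x"
    using suminf_le[OF le s sums_summable[OF t]] sums_unique[OF t] by simp
qed

text \<open>Comparison with the integral of \<open>t powr (x - 1)\<close>. For
  \<open>x \<ge> 1\<close> the summands increase, so the integral up to \<open>M\<close> dominates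
  only the terms below \<open>M\<close>, and the last term is added separately.\<close>

lemma powr_partial_sum_bound:
  fixes x :: real assumes "x > 0" "M \<ge> (1::nat)"
  shows "(\<Sum>n=1..M. real n powr (x-1)) \<le> real M powr x / x + real M powr (x-1)"
proof -
  have mvt: "\<exists>z. real n < z \<and> z < real (Suc n) \<and> (real (Suc n) powr x - real n powr x)/x = z powr (x-1)"
    if "n \<ge> 1" for n :: nat
  proof -
    have "\<exists>z. real n < z \<and> z < real (Suc n) \<and> real (Suc n) powr x - real n powr x = (real (Suc n) - real n) * (x * z powr (x-1))"
      by (rule MVT2) (use that assms in \<open>auto intro!: derivative_eq_intros\<close>)
    thus ?thesis using assms by (auto simp: field_simps)
  qed
  show ?thesis
  proof (cases "x \<ge> 1")
    case True
    have "(\<Sum>n=1..M. real n powr (x-1)) \<le> real M powr x / x + real M powr (x-1)"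
      using assms(2)
    proof (induction M rule: dec_induct)
      case base
      then show ?case using assms by simp
    next
      case (step n)
      obtain z where z: "real n < z" "z < real (Suc n)" "(real (Suc n) powr x - real n powr x)/x = z powr (x-1)"
        using mvt step by blast
      have "real n powr (x-1) \<le> z powr (x-1)" using z step True by (intro powr_mono2) auto
      then show ?case using step z(3) by (simp add: diff_divide_distrib)
    qed
    thus ?thesis .
  next
    case False
    have "(\<Sum>n=1..M. real n powr (x-1)) \<le> real M powr x / x"
      using assms(2)
    proof (induction M rule: dec_induct)
      case base
      then show ?case using assms False by simp
    next
      case (step n)
      obtain z where z: "real n < z" "z < real (Suc n)" "(real (Suc n) powr x - real n powr x)/x = z powr (x-1)"
        using mvt step by blast
      have "real (Suc n) powr (x-1) \<le> z powr (x-1)" using z step False by (intro powr_mono2') auto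
      then show ?case using step z(3) by (simp add: diff_divide_distrib)
    qed
    thus ?thesis by (smt (verit) powr_ge_zero)
  qed
qed


text \<open>Cauchy's formula with the kernel \<open>K\<close> is applied to \<open>G\<close> and to
  the partial sum \<open>S M\<close>, and the results are subtracted. On the right arc
  \<open>C\<close> the difference is a tail of the series. On the left, \<open>G\<close> is
  integrated along a thin rectangular path \<open>B\<close> inside its domain, and
  \<open>S M\<close>, being entire, along the reflected arc \<open>C'\<close>, where it is bounded
  term by term. The factor \<open>E M\<close>, of size \<open>M powr Re z\<close>, balances the
  estimates on both arcs.\<close>

theorem Newman_tauberian:
  fixes a :: "nat \<Rightarrow> complex" and G :: "complex \<Rightarrow> complex"
  assumes a: "\<And>n. norm (a n) \<le> 1"
    and U: "open U" "{z. Re z \<ge> 0} \<subseteq> U" "G holomorphic_on U"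
    and G: "\<And>z. Re z > 0 \<Longrightarrow> (\<lambda>n. a (Suc n) * of_nat (Suc n) powr (-1 - z)) sums G z"
  shows "(\<lambda>M. \<Sum>n=1..M. a n / of_nat n) \<longlonglongrightarrow> G 0"
proof (rule LIMSEQ_I)
  fix \<epsilon> :: real assume \<epsilon>: "\<epsilon> > 0"
  \<comment> \<open>The two arcs together contribute
    \<open>4 * pi / R = pi * \<epsilon> / 2\<close>, up to a term that vanishes as \<open>M\<close>
    grows.\<close>
  define R where "R = 8 / \<epsilon>"
  have R: "R > 0" using \<epsilon> by (simp add: R_def)
  define S where "S = (\<lambda>(M::nat) z. \<Sum>n=1..M. a n * of_nat n powr (-1 - z))"
  define E where "E = (\<lambda>(M::nat) z::complex. exp (z * of_real (ln (real M))))"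
  define K where "K = (\<lambda>z::complex. 1 + z\<^sup>2 / of_real R ^ 2)"
  have [holomorphic_intros]: "S M holomorphic_on A" for M A
    unfolding S_def by (intro holomorphic_intros) auto
  have [holomorphic_intros]: "E M holomorphic_on A" "K holomorphic_on A" for M A
    unfolding E_def K_def using R by (auto intro!: holomorphic_intros)
  have normE: "norm (E M z) = real M powr Re z" if "M \<ge> 1" for M z
    using that by (simp add: E_def powr_def)
  have "compact ({z. Re z = 0} \<inter> cball 0 (2*R))"
    by (intro closed_Int_compact compact_cball) (auto intro!: closed_Collect_eq continuous_intros)
  moreover have "{z. Re z = 0} \<inter> cball 0 (2*R) \<subseteq> U" using U by auto
  ultimately obtain e where e: "e > 0" "(\<Union>x\<in>({z. Re z = 0} \<inter> cball 0 (2*R)). ball x e) \<subseteq> U"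
    using compact_subset_open_imp_ball_epsilon_subset[OF _ U(1)] by metis
  \<comment> \<open>A convex open set containing both \<open>C\<close> and \<open>B\<close>, as the
    Cauchy formula requires. Its depth \<open>e\<close> to the left of the imaginary axis comes from
    compactness of a segment of that axis.\<close>
  define V where "V = {z. Re z > -e} \<inter> {z. Im z < 2*R} \<inter> {z. Im z > - (2*R)}"
  have V: "convex V" "open V" "0 \<in> V"
    using e R by (auto simp: V_def open_halfspace_Re_gt open_halfspace_Im_lt open_halfspace_Im_gt
        convex_halfspace_Re_gt convex_halfspace_Im_lt convex_halfspace_Im_gt intro!: open_Int convex_Int)
  have VU: "V \<subseteq> U"
  proof
    fix z assume z: "z \<in> V"
    show "z \<in> U"
    proof (cases "Re z \<ge> 0")
      case False
      have "\<i> * Im z \<in> {z. Re z = 0} \<inter> cball 0 (2*R)" using z by (auto simp: V_def norm_mult)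
      moreover have "z \<in> ball (\<i> * Im z) e"
      proof -
        have "\<i> * Im z - z = - of_real (Re z)" by (simp add: complex_eq_iff)
        thus ?thesis using z False by (auto simp: V_def dist_norm)
      qed
      ultimately show ?thesis using e by blast
    qed (use U in auto)
  qed
  have GV: "G holomorphic_on V" using U VU holomorphic_on_subset by blast
  note [holomorphic_intros] = GV
  define h where "h = (\<lambda>z. G z * K z / z)"
  have hV: "continuous_on A h" if "A \<subseteq> V" "0 \<notin> A" for A
    unfolding h_def
    by (intro holomorphic_on_imp_continuous_on holomorphic_intros holomorphic_on_subset[OF GV]) (use that in auto)
  define \<delta>0 where "\<delta>0 = e / 2"
  have "bounded (h ` ((cbox (Complex (-\<delta>0) R) (Complex 0 R)) \<union> cbox (Complex (-\<delta>0) (-R)) (Complex 0 (-R))))"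
    using R e by (intro compact_imp_bounded compact_continuous_image compact_Un compact_cbox hV)
      (auto simp: V_def in_cbox_complex_iff \<delta>0_def)
  then obtain C1 where C1: "C1 > 0" "\<And>z. z \<in> (cbox (Complex (-\<delta>0) R) (Complex 0 R)) \<union> cbox (Complex (-\<delta>0) (-R)) (Complex 0 (-R)) \<Longrightarrow> norm (h z) \<le> C1"
    unfolding bounded_pos by blast
  \<comment> \<open>The order of the choices matters: \<open>C1\<close> bounds \<open>h\<close> on
    horizontal sides of the fixed width \<open>\<delta>0\<close> and survives shrinking
    \<open>\<delta>\<close>, while \<open>C2\<close> may depend on \<open>\<delta>\<close> because
    it is multiplied by \<open>M powr (-\<delta>)\<close>.\<close>
  define \<delta> where "\<delta> = min \<delta>0 (\<epsilon> / (2 * C1))"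
  have \<delta>: "\<delta> > 0" "\<delta> \<le> \<delta>0" "2 * C1 * \<delta> \<le> \<epsilon>" "\<delta> < e" using C1 \<epsilon> e by (auto simp: \<delta>_def \<delta>0_def min_def field_simps)
  have "bounded (h ` (cbox (Complex (-\<delta>) (-R)) (Complex (-\<delta>) R)))"
    using R e \<delta> by (intro compact_imp_bounded compact_continuous_image compact_cbox hV)
      (auto simp: V_def in_cbox_complex_iff \<delta>0_def)
  then obtain C2 where C2: "C2 > 0" "\<And>z. z \<in> cbox (Complex (-\<delta>) (-R)) (Complex (-\<delta>) R) \<Longrightarrow> norm (h z) \<le> C2"
    unfolding bounded_pos by blast
  define C where "C = part_circlepath 0 R (-(pi/2)) (pi/2)"
  define C' where "C' = part_circlepath 0 R (pi/2) (3*pi/2)"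
  define B1 where "B1 = linepath (\<i> * R) (Complex (-\<delta>) R)"
  define B2 where "B2 = linepath (Complex (-\<delta>) R) (Complex (-\<delta>) (-R))"
  define B3 where "B3 = linepath (Complex (-\<delta>) (-R)) (-(\<i> * R))"
  have imC: "Re z \<ge> 0 \<and> norm z = R" if "z \<in> path_image C" for z
    using right_half_circle[of R z] that R by (auto simp: C_def)
  have imC': "Re z \<le> 0 \<and> norm z = R" if zC: "z \<in> path_image C'" for z
  proof -
    obtain t where t: "t \<in> {pi/2..3*pi/2}" "z = R * exp (\<i> * t)"
      using zC R by (auto simp: C'_def path_image_part_circlepath)
    have "cos (t - pi) \<ge> 0" using t by (intro cos_ge_zero) auto
    thus ?thesis using R t by (auto simp: Re_exp norm_mult mult_nonneg_nonpos)
  qed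
  have imB1: "z \<in> cbox (Complex (-\<delta>0) R) (Complex 0 R) \<and> -\<delta> \<le> Re z" if "z \<in> path_image B1" for z
    using that \<delta> by (auto simp: B1_def closed_segment_same_Im in_cbox_complex_iff closed_segment_eq_real_ivl)
  have imB3: "z \<in> cbox (Complex (-\<delta>0) (-R)) (Complex 0 (-R)) \<and> -\<delta> \<le> Re z" if "z \<in> path_image B3" for z
    using that \<delta> by (auto simp: B3_def closed_segment_same_Im in_cbox_complex_iff closed_segment_eq_real_ivl)
  have imB2: "z \<in> cbox (Complex (-\<delta>) (-R)) (Complex (-\<delta>) R)" if "z \<in> path_image B2" for z
    using that \<delta> R by (auto simp: B2_def closed_segment_same_Re in_cbox_complex_iff closed_segment_eq_real_ivl)
  define B where "B = B1 +++ (B2 +++ B3)"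
  have B: "valid_path B" "pathstart B = \<i> * R" "pathfinish B = -(\<i> * R)"
    "path_image B = path_image B1 \<union> path_image B2 \<union> path_image B3"
    by (auto simp: B_def B1_def B2_def B3_def path_image_join intro!: valid_path_join)
  have C': "valid_path C'" "pathstart C' = \<i> * R" "pathfinish C' = -(\<i> * R)"
    using cos_3over2_pi sin_3over2_pi by (auto simp: C'_def exp_eq_polar complex_eq_iff)
  have BV: "path_image B \<subseteq> V"
    using imB1 imB2 imB3 \<delta> R unfolding B(4) by (fastforce simp: V_def in_cbox_complex_iff)
  have CV: "path_image C \<subseteq> V"
  proof
    fix z assume "z \<in> path_image C"
    with imC[of z] have "Re z \<ge> 0" "norm z = R" by auto
    moreover from this have "\<bar>Im z\<bar> \<le> R" using abs_Im_le_cmod[of z] by simp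
    ultimately show "z \<in> V" using R e(1) unfolding V_def Int_iff mem_Collect_eq by linarith
  qed
  have Bneg: "path_image B \<subseteq> {z. - z \<notin> \<real>\<^sub>\<le>\<^sub>0}"
    using imB1 imB2 imB3 \<delta> R unfolding B(4) by (fastforce simp: complex_nonpos_Reals_iff in_cbox_complex_iff)
  have C'neg: "path_image C' \<subseteq> {z. - z \<notin> \<real>\<^sub>\<le>\<^sub>0}"
    using imC' R by (fastforce simp: complex_nonpos_Reals_iff cmod_def)
  \<comment> \<open>With \<open>R^2 = z * cnj z\<close> the quotient is
    \<open>1 / z + z / R^2 = (cnj z + z) / R^2\<close>, a real number proportional to
    \<open>Re z\<close>.\<close>
  have kernel: "K z / z = of_real (2 * Re z / R^2)" if "norm z = R" for z
  proof -
    have z: "z \<noteq> 0" using that R by auto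
    have "of_real R ^ 2 = z * cnj z"
      using that complex_norm_square[of z] by simp
    moreover have "z + cnj z = of_real (2 * Re z)" by (simp add: complex_add_cnj)
    ultimately have "(of_real R ^ 2 + z\<^sup>2) = z * of_real (2 * Re z)" by (simp add: power2_eq_square algebra_simps flip: distrib_left)
    thus ?thesis using z R by (simp add: K_def field_simps)
  qed
  have main: "2 * pi * norm (G 0 - S M 0) \<le> 4 * pi / R + 2 * pi / real M + 2 * C1 * \<delta> + C2 * real M powr (-\<delta>) * (2 * R)"
    if M: "M \<ge> 1" for M
  proof -
    let ?H1 = "\<lambda>z. G z * E M z * K z" and ?H2 = "\<lambda>z. S M z * E M z * K z"
    have e1: "contour_integral C (\<lambda>z. ?H1 z / z) + contour_integral B (\<lambda>z. ?H1 z / z) = 2 * pi * \<i> * ?H1 0"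
      unfolding C_def
      by (rule half_circle_Cauchy[where S = V])
         (use R V B BV Bneg CV in \<open>auto intro!: holomorphic_intros simp: C_def\<close>)
    have e2: "contour_integral C (\<lambda>z. ?H2 z / z) + contour_integral C' (\<lambda>z. ?H2 z / z) = 2 * pi * \<i> * ?H2 0"
      unfolding C_def
      by (rule half_circle_Cauchy[where S = UNIV])
         (use R V C' C'neg in \<open>auto intro!: holomorphic_intros\<close>)
    have c1: "continuous_on A (\<lambda>z. ?H1 z / z)" if "A \<subseteq> V" "0 \<notin> A" for A
      by (intro holomorphic_on_imp_continuous_on holomorphic_intros holomorphic_on_subset[OF GV]) (use that in auto)
    have c2: "continuous_on A (\<lambda>z. ?H2 z / z)" if "0 \<notin> A" for A
      by (intro holomorphic_on_imp_continuous_on holomorphic_intros) (use that in auto)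
    have 0: "0 \<notin> path_image C" "0 \<notin> path_image B" "0 \<notin> path_image C'"
      using imC imC' Bneg R by force+
    have i1: "(\<lambda>z. ?H1 z / z) contour_integrable_on C"
      unfolding C_def by (intro contour_integrable_continuous_part_circlepath c1) (use 0 CV in \<open>auto simp: C_def\<close>)
    have i2: "(\<lambda>z. ?H2 z / z) contour_integrable_on C"
      unfolding C_def by (intro contour_integrable_continuous_part_circlepath c2) (use 0 in \<open>auto simp: C_def\<close>)
    have i3: "(\<lambda>z. ?H2 z / z) contour_integrable_on C'"
      unfolding C'_def by (intro contour_integrable_continuous_part_circlepath c2) (use 0 in \<open>auto simp: C'_def\<close>)
    have iB: "(\<lambda>z. ?H1 z / z) contour_integrable_on B1" "(\<lambda>z. ?H1 z / z) contour_integrable_on B2" "(\<lambda>z. ?H1 z / z) contour_integrable_on B3"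
      unfolding B1_def B2_def B3_def
      by (intro contour_integrable_continuous_linepath c1; use 0 BV B(4) in \<open>auto simp: B1_def B2_def B3_def\<close>)+
    have dB: "contour_integral B (\<lambda>z. ?H1 z / z) = contour_integral B1 (\<lambda>z. ?H1 z / z) + (contour_integral B2 (\<lambda>z. ?H1 z / z) + contour_integral B3 (\<lambda>z. ?H1 z / z))"
      unfolding B_def using iB
      by (subst contour_integral_join; (subst contour_integral_join)?) (auto simp: B1_def B2_def B3_def intro!: contour_integrable_joinI valid_path_join)
    have E0: "E M 0 = 1" "K 0 = 1" by (auto simp: E_def K_def)
    have eq: "2 * pi * \<i> * (G 0 - S M 0) = contour_integral C (\<lambda>z. ?H1 z / z - ?H2 z / z)
       + (contour_integral B1 (\<lambda>z. ?H1 z / z) + (contour_integral B2 (\<lambda>z. ?H1 z / z) + contour_integral B3 (\<lambda>z. ?H1 z / z))) - contour_integral C' (\<lambda>z. ?H2 z / z)"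
      using e1 e2 dB E0 by (subst contour_integral_diff[OF i1 i2]) (simp add: algebra_simps)
    have b1: "norm (contour_integral C (\<lambda>z. ?H1 z / z - ?H2 z / z)) \<le> (2 / R^2) * R * \<bar>pi/2 - (-(pi/2))\<bar>"
      unfolding C_def
    proof (rule contour_integral_bound_part_circlepath)
      show "(\<lambda>z. ?H1 z / z - ?H2 z / z) contour_integrable_on part_circlepath 0 R (-(pi/2)) (pi/2)"
        using contour_integrable_diff[OF i1 i2] by (simp add: C_def)
      fix z assume "z \<in> path_image (part_circlepath 0 R (-(pi/2)) (pi/2))"
      hence z: "Re z \<ge> 0" "norm z = R" using imC[of z] by (auto simp: C_def)
      have "norm (?H1 z / z - ?H2 z / z) = norm ((G z - S M z) * E M z * (K z / z))"
        by (simp add: algebra_simps diff_divide_distrib)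
      also have "\<dots> = norm (G z - S M z) * real M powr Re z * (2 * Re z / R^2)"
        unfolding norm_mult kernel[OF z(2)] normE[OF M] using z by (simp flip: of_real_power of_real_divide of_real_mult)
      also have "\<dots> \<le> 2 / R^2"
      \<comment> \<open>On the imaginary axis the kernel factor is 0; off it, \<open>Re z\<close>
        cancels the denominator in the tail bound.\<close>
      proof (cases "Re z = 0")
        case False
        with z have z0: "Re z > 0" by simp
        have sm: "(\<lambda>n. a (Suc (n + M)) * of_nat (Suc (n + M)) powr (-1 - z)) sums (G z - S M z)"
        proof -
          have "S M z = (\<Sum>n<M. a (Suc n) * of_nat (Suc n) powr (-1 - z))"
            unfolding S_def by (rule sum.reindex_bij_witness[of _ Suc "\<lambda>n. n - 1"]) auto
          thus ?thesis using sums_split_initial_segment[OF G[OF z0], of M] by simp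
        qed
        have nb: "norm (a (Suc (n + M)) * of_nat (Suc (n + M)) powr (-1 - z)) \<le> real (Suc (n + M)) powr (-1 - Re z)" for n
        proof -
          have "norm (of_nat (Suc (n + M)) powr (-1 - z) :: complex) = real (Suc (n + M)) powr (-1 - Re z)"
            using norm_powr_real_powr[of "of_nat (Suc (n+M))" "-1-z"] by (simp del: of_nat_Suc)
          thus ?thesis using mult_right_mono[OF a] by (simp add: norm_mult del: of_nat_Suc)
        qed
        have "norm (G z - S M z) \<le> (\<Sum>n. real (Suc (n + M)) powr (-1 - Re z))"
          unfolding sums_unique[OF sm] by (rule norm_suminf_le) (use nb powr_tail_summable[OF z0 M] in auto)
        also have "\<dots> \<le> real M powr (-Re z) / Re z" by (rule powr_tail_summable[OF z0 M])
        finally have "norm (G z - S M z) * real M powr Re z * (2 * Re z / R^2) \<le> (real M powr (-Re z) / Re z) * real M powr Re z * (2 * Re z / R^2)"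
          using z by (intro mult_right_mono) auto
        also have "\<dots> = 2 / R^2" using z0 M by (simp add: powr_minus field_simps)
        finally show ?thesis .
      qed auto
      finally show "norm (?H1 z / z - ?H2 z / z) \<le> 2 / R^2" .
    qed (use R in auto)
    have b2: "norm (contour_integral C' (\<lambda>z. ?H2 z / z)) \<le> (2 / R^2 + 2 / (real M * R)) * R * \<bar>3*pi/2 - pi/2\<bar>"
      unfolding C'_def
    proof (rule contour_integral_bound_part_circlepath)
      show "(\<lambda>z. ?H2 z / z) contour_integrable_on part_circlepath 0 R (pi/2) (3*pi/2)"
        using i3 by (simp add: C'_def)
      fix z assume "z \<in> path_image (part_circlepath 0 R (pi/2) (3*pi/2))"
      hence z: "Re z \<le> 0" "norm z = R" using imC'[of z] by (auto simp: C'_def)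
      define x where "x = - Re z"
      have xR: "x \<le> R" using abs_Re_le_cmod[of z] z by (simp add: x_def)
      have "norm (?H2 z / z) = norm (S M z * E M z * (K z / z))" by simp
      also have "\<dots> = norm (S M z) * real M powr (-x) * (2 * x / R^2)"
        unfolding norm_mult kernel[OF z(2)] normE[OF M] using z by (simp add: x_def flip: of_real_power of_real_divide of_real_mult)
      also have "\<dots> \<le> 2 / R^2 + 2 / (real M * R)"
      proof (cases "x = 0")
        case False
        with z have x0: "x > 0" by (simp add: x_def)
        have "norm (S M z) \<le> (\<Sum>n=1..M. real n powr (x - 1))"
          unfolding S_def
        proof (rule sum_norm_le)
          fix n assume "n \<in> {1..M}"
          hence "norm (of_nat n powr (-1 - z) :: complex) = real n powr (-1 - Re z)"
            using norm_powr_real_powr[of "of_nat n" "-1-z"] by simp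
          also have "-1 - Re z = x - 1" by (simp add: x_def)
          finally have "norm (of_nat n powr (-1 - z) :: complex) = real n powr (x - 1)" .
          thus "norm (a n * of_nat n powr (-1 - z)) \<le> real n powr (x - 1)"
            using mult_right_mono[OF a] by (simp add: norm_mult)
        qed
        also have "\<dots> \<le> real M powr x / x + real M powr (x - 1)" by (rule powr_partial_sum_bound[OF x0 M])
        finally have "norm (S M z) * real M powr (-x) * (2 * x / R^2) \<le> (real M powr x / x + real M powr (x - 1)) * real M powr (-x) * (2 * x / R^2)"
          using x0 by (intro mult_right_mono) auto
        also have "\<dots> = 2 / R^2 + 2 * (x / R) / (real M * R)"
          using x0 M R by (simp add: powr_diff powr_minus field_simps power2_eq_square)
        also have "\<dots> \<le> 2 / R^2 + 2 * 1 / (real M * R)"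
          using xR R M x0 by (intro add_left_mono divide_right_mono mult_left_mono) auto
        finally show ?thesis by simp
      qed (use R in auto)
      finally show "norm (?H2 z / z) \<le> 2 / R^2 + 2 / (real M * R)" .
    qed (use R in auto)
    have nH: "norm (?H1 z / z) = norm (h z) * real M powr Re z" for z
      by (simp add: h_def norm_mult norm_divide normE[OF M])
    have hor: "norm (?H1 z / z) \<le> C1" if "norm (h z) \<le> C1" "Re z \<le> 0" for z
    proof -
      have "real M powr Re z \<le> 1" using M that powr_mono[of "Re z" 0 "real M"] by simp
      thus ?thesis unfolding nH using mult_mono[OF that(1), of "real M powr Re z" 1] C1 by simp
    qed
    have b3: "norm (contour_integral B1 (\<lambda>z. ?H1 z / z)) \<le> C1 * norm (Complex (-\<delta>) R - \<i> * R)"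
      unfolding B1_def
      by (rule contour_integral_bound_linepath)
         (use iB imB1 C1 in \<open>auto intro!: hor simp: B1_def in_cbox_complex_iff\<close>)
    have b4: "norm (contour_integral B3 (\<lambda>z. ?H1 z / z)) \<le> C1 * norm (-(\<i> * R) - Complex (-\<delta>) (-R))"
      unfolding B3_def
      by (rule contour_integral_bound_linepath)
         (use iB imB3 C1 in \<open>auto intro!: hor simp: B3_def in_cbox_complex_iff\<close>)
    have b5: "norm (contour_integral B2 (\<lambda>z. ?H1 z / z)) \<le> (C2 * real M powr (-\<delta>)) * norm (Complex (-\<delta>) (-R) - Complex (-\<delta>) R)"
      unfolding B2_def
    proof (rule contour_integral_bound_linepath)
      fix z assume "z \<in> closed_segment (Complex (- \<delta>) R) (Complex (- \<delta>) (- R))"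
      hence z: "z \<in> cbox (Complex (-\<delta>) (-R)) (Complex (-\<delta>) R)" using imB2 by (auto simp: B2_def)
      hence "Re z = -\<delta>" by (auto simp: in_cbox_complex_iff)
      thus "norm (?H1 z / z) \<le> C2 * real M powr (-\<delta>)"
        unfolding nH using C2(2)[OF z] by (auto intro!: mult_right_mono)
    qed (use iB C2 in \<open>auto simp: B2_def\<close>)
    have n1: "norm (Complex (-\<delta>) R - \<i> * R) = \<delta>" "norm (-(\<i> * R) - Complex (-\<delta>) (-R)) = \<delta>" "norm (Complex (-\<delta>) (-R) - Complex (-\<delta>) R) = 2 * R"
      using \<delta> R by (simp_all add: cmod_def real_sqrt_mult)
    have "2 * pi * norm (G 0 - S M 0) = norm (2 * pi * \<i> * (G 0 - S M 0))" by (simp add: norm_mult)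
    also have "\<dots> \<le> norm (contour_integral C (\<lambda>z. ?H1 z / z - ?H2 z / z)) + (norm (contour_integral B1 (\<lambda>z. ?H1 z / z)) + (norm (contour_integral B2 (\<lambda>z. ?H1 z / z)) + norm (contour_integral B3 (\<lambda>z. ?H1 z / z)))) + norm (contour_integral C' (\<lambda>z. ?H2 z / z))"
      unfolding eq by (intro order_trans[OF norm_triangle_ineq4] order_trans[OF norm_triangle_ineq] add_mono order_refl)
    also have "\<dots> \<le> (2 / R^2) * R * pi + (C1 * \<delta> + (C2 * real M powr (-\<delta>) * (2*R) + C1 * \<delta>)) + (2 / R^2 + 2 / (real M * R)) * R * pi"
    proof -
      have "\<bar>pi/2 - (-(pi/2))\<bar> = pi" "\<bar>3*pi/2 - pi/2\<bar> = pi" by auto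
      thus ?thesis using b1 b2 b3 b4 b5 unfolding n1 by (intro add_mono) (simp_all only:)
    qed
    also have "\<dots> = 4 * pi / R + 2 * pi / real M + 2 * C1 * \<delta> + C2 * real M powr (-\<delta>) * (2 * R)"
      using R M by (simp add: field_simps power2_eq_square)
    finally show ?thesis .
  qed
  have "(\<lambda>M. 2 * pi / real M + C2 * real M powr (-\<delta>) * (2 * R)) \<longlonglongrightarrow> 0 + C2 * 0 * (2 * R)"
    using \<delta> by (intro tendsto_intros tendsto_neg_powr lim_const_over_n filterlim_real_sequentially) auto
  hence "eventually (\<lambda>M. 2 * pi / real M + C2 * real M powr (-\<delta>) * (2 * R) < \<epsilon>) sequentially"
    using \<epsilon> by (intro order_tendstoD(2)[where y = 0]) auto
  then obtain M0 where M0: "\<And>M. M \<ge> M0 \<Longrightarrow> 2 * pi / real M + C2 * real M powr (-\<delta>) * (2 * R) < \<epsilon>"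
    by (auto simp: eventually_sequentially)
  have S0: "S M 0 = (\<Sum>n=1..M. a n / of_nat n)" for M
    unfolding S_def by (intro sum.cong) (auto simp: powr_minus divide_inverse powr_neg_one' )
  show "\<exists>M0. \<forall>M\<ge>M0. norm ((\<Sum>n=1..M. a n / of_nat n) - G 0) < \<epsilon>"
  proof (intro exI[of _ "max M0 1"] allI impI)
    fix M assume M: "M \<ge> max M0 1"
    have "2 * pi * norm (G 0 - S M 0) < pi * \<epsilon> / 2 + \<epsilon> + \<epsilon>"
      using main[of M] M0[of M] M \<delta>(3) \<epsilon> by (simp add: R_def)
    also have "\<dots> < 2 * pi * \<epsilon>"
    proof -
      have "2 * \<epsilon> < pi * \<epsilon>" using \<epsilon> pi_gt3 by simp
      thus ?thesis using \<epsilon> by (simp add: field_simps)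
    qed
    finally show "norm ((\<Sum>n=1..M. a n / of_nat n) - G 0) < \<epsilon>"
      by (simp add: S0 norm_minus_commute)
  qed
qed

section \<open>Dirichlet series\<close>

definition npow :: "complex \<Rightarrow> nat \<Rightarrow> complex" where
  "npow s n = of_nat n powr (-s)"

lemma norm_npow: "n > 0 \<Longrightarrow> norm (npow s n) = real n powr (- Re s)"
  unfolding npow_def using norm_powr_real_powr[of "of_nat n" "-s"] by simp

lemma npow_mult: "npow s (m * n) = npow s m * npow s n"
  unfolding npow_def of_nat_mult by (rule powr_times_real) auto

lemma npow_1 [simp]: "npow s 1 = 1" "npow s (Suc 0) = 1" by (simp_all add: npow_def)

lemma npow_holomorphic [holomorphic_intros]:
  "n > 0 \<Longrightarrow> f holomorphic_on A \<Longrightarrow> (\<lambda>s. npow (f s) n) holomorphic_on A"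
  unfolding npow_def by (intro holomorphic_intros) auto

lemma real_npow_summable:
  assumes "\<sigma> > 1" shows "(\<lambda>n. real n powr (-\<sigma>)) summable_on {1..}"
proof -
  have "summable (\<lambda>n. real (Suc (n + 1)) powr (-1-(\<sigma>-1)))"
    using assms by (intro powr_tail_summable) auto
  moreover have "-1-(\<sigma>-1) = -\<sigma>" by simp
  ultimately have "summable (\<lambda>n. real (n + 2) powr (-\<sigma>))" by (simp only: add_2_eq_Suc' Suc_eq_plus1[symmetric])
  hence "summable (\<lambda>n. real n powr (-\<sigma>))"
    by (rule iffD1[OF summable_iff_shift[of "\<lambda>n. real n powr (-\<sigma>)" 2]])
  hence "(\<lambda>n. real n powr (-\<sigma>)) summable_on UNIV"
    by (intro norm_summable_imp_summable_on) auto
  thus ?thesis by (rule summable_on_subset_banach) auto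
qed

lemma dirichlet_abs_summable:
  assumes "\<And>n. norm (f n) \<le> (C::real)" "Re s > 1"
  shows "(\<lambda>n. norm (f n * npow s n)) summable_on {1..}"
proof (rule Infinite_Sum.abs_summable_on_comparison_test')
  show "(\<lambda>n. C * real n powr (- Re s)) summable_on {1..}"
    using assms by (intro summable_on_cmult_right real_npow_summable)
  show "norm (f n * npow s n) \<le> C * real n powr (- Re s)" if "n \<in> {1..}" for n
    using that assms by (auto simp: norm_mult norm_npow intro!: mult_right_mono)
qed

text \<open>A pair is replaced by its product together with the first entry as a divisor. Products
  of Dirichlet series and the Lambert series are both regrouped in this way.\<close>

lemma has_sum_divisor_pairs:
  "((\<lambda>(m, n). f m n) has_sum s) ({1..} \<times> {1..}) \<longleftrightarrow>
   ((\<lambda>(n, d). f d (n div d)) has_sum s) (SIGMA n:{1..}. {d. d dvd (n::nat)})"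
proof (rule has_sum_reindex_bij_witness[where i = "\<lambda>(n, d). (d, n div d)" and j = "\<lambda>(m, n). (m * n, m)"])
  fix b :: "nat \<times> nat" assume "b \<in> (SIGMA n:{1..}. {d. d dvd n})"
  then obtain n d where b: "b = (n, d)" "n \<ge> 1" "d dvd n" by auto
  then have "n div d \<ge> 1" "d \<ge> 1" by (auto simp: dvd_div_eq_0_iff Suc_le_eq intro!: Nat.gr0I)
  with b show "(case case b of (n, d) \<Rightarrow> (d, n div d) of (m, n) \<Rightarrow> (m * n, m)) = b"
    "(case b of (n, d) \<Rightarrow> (d, n div d)) \<in> {1..} \<times> {1..}" by auto
qed auto

lemma has_sum_imp_sums_Suc:
  assumes "(f has_sum s) {1..}"
  shows "(\<lambda>n. f (Suc n)) sums s"
proof -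
  have "bij_betw Suc UNIV {1..}" by (rule bij_betwI[where g = "\<lambda>n. n - 1"]) auto
  from has_sum_reindex_bij_betw[OF this, of f s] show ?thesis using assms has_sum_imp_sums by blast
qed

text \<open>An unordered sum, so it is meaningful only under absolute convergence; the values
  further to the left are supplied by \<open>Lext\<close>.\<close>

definition dseries :: "(nat \<Rightarrow> complex) \<Rightarrow> complex \<Rightarrow> complex" where
  "dseries f s = (\<Sum>\<^sub>\<infinity>n\<in>{1..}. f n * npow s n)"

lemma dseries_has_sum:
  assumes "\<And>n. norm (f n) \<le> (C::real)" "Re s > 1"
  shows "((\<lambda>n. f n * npow s n) has_sum dseries f s) {1..}"
  unfolding dseries_def by (rule has_sum_infsum[OF abs_summable_summable[OF dirichlet_abs_summable[OF assms]]])

lemma dseries_sums: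
  assumes "\<And>n. norm (f n) \<le> (C::real)" "Re s > 1"
  shows "(\<lambda>n. f (Suc n) * npow s (Suc n)) sums dseries f s"
  by (rule has_sum_imp_sums_Suc[OF dseries_has_sum[OF assms]])

lemma dseries_norm_le:
  assumes "\<And>n. norm (f n) \<le> 1" "Re s > 1"
  shows "norm (dseries f s) \<le> (\<Sum>\<^sub>\<infinity>n\<in>{1..}. real n powr (- Re s))"
proof -
  have "norm (dseries f s) \<le> (\<Sum>\<^sub>\<infinity>n\<in>{1..}. norm (f n * npow s n))"
    unfolding dseries_def by (rule norm_infsum_bound) (rule dirichlet_abs_summable[OF assms])
  also have "\<dots> \<le> (\<Sum>\<^sub>\<infinity>n\<in>{1..}. real n powr (- Re s))"
  proof (rule infsum_mono)
    show "norm (f n * npow s n) \<le> real n powr (- Re s)" if "n \<in> {1..}" for n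
      using that assms(1)[of n] by (auto simp: norm_mult norm_npow intro!: mult_left_le_one_le)
  qed (use dirichlet_abs_summable[OF assms] real_npow_summable[OF assms(2)] in auto)
  finally show ?thesis .
qed

lemma dseries_mult:
  assumes f: "\<And>n. norm (f n) \<le> C" and g: "\<And>n. norm (g n) \<le> D" and s: "Re s > 1"
  shows "((\<lambda>n. (\<Sum>d | d dvd n. f d * g (n div d)) * npow s n) has_sum (dseries f s * dseries g s)) {1..}"
proof -
  let ?F = "\<lambda>(m,n). (f m * npow s m) * (g n * npow s n)"
  have abs: "(\<lambda>x. norm (?F x)) summable_on {1..} \<times> {1..}"
  proof (subst Infinite_Sum.abs_summable_on_Sigma_iff, intro conjI ballI)
    show "(\<lambda>n. norm (?F (m, n))) summable_on {1..}" for m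
      using summable_on_cmult_right[OF dirichlet_abs_summable[OF g s]] by (simp add: norm_mult)
    have "(\<Sum>\<^sub>\<infinity>n\<in>{1..}. norm (?F (m, n))) = norm (f m * npow s m) * (\<Sum>\<^sub>\<infinity>n\<in>{1..}. norm (g n * npow s n))" for m
      by (subst infsum_cmult_right'[symmetric]) (simp add: norm_mult)
    thus "(\<lambda>m. norm (\<Sum>\<^sub>\<infinity>n\<in>{1..}. norm (?F (m, n)))) summable_on {1..}"
      using summable_on_cmult_left[OF dirichlet_abs_summable[OF f s]]
      by (simp add: norm_mult abs_mult infsum_nonneg)
  qed
  have "(?F has_sum (dseries f s * dseries g s)) ({1..} \<times> {1..})"
  proof (rule has_sum_SigmaI)
    show "((\<lambda>n. ?F (m, n)) has_sum (f m * npow s m) * dseries g s) {1..}" for m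
      using has_sum_cmult_right[OF dseries_has_sum[OF g s]] by simp
    show "((\<lambda>m. (f m * npow s m) * dseries g s) has_sum dseries f s * dseries g s) {1..}"
      by (rule has_sum_cmult_left[OF dseries_has_sum[OF f s]])
  qed (rule abs_summable_summable[OF abs])
  hence "((\<lambda>(n, d). (f d * npow s d) * (g (n div d) * npow s (n div d))) has_sum (dseries f s * dseries g s)) (SIGMA n:{1..}. {d. d dvd n})"
    by (simp only: has_sum_divisor_pairs)
  also have "?this \<longleftrightarrow> ((\<lambda>(n, d). f d * g (n div d) * npow s n) has_sum (dseries f s * dseries g s)) (SIGMA n:{1..}. {d. d dvd n})"
    by (rule has_sum_cong) (auto simp: mult_ac simp flip: npow_mult)
  finally have *: "((\<lambda>(n, d). f d * g (n div d) * npow s n) has_sum (dseries f s * dseries g s)) (SIGMA n:{1..}. {d. d dvd n})" .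
  show ?thesis
  proof (rule has_sum_SigmaD[OF *])
    fix n :: nat assume "n \<in> {1..}"
    thus "((\<lambda>d. case (n, d) of (n, d) \<Rightarrow> f d * g (n div d) * npow s n) has_sum (\<Sum>d | d dvd n. f d * g (n div d)) * npow s n) {d. d dvd n}"
      by (auto simp: sum_distrib_right intro!: has_sum_finiteI)
  qed
qed

lemma npow_diff_bound:
  assumes "n \<ge> 1" "real n \<le> u" "real n \<le> v" "Re s > 0"
  shows "norm (of_real u powr (-s) - of_real v powr (-s) :: complex) \<le> norm s * real n powr (-1 - Re s) * \<bar>u - v\<bar>"
proof -
  have "norm ((of_real u :: complex) powr (-s) - of_real v powr (-s)) \<le> (norm s * real n powr (-1 - Re s)) * norm (of_real u - of_real v :: complex)"
  proof (rule field_differentiable_bound[where S = "complex_of_real ` {real n..}" and f' = "\<lambda>z. -s * z powr (-s-1)"])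
    show "convex (complex_of_real ` {real n..})"
      by (intro convex_linear_image) (auto simp: linear_iff scaleR_conv_of_real)
    fix z assume "z \<in> complex_of_real ` {real n..}"
    then obtain x where x: "z = of_real x" "x \<ge> real n" by auto
    with assms have "x > 0" by auto
    thus "((\<lambda>z. z powr (-s)) has_field_derivative - s * z powr (-s-1)) (at z within complex_of_real ` {real n..})"
      using x by (auto intro!: derivative_eq_intros)
    have "norm (z powr (-s-1)) = x powr (- Re s - 1)"
      using x \<open>x > 0\<close> norm_powr_real_powr[of z "-s-1"] by simp
    also have "- Re s - 1 = -1 - Re s" by simp
    also have "x powr (-1 - Re s) \<le> real n powr (-1 - Re s)" using x assms by (intro powr_mono2') auto
    finally show "norm (- s * z powr (-s-1)) \<le> norm s * real n powr (-1 - Re s)"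
      by (auto simp: norm_mult intro!: mult_left_mono)
  qed (use assms in auto)
  thus ?thesis by (simp flip: of_real_diff)
qed

lemma npow_step_bound:
  assumes "n \<ge> 1" "Re s > 0"
  shows "norm (npow s n - npow s (Suc n)) \<le> norm s * real n powr (-1 - Re s)"
  using npow_diff_bound[of n "real n" "real (Suc n)" s] assms by (simp add: npow_def)

definition psum :: "(nat \<Rightarrow> 'a :: comm_monoid_add) \<Rightarrow> nat \<Rightarrow> 'a" where
  "psum f n = (\<Sum>k=1..n. f k)"

lemma psum_0 [simp]: "psum f 0 = 0" and psum_Suc [simp]: "psum f (Suc n) = psum f n + f (Suc n)"
  by (simp_all add: psum_def)

lemma abel_psum:
  fixes w :: "nat \<Rightarrow> 'a :: comm_ring"
  shows "psum (\<lambda>n. f n * w n) M = psum f M * w (Suc M) + (\<Sum>n=1..M. psum f n * (w n - w (Suc n)))"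
  by (induction M) (simp_all add: algebra_simps)

text \<open>\<open>Lext f\<close> is the Dirichlet series of \<open>f\<close> after summation by parts; when the partial sums of \<open>f\<close> are
  bounded it converges absolutely for \<open>Re s > 0\<close>.\<close>

definition Lext :: "(nat \<Rightarrow> complex) \<Rightarrow> complex \<Rightarrow> complex" where
  "Lext f s = (\<Sum>n. psum f (Suc n) * (npow s (Suc n) - npow s (Suc (Suc n))))"

lemma Lext_summand_bound:
  assumes "\<And>n. norm (psum f n) \<le> B" "Re s \<ge> \<delta>" "\<delta> > 0" "norm s \<le> K"
  shows "norm (psum f (Suc n) * (npow s (Suc n) - npow s (Suc (Suc n)))) \<le> B * (K * real (Suc n) powr (-1 - \<delta>))"
proof -
  have B: "B \<ge> 0" using assms(1)[of 0] by simp
  have "norm (npow s (Suc n) - npow s (Suc (Suc n))) \<le> norm s * real (Suc n) powr (-1 - Re s)"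
    using assms by (intro npow_step_bound) auto
  also have "\<dots> \<le> K * real (Suc n) powr (-1 - \<delta>)"
    using assms by (intro mult_mono powr_mono) (auto intro: order_trans[OF norm_ge_zero])
  finally show ?thesis unfolding norm_mult using B by (intro mult_mono assms(1)) auto
qed

lemma summable_Suc_powr: "\<delta> > 0 \<Longrightarrow> summable (\<lambda>n. real (Suc n) powr (-1 - \<delta>))"
  by (rule iffD1[OF summable_iff_shift[of "\<lambda>n. real (Suc n) powr (-1 - \<delta>)" 1]])
     (rule powr_tail_summable, auto)

lemma Lext_holomorphic:
  assumes "\<And>n. norm (psum f n) \<le> B"
  shows "Lext f holomorphic_on {s. Re s > 0}"
proof (rule holomorphic_uniform_sequence)
  show "open {s. Re s > 0}" by (rule open_halfspace_Re_gt)
  show "(\<lambda>s. \<Sum>i<n. psum f (Suc i) * (npow s (Suc i) - npow s (Suc (Suc i)))) holomorphic_on {s. Re s > 0}" for n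
    by (intro holomorphic_intros) auto
  fix s assume s: "s \<in> {s. Re s > 0}"
  define d where "d = Re s / 2"
  have d: "d > 0" using s by (simp add: d_def)
  have cb: "Re w \<ge> d \<and> norm w \<le> norm s + d" if "w \<in> cball s d" for w
  proof -
    have "norm (w - s) \<le> d" using that by (simp add: dist_norm norm_minus_commute)
    thus ?thesis using abs_Re_le_cmod[of "w - s"] norm_triangle_ineq2[of w s] by (auto simp: d_def)
  qed
  have "uniform_limit (cball s d) (\<lambda>n s. \<Sum>i<n. psum f (Suc i) * (npow s (Suc i) - npow s (Suc (Suc i)))) (Lext f) sequentially"
    unfolding Lext_def
  proof (rule Weierstrass_m_test)
    show "summable (\<lambda>n. B * ((norm s + d) * real (Suc n) powr (-1 - d)))"
      using d by (intro summable_mult summable_Suc_powr)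
  qed (use cb assms d in \<open>intro Lext_summand_bound; auto\<close>)
  thus "\<exists>d>0. cball s d \<subseteq> {s. 0 < Re s} \<and>
             uniform_limit (cball s d) (\<lambda>n s. \<Sum>i<n. psum f (Suc i) * (npow s (Suc i) - npow s (Suc (Suc i)))) (Lext f) sequentially"
    using d cb by (intro exI[of _ d]) fastforce
qed

lemma Lext_limit:
  assumes B: "\<And>n. norm (psum f n) \<le> B" and s: "Re s > 0"
  shows "(\<lambda>M. psum (\<lambda>n. f n * npow s n) M) \<longlonglongrightarrow> Lext f s"
proof -
  have "summable (\<lambda>n. B * (norm s * real (Suc n) powr (-1 - Re s)))"
    using s by (intro summable_mult summable_Suc_powr)
  hence "summable (\<lambda>n. psum f (Suc n) * (npow s (Suc n) - npow s (Suc (Suc n))))"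
    by (rule summable_comparison_test'[where N = 0]) (rule Lext_summand_bound[OF B], use s in auto)
  hence "(\<lambda>n. psum f (Suc n) * (npow s (Suc n) - npow s (Suc (Suc n)))) sums Lext f s"
    unfolding Lext_def by (rule summable_sums)
  hence 1: "(\<lambda>M. \<Sum>n<M. psum f (Suc n) * (npow s (Suc n) - npow s (Suc (Suc n)))) \<longlonglongrightarrow> Lext f s"
    by (simp add: sums_def)
  have 2: "(\<lambda>M. psum f M * npow s (Suc M)) \<longlonglongrightarrow> 0"
  proof (rule Lim_null_comparison)
    have "norm (psum f M * npow s (Suc M)) \<le> B * real (Suc M) powr (-Re s)" for M
      unfolding norm_mult by (subst norm_npow) (auto intro!: mult_right_mono B)
    thus "\<forall>\<^sub>F M in sequentially. norm (psum f M * npow s (Suc M)) \<le> B * real (Suc M) powr (-Re s)"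
      by (intro always_eventually) blast
    have "(\<lambda>n. real n powr (-Re s)) \<longlonglongrightarrow> 0"
      using s by (intro tendsto_neg_powr) (auto simp: filterlim_real_sequentially)
    thus "(\<lambda>M. B * real (Suc M) powr (-Re s)) \<longlonglongrightarrow> 0"
      by (intro tendsto_mult_right_zero) (rule LIMSEQ_Suc)
  qed
  have "psum (\<lambda>n. f n * npow s n) M = psum f M * npow s (Suc M) + (\<Sum>n<M. psum f (Suc n) * (npow s (Suc n) - npow s (Suc (Suc n))))" for M
    unfolding abel_psum by (intro arg_cong2[where f = "(+)"] refl sum.reindex_bij_witness[of _ Suc "\<lambda>n. n - 1"]) auto
  thus ?thesis using tendsto_add[OF 2 1] by simp
qed

lemma Lext_eq_dseries:
  assumes B: "\<And>n. norm (psum f n) \<le> B" and f: "\<And>n. norm (f n) \<le> C" and s: "Re s > 1"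
  shows "Lext f s = dseries f s"
proof -
  have "(\<lambda>M. \<Sum>n<M. f (Suc n) * npow s (Suc n)) \<longlonglongrightarrow> dseries f s"
    using dseries_sums[OF f s] by (simp add: sums_def)
  moreover have "(\<Sum>n<M. f (Suc n) * npow s (Suc n)) = psum (\<lambda>n. f n * npow s n) M" for M
    by (induction M) auto
  ultimately show ?thesis using Lext_limit[OF B, of s] s LIMSEQ_unique by fastforce
qed

text \<open>The term at \<open>n\<close> is compared with the integral of \<open>x powr (-s)\<close>
  over \<open>[n, n + 1]\<close>, which is \<open>\<phi> (Suc n) - \<phi> n\<close>. These integrals
  telescope to \<open>1 / (s - 1)\<close>, and the errors sum to at most \<open>norm s\<close> times
  the sum of inverse squares, which is at most 2.\<close>

lemma zeta_bound:
  assumes s: "Re s > 1"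
  shows "norm (dseries (\<lambda>_. 1) s) \<le> 1 / norm (s - 1) + 2 * norm s"
proof -
  have s1: "s \<noteq> 1" using s by auto
  define \<phi> where "\<phi> = (\<lambda>n::nat. of_nat n powr (1-s) / (1-s))"
  have step: "norm (npow s n - (\<phi> (Suc n) - \<phi> n)) \<le> norm s * real n powr (-1 - Re s)" if n: "n \<ge> 1" for n
  proof -
    \<comment> \<open>An antiderivative of \<open>z powr (-s) - npow s n\<close>, so its increment
      over \<open>[n, n + 1]\<close> is the integral minus the term at \<open>n\<close>.\<close>
    let ?\<psi> = "\<lambda>z::complex. z powr (1-s) / (1-s) - z * npow s n"
    have "norm (?\<psi> (of_real (real (Suc n))) - ?\<psi> (of_real (real n))) \<le> (norm s * real n powr (-1 - Re s)) * norm (of_real (real (Suc n)) - of_real (real n) :: complex)"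
    proof (rule field_differentiable_bound[where S = "complex_of_real ` {real n..real (Suc n)}" and f' = "\<lambda>z. z powr (-s) - npow s n"])
      show "convex (complex_of_real ` {real n..real (Suc n)})"
        by (intro convex_linear_image) (auto simp: linear_iff scaleR_conv_of_real)
      fix z assume "z \<in> complex_of_real ` {real n..real (Suc n)}"
      then obtain x where x: "z = of_real x" "x \<ge> real n" "x \<le> real (Suc n)" by auto
      with n have "x > 0" by auto
      thus "(?\<psi> has_field_derivative z powr (-s) - npow s n) (at z within complex_of_real ` {real n..real (Suc n)})"
        using x s1 by (auto intro!: derivative_eq_intros)
      have "norm (z powr (-s) - npow s n) \<le> norm s * real n powr (-1 - Re s) * \<bar>x - real n\<bar>"
        using npow_diff_bound[of n x "real n" s] n x s by (simp add: npow_def)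
      also have "\<dots> \<le> norm s * real n powr (-1 - Re s) * 1" using x by (intro mult_left_mono) auto
      finally show "norm (z powr (-s) - npow s n) \<le> norm s * real n powr (-1 - Re s)" by simp
    qed (rule imageI; simp)+
    moreover have "?\<psi> (of_real (real (Suc n))) - ?\<psi> (of_real (real n)) = -(npow s n - (\<phi> (Suc n) - \<phi> n))"
      by (simp add: \<phi>_def algebra_simps)
    moreover have "norm (of_real (real (Suc n)) - of_real (real n) :: complex) = 1" by simp
    ultimately show ?thesis by (simp only: norm_minus_cancel mult_1_right)
  qed
  have lim: "(\<lambda>n. \<phi> (Suc n)) \<longlonglongrightarrow> 0"
  proof (rule tendsto_norm_zero_cancel)
    have "norm (\<phi> (Suc n)) = real (Suc n) powr (-(Re s - 1)) / norm (1-s)" for n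
      using norm_powr_real_powr[of "of_nat (Suc n)" "1-s"] by (simp add: \<phi>_def norm_divide)
    moreover have "(\<lambda>n. real n powr (-(Re s - 1))) \<longlonglongrightarrow> 0"
      using s by (intro tendsto_neg_powr) (auto simp: filterlim_real_sequentially)
    hence "(\<lambda>n. real (Suc n) powr (-(Re s - 1)) / norm (1-s)) \<longlonglongrightarrow> 0"
      by (intro tendsto_divide_zero) (rule LIMSEQ_Suc)
    ultimately show "(\<lambda>n. norm (\<phi> (Suc n))) \<longlonglongrightarrow> 0" by simp
  qed
  note tel = telescope_sums[OF lim]
  hence "(\<lambda>n. npow s (Suc n) - (\<phi> (Suc (Suc n)) - \<phi> (Suc n))) sums (dseries (\<lambda>_. 1) s - (0 - \<phi> (Suc 0)))"
    using sums_diff[OF dseries_sums[of "\<lambda>_. 1" 1 s, OF _ s] tel] by simp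
  hence e: "dseries (\<lambda>_. 1) s = (0 - \<phi> (Suc 0)) + (\<Sum>n. npow s (Suc n) - (\<phi> (Suc (Suc n)) - \<phi> (Suc n)))"
    by (simp add: sums_iff)
  have "norm (0 - \<phi> (Suc 0)) = 1 / norm (s - 1)" by (simp add: \<phi>_def norm_divide norm_minus_commute)
  moreover have "norm (\<Sum>n. npow s (Suc n) - (\<phi> (Suc (Suc n)) - \<phi> (Suc n))) \<le> 2 * norm s"
  proof -
    have "norm (\<Sum>n. npow s (Suc n) - (\<phi> (Suc (Suc n)) - \<phi> (Suc n))) \<le> (\<Sum>n. norm s * real (Suc n) powr (-1 - 1))"
    proof (rule norm_suminf_le)
      fix n show "norm (npow s (Suc n) - (\<phi> (Suc (Suc n)) - \<phi> (Suc n))) \<le> norm s * real (Suc n) powr (-1 - 1)"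
        by (rule order_trans[OF step]) (use s in \<open>auto intro!: mult_left_mono powr_mono\<close>)
    qed (intro summable_mult summable_Suc_powr, simp)
    also have "\<dots> = norm s * (\<Sum>n. real (Suc n) powr (-1 - 1))"
      by (intro suminf_mult summable_Suc_powr) auto
    finally have le: "norm (\<Sum>n. npow s (Suc n) - (\<phi> (Suc (Suc n)) - \<phi> (Suc n))) \<le> norm s * (\<Sum>n. real (Suc n) powr (-1 - 1))" .
    have "(\<Sum>n. real (Suc n) powr (-1 - 1)) = (\<Sum>n. real (Suc (n + 1)) powr (-1 - 1)) + 1"
      using suminf_split_initial_segment[OF summable_Suc_powr[of 1], of 1] by simp
    also have "\<dots> \<le> 2" using powr_tail_summable(2)[of 1 1] by simp
    finally have "norm s * (\<Sum>n. real (Suc n) powr (-1 - 1)) \<le> norm s * 2" by (intro mult_left_mono) auto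
    with le show ?thesis by simp
  qed
  ultimately show ?thesis unfolding e
    using norm_triangle_ineq[of "0 - \<phi> (Suc 0)" "\<Sum>n. npow s (Suc n) - (\<phi> (Suc (Suc n)) - \<phi> (Suc n))"] by linarith
qed

section \<open>Dirichlet characters and Euler products\<close>

lemmas cong_mod_def = unique_euclidean_semiring_class.cong_def

lemma sum_mod_permute:
  fixes f :: "nat \<Rightarrow> 'a :: comm_monoid_add"
  assumes "coprime u N" "N > 0"
  shows "(\<Sum>k<N. f (u * k mod N)) = (\<Sum>k<N. f k)"
proof -
  have inj: "inj_on (\<lambda>k. u * k mod N) {..<N}"
  proof (rule inj_onI)
    fix x y assume xy: "x \<in> {..<N}" "y \<in> {..<N}" "u * x mod N = u * y mod N"
    hence "[u * x = u * y] (mod N)" unfolding cong_mod_def by simp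
    hence "[x = y] (mod N)" using assms by (simp add: cong_mult_lcancel_nat)
    thus "x = y" using xy by (simp add: cong_mod_def)
  qed
  moreover have "(\<lambda>k. u * k mod N) ` {..<N} = {..<N}"
    by (rule endo_inj_surj[OF _ _ inj]) (use assms in auto)
  ultimately have "bij_betw (\<lambda>k. u * k mod N) {..<N} {..<N}" by (simp add: bij_betw_def)
  thus ?thesis by (rule sum.reindex_bij_betw)
qed

lemma periodic_mod:
  fixes f :: "nat \<Rightarrow> 'a"
  assumes "\<And>n. f (n + N) = f n"
  shows "f (n mod N) = f n"
proof -
  have "f (m + k * N) = f m" for m k
    by (induction k) (use assms[of "m + _ * N"] in \<open>auto simp: algebra_simps\<close>)
  from this[of "n mod N" "n div N"] show ?thesis by simp
qed

lemma periodic_psum_bounded: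
  fixes f :: "nat \<Rightarrow> complex"
  assumes per: "\<And>n. f (n + N) = f n" and N: "N > 0" and z: "psum f N = 0"
  obtains B where "\<And>n. norm (psum f n) \<le> B"
proof -
  have "psum f (n + N) = psum f n" for n
  proof (induction n)
    case (Suc n)
    thus ?case using per[of "Suc n"] by simp
  qed (use z in auto)
  hence "psum f n = psum f (n mod N)" for n by (rule periodic_mod[symmetric])
  moreover have "norm (psum f (n mod N)) \<le> Max ((\<lambda>n. norm (psum f n)) ` {..<N})" for n
    using N by (intro Max_ge) auto
  ultimately show ?thesis using that by metis
qed

lemma psum_period: 
  assumes "\<And>n. f (n + N) = f n" "N > 0"
  shows "psum f N = (\<Sum>k<N. f k :: 'a :: comm_monoid_add)"
proof -
  have "psum f N = (\<Sum>k\<in>{1..<N}. f k) + f N"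
    using assms(2) unfolding psum_def by (cases N) (simp_all add: atLeastLessThanSuc_atLeastAtMost)
  also have "f N = f 0" using assms(1)[of 0] by simp
  also have "(\<Sum>k\<in>{1..<N}. f k) + f 0 = (\<Sum>k<N. f k)"
    using assms(2) by (subst sum.atLeast_Suc_lessThan[of 0 N, unfolded atLeast0LessThan, simplified]) (auto simp: add.commute)
  finally show ?thesis .
qed

definition mu :: "nat \<Rightarrow> complex" where
  "mu n = (if squarefree n then (-1) ^ card (prime_factors n) else 0)"

lemma norm_mu_le: "norm (mu n) \<le> 1"
  by (simp add: mu_def norm_power)

text \<open>Squarefree divisors correspond to sets of prime factors, so the sum is the expansion of
  a product of factors \<open>-1 + 1\<close>, which vanishes unless it is empty.\<close>

lemma sum_mu_divisors:
  assumes "n > 0"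
  shows "(\<Sum>d | d dvd n. mu d) = (if n = 1 then 1 else 0)"
proof -
  let ?P = "prime_factors n"
  have "(\<Sum>d | d dvd n. mu d) = (\<Sum>d | d dvd n \<and> squarefree d. (-1) ^ card (prime_factors d))"
    using assms by (intro sum.mono_neutral_cong_right) (auto simp: mu_def)
  also have "\<dots> = (\<Sum>X\<in>Pow ?P. (-1) ^ card X)"
  proof (rule sum.reindex_bij_witness[where i = "\<lambda>X. \<Prod>X" and j = prime_factors])
    fix d assume d: "d \<in> {d. d dvd n \<and> squarefree d}"
    then have d0: "d \<noteq> 0" using assms by auto
    have "(\<Prod>p\<in>prime_factors d. p ^ multiplicity p d) = d"
      using prod_prime_factors[OF d0] by simp
    moreover have "multiplicity p d = 1" if "p \<in> prime_factors d" for p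
      using that d d0 squarefree_factorial_semiring''[of d] by (auto simp: prime_factors_multiplicity intro: antisym Suc_leI)
    ultimately show "\<Prod>(prime_factors d) = d" by simp
    show "prime_factors d \<in> Pow ?P" using d assms by (auto simp: in_prime_factors_iff intro: dvd_trans)
  next
    fix X assume X: "X \<in> Pow ?P"
    hence fin: "finite X" by (auto intro: finite_subset)
    have pr: "\<And>p. p \<in> X \<Longrightarrow> prime p" using X by auto
    have "squarefree (\<Prod>X)" 
      by (rule squarefree_prod_coprime) (use pr in \<open>auto intro: squarefree_prime primes_coprime\<close>)
    moreover have pf: "prime_factors (\<Prod>X) = X"
      using pr pr[of 0] fin by (subst prime_factors_prod) (auto simp: prime_prime_factors)
    moreover have "\<Prod>X dvd n"
    proof -
      have "\<Prod>X dvd \<Prod>?P" using X by (intro prod_dvd_prod_subset) auto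
      also have "\<dots> dvd (\<Prod>p\<in>?P. p ^ multiplicity p n)"
        by (intro prod_dvd_prod) (auto simp: prime_factors_multiplicity)
      also have "\<dots> = n" using assms prod_prime_factors[of n] by simp
      finally show ?thesis .
    qed
    ultimately show "\<Prod>X \<in> {d. d dvd n \<and> squarefree d}" "prime_factors (\<Prod>X) = X" by auto
  qed auto
  also have "\<dots> = (\<Prod>x\<in>?P. -1 + (1::complex))"
    by (subst prod_add) auto
  also have "\<dots> = (if n = 1 then 1 else 0)"
  proof (cases "n = 1")
    case False
    then obtain p where "prime p" "p dvd n" using prime_factor_nat by blast
    hence "p \<in> ?P" using assms by (auto simp: prime_factors_dvd)
    thus ?thesis using False by (subst prod_zero) auto
  qed auto
  finally show ?thesis .
qed

locale dchar =
  fixes N :: nat and \<xi> :: "nat \<Rightarrow> complex"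
  assumes N_pos: "N > 0"
    and mult: "\<xi> (m * n) = \<xi> m * \<xi> n"
    and periodic: "\<xi> (n + N) = \<xi> n"
    and zero_iff: "\<xi> n = 0 \<longleftrightarrow> \<not> coprime n N"
begin

lemma chi_mod: "\<xi> (n mod N) = \<xi> n"
  using periodic by (rule periodic_mod)

lemma chi_cong: "[m = n] (mod N) \<Longrightarrow> \<xi> m = \<xi> n"
  using chi_mod[of m] chi_mod[of n] by (simp add: cong_mod_def)

lemma chi_1 [simp]: "\<xi> (Suc 0) = 1"
  using mult[of 1 1] zero_iff[of 1] by simp

lemma chi_power: "\<xi> (n ^ k) = \<xi> n ^ k"
  by (induction k) (auto simp: mult)

lemma chi_root: "coprime n N \<Longrightarrow> \<xi> n ^ totient N = 1"
  using chi_cong[OF euler_theorem[of n N]] by (simp add: chi_power)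

lemma norm_chi: "coprime n N \<Longrightarrow> norm (\<xi> n) = 1"
  using arg_cong[OF chi_root, of n norm] N_pos power_eq_imp_eq_base[of "norm (\<xi> n)" "totient N" 1]
  by (simp add: norm_power)

lemma norm_chi_le: "norm (\<xi> n) \<le> 1"
  using norm_chi[of n] zero_iff[of n] by (cases "coprime n N") auto

text \<open>The witness \<open>u\<close> expresses that the character is non-principal, here and
  below. Multiplication by \<open>u\<close> permutes the residues and multiplies the sum by
  \<open>\<xi> u\<close>.\<close>

lemma psum_zero:
  assumes "coprime u N" "\<xi> u \<noteq> 1"
  shows "psum \<xi> N = 0"
proof -
  have "psum \<xi> N = (\<Sum>k<N. \<xi> k)" by (rule psum_period[of \<xi> N, OF periodic N_pos])
  moreover have "(\<Sum>k<N. \<xi> k) = \<xi> u * (\<Sum>k<N. \<xi> k)"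
    using sum_mod_permute[OF assms(1) N_pos, of \<xi>] by (simp add: chi_mod mult sum_distrib_left)
  ultimately show ?thesis using assms(2) by simp
qed

lemma psum_bounded:
  assumes "coprime u N" "\<xi> u \<noteq> 1"
  obtains B where "\<And>n. norm (psum \<xi> n) \<le> B"
  using periodic_psum_bounded[of \<xi> N, OF periodic N_pos psum_zero[OF assms]] by blast

lemma dseries_mu_chi:
  assumes "Re s > 1"
  shows "dseries (\<lambda>n. mu n * \<xi> n) s * dseries \<xi> s = 1"
proof -
  have b: "norm (mu n * \<xi> n) \<le> 1" for n
    using mult_mono[OF norm_mu_le norm_chi_le, of n n] by (simp add: norm_mult)
  have hs: "((\<lambda>n. (\<Sum>d | d dvd n. mu d * \<xi> d * \<xi> (n div d)) * npow s n) has_sum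
          dseries (\<lambda>n. mu n * \<xi> n) s * dseries \<xi> s) {1..}"
    by (rule dseries_mult[OF b norm_chi_le assms])
  have cg: "(\<Sum>d | d dvd n. mu d * \<xi> d * \<xi> (n div d)) * npow s n = (if n = 1 then 1 else 0)" if "n \<in> {1..}" for n
  proof -
    have "(\<Sum>d | d dvd n. mu d * \<xi> d * \<xi> (n div d)) = (\<Sum>d | d dvd n. mu d * \<xi> n)"
      by (rule sum.cong) (auto simp: mult.assoc simp flip: mult)
    also have "\<dots> = (\<Sum>d | d dvd n. mu d) * \<xi> n" by (simp add: sum_distrib_right)
    finally show ?thesis using that sum_mu_divisors[of n] by auto
  qed
  have "((\<lambda>n::nat. if n = 1 then 1 else 0) has_sum dseries (\<lambda>n. mu n * \<xi> n) s * dseries \<xi> s) {1..}"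
    by (rule has_sum_cong[THEN iffD1, OF _ hs]) (rule cg)
  moreover have "((\<lambda>n. if n = 1 then 1 else (0::complex)) has_sum 1) {1::nat..}"
    by (rule has_sum_finite_neutralI[of "{1}"]) auto
  ultimately show ?thesis by (rule has_sum_unique)
qed

text \<open>Multiplying by \<open>1 - \<xi> q * npow s q\<close> subtracts exactly the terms at
  multiples of \<open>q\<close>. Finite products of this kind serve in place of an infinite Euler
  product.\<close>

lemma euler_sieve:
  assumes s: "Re s > 1" and Q: "finite Q" "\<And>p. p \<in> Q \<Longrightarrow> prime p"
  shows "((\<lambda>n. \<xi> n * npow s n) has_sum ((\<Prod>p\<in>Q. 1 - \<xi> p * npow s p) * dseries \<xi> s)) {n\<in>{1..}. \<forall>p\<in>Q. \<not> p dvd n}"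
  using Q
proof (induction Q rule: finite_induct)
  case empty
  then show ?case using dseries_has_sum[of \<xi> 1 s, OF norm_chi_le s] by (simp add: atLeast_def)
next
  case (insert q Q)
  let ?A = "{n\<in>{1..}. \<forall>p\<in>Q. \<not> p dvd n}" and ?v = "(\<Prod>p\<in>Q. 1 - \<xi> p * npow s p) * dseries \<xi> s"
  have q: "prime q" using insert by auto
  have IH: "((\<lambda>n. \<xi> n * npow s n) has_sum ?v) ?A" using insert by auto
  have "((\<lambda>n. (\<xi> q * npow s q) * (\<xi> n * npow s n)) has_sum (\<xi> q * npow s q) * ?v) ?A"
    by (rule has_sum_cmult_right[OF IH])
  also have "?this \<longleftrightarrow> ((\<lambda>n. \<xi> n * npow s n) has_sum (\<xi> q * npow s q) * ?v) {n\<in>?A. q dvd n}"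
  proof (rule has_sum_reindex_bij_witness[where j = "\<lambda>n. q * n" and i = "\<lambda>n. n div q"])
    fix n assume n: "n \<in> ?A"
    have "\<not> p dvd q" if "p \<in> Q" for p
      using that insert q primes_dvd_imp_eq[of p q] by auto
    hence "\<not> p dvd q * n" if "p \<in> Q" for p
      using that n insert(4)[of p] by (auto simp: prime_dvd_mult_iff)
    thus "q * n \<in> {n\<in>?A. q dvd n}" using n q by (auto simp: Suc_le_eq prime_gt_0_nat)
  next
    fix n assume n: "n \<in> {n\<in>?A. q dvd n}"
    then obtain m where m: "n = q * m" by auto
    thus "n div q \<in> ?A" using n q by (auto simp: Suc_le_eq)
  qed (use q in \<open>auto simp: mult npow_mult\<close>)
  finally have "((\<lambda>n. \<xi> n * npow s n) has_sum ?v - (\<xi> q * npow s q) * ?v) (?A - {n\<in>?A. q dvd n})"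
    by (intro has_sum_Diff[OF IH]) auto
  also have "?A - {n\<in>?A. q dvd n} = {n\<in>{1..}. \<forall>p\<in>insert q Q. \<not> p dvd n}" by auto
  also have "?v - (\<xi> q * npow s q) * ?v = (\<Prod>p\<in>insert q Q. 1 - \<xi> p * npow s p) * dseries \<xi> s"
    using insert by (simp add: algebra_simps)
  finally show ?case .
qed

text \<open>After sieving by all primes up to \<open>y\<close>, every remaining integer other than 1
  exceeds \<open>y\<close>, so the distance from 1 is at most a tail of the series of absolute
  values.\<close>

lemma euler_limit:
  assumes s: "Re s > 1"
  shows "(\<lambda>y. (\<Prod>p | prime p \<and> p \<le> y. 1 - \<xi> p * npow s p) * dseries \<xi> s) \<longlonglongrightarrow> 1"
proof -
  let ?v = "\<lambda>y. (\<Prod>p | prime p \<and> p \<le> y. 1 - \<xi> p * npow s p) * dseries \<xi> s"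
  have "norm (?v y - 1) \<le> real y powr (-(Re s - 1)) / (Re s - 1)" if y: "y \<ge> 1" for y
  proof -
    let ?Q = "{p. prime p \<and> p \<le> y}"
    let ?A = "{n\<in>{1..}. \<forall>p\<in>?Q. \<not> p dvd n}"
    have "finite ?Q" by (rule finite_subset[of _ "{..y}"]) auto
    hence "((\<lambda>n. \<xi> n * npow s n) has_sum ?v y) ?A" by (intro euler_sieve s) auto
    moreover have "((\<lambda>n. \<xi> n * npow s n) has_sum 1) {1}" by (rule has_sum_finiteI) auto
    moreover have "{1} \<subseteq> ?A" by auto
    ultimately have hs: "((\<lambda>n. \<xi> n * npow s n) has_sum ?v y - 1) (?A - {1})" by (rule has_sum_Diff)
    have sub: "?A - {1} \<subseteq> {Suc y..}"
    proof
      fix n assume n: "n \<in> ?A - {1}"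
      then obtain p where p: "prime p" "p dvd n" using prime_factor_nat[of n] by auto
      hence "p > y" using n by force
      moreover have "p \<le> n" using p n by (intro dvd_imp_le) auto
      ultimately show "n \<in> {Suc y..}" by auto
    qed
    have sm: "(\<lambda>n. real n powr (-Re s)) summable_on {1..}" by (rule real_npow_summable[OF s])
    have "bij_betw (\<lambda>n. Suc (n + y)) UNIV {Suc y..}" by (rule bij_betwI[where g = "\<lambda>n. n - Suc y"]) auto
    hence "(\<Sum>\<^sub>\<infinity>n\<in>{Suc y..}. real n powr (-Re s)) = (\<Sum>\<^sub>\<infinity>n. real (Suc (n + y)) powr (-Re s))"
      by (rule infsum_reindex_bij_betw[symmetric])
    also have "\<dots> = (\<Sum>n. real (Suc (n + y)) powr (-1 - (Re s - 1)))"
    proof -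
      have "summable (\<lambda>n. real (Suc (n + y)) powr (-1 - (Re s - 1)))"
        using s y by (intro powr_tail_summable) auto
      from norm_summable_imp_has_sum[OF _ summable_sums[OF this]] this show ?thesis
        by (intro infsumI) simp
    qed
    also have "\<dots> \<le> real y powr (-(Re s - 1)) / (Re s - 1)"
      using s y by (intro powr_tail_summable) auto
    finally have tail: "(\<Sum>\<^sub>\<infinity>n\<in>{Suc y..}. real n powr (-Re s)) \<le> real y powr (-(Re s - 1)) / (Re s - 1)" .
    have "norm (?v y - 1) \<le> (\<Sum>\<^sub>\<infinity>n\<in>{Suc y..}. real n powr (-Re s))"
    proof (rule order_trans[OF norm_has_sum_bound[OF _ hs]])
      show hn: "((\<lambda>n. norm (\<xi> n * npow s n)) has_sum (\<Sum>\<^sub>\<infinity>n\<in>?A - {1}. norm (\<xi> n * npow s n))) (?A - {1})"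
        by (intro has_sum_infsum summable_on_subset_banach[OF dirichlet_abs_summable[of \<xi> 1 s, OF norm_chi_le s]]) auto
      have ht: "((\<lambda>n. real n powr (-Re s)) has_sum (\<Sum>\<^sub>\<infinity>n\<in>{Suc y..}. real n powr (-Re s))) {Suc y..}"
        by (intro has_sum_infsum summable_on_subset_banach[OF sm]) auto
      show "(\<Sum>\<^sub>\<infinity>n\<in>?A - {1}. norm (\<xi> n * npow s n)) \<le> (\<Sum>\<^sub>\<infinity>n\<in>{Suc y..}. real n powr (-Re s))"
      proof (rule has_sum_mono_neutral[OF hn ht])
        fix n assume "n \<in> ?A - {1} - {Suc y..}" thus "norm (\<xi> n * npow s n) \<le> 0" using sub by blast
      next
        fix n assume n: "n \<in> (?A - {1}) \<inter> {Suc y..}"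
        thus "norm (\<xi> n * npow s n) \<le> real n powr - Re s"
          using norm_chi_le[of n] by (auto simp: norm_mult norm_npow intro!: mult_left_le_one_le)
      qed auto
    qed
    with tail show ?thesis by linarith
  qed
  moreover have "(\<lambda>y. real y powr (-(Re s - 1)) / (Re s - 1)) \<longlonglongrightarrow> 0"
    using s by (intro tendsto_divide_zero tendsto_neg_powr) (auto simp: filterlim_real_sequentially)
  ultimately have "(\<lambda>y. ?v y - 1) \<longlonglongrightarrow> 0"
    by (intro Lim_null_comparison[of "\<lambda>y. ?v y - 1"]) (auto simp: eventually_sequentially)
  thus ?thesis by (simp add: LIM_zero_iff)
qed

end

section \<open>Non-vanishing on the line Re s = 1\<close>

text \<open>In the power series of the logarithm, the coefficient of \<open>- r ^ n / n\<close> has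
  real part \<open>3 + 4 * cos t + cos (2 * t) = 2 * (1 + cos t)^2\<close>, where
  \<open>cos t\<close> is the real part of \<open>w ^ n\<close>.\<close>

lemma mertens_ineq:
  fixes w :: complex and r :: real
  assumes r: "0 \<le> r" "r < 1" and w: "norm w = 1"
  shows "norm (1 - of_real r :: complex) ^ 3 * norm (1 - of_real r * w) ^ 4 * norm (1 - of_real r * w^2) \<le> 1"
proof -
  \<comment> \<open>The term at \<open>n = 0\<close> is a division by zero and hence 0.\<close>
  have ln: "(\<lambda>n. - (z ^ n / of_nat n)) sums Ln (1 - z)" if "norm z < 1" for z :: complex
  proof -
    have "(\<lambda>n. (-1) ^ Suc n / of_nat n * (-z) ^ n) sums Ln (1 + (-z))"
      by (rule Ln_series) (use that in auto)
    moreover have "(-1) ^ Suc n / of_nat n * (-z) ^ n = - (z ^ n / of_nat n)" for n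
    proof -
      have "(-1) ^ n * (-z) ^ n = z ^ n" by (simp flip: power_mult_distrib)
      thus ?thesis by simp
    qed
    ultimately show ?thesis by (simp only: add_uminus_conv_diff)
  qed
  have nr: "norm (of_real r * w) < 1" "norm (of_real r * w^2) < 1" "norm (of_real r :: complex) < 1"
    using r w by (auto simp: norm_mult norm_power)
  let ?z = "3 * Ln (1 - of_real r) + 4 * Ln (1 - of_real r * w) + Ln (1 - of_real r * w^2)"
  have "(\<lambda>n. 3 * - ((of_real r) ^ n / of_nat n) + 4 * - ((of_real r * w) ^ n / of_nat n) + - ((of_real r * w^2) ^ n / of_nat n)) sums ?z"
    using nr by (intro sums_add sums_mult ln) auto
  hence "(\<lambda>n. Re (3 * - ((of_real r) ^ n / of_nat n) + 4 * - ((of_real r * w) ^ n / of_nat n) + - ((of_real r * w^2) ^ n / of_nat n))) sums Re ?z"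
    by (rule sums_Re)
  moreover have "Re (3 * - ((of_real r) ^ n / of_nat n) + 4 * - ((of_real r * w) ^ n / of_nat n) + - ((of_real r * w^2) ^ n / of_nat n)) \<le> 0" for n
  proof -
    define v where "v = w ^ n"
    have v: "norm v = 1" using w by (simp add: v_def norm_power)
    hence "(Re v)\<^sup>2 + (Im v)\<^sup>2 = 1" by (simp add: cmod_def)
    hence re: "Re (v ^ 2) = 2 * (Re v)\<^sup>2 - 1" by (simp add: power2_eq_square algebra_simps)
    have "3 * - ((of_real r) ^ n / of_nat n) + 4 * - ((of_real r * w) ^ n / of_nat n) + - ((of_real r * w^2) ^ n / of_nat n)
        = - ((r ^ n / real n) *\<^sub>R (3 + 4 * v + v ^ 2))"
      by (simp add: scaleR_conv_of_real v_def power_mult_distrib algebra_simps add_divide_distrib flip: power_mult)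
    also have "Re \<dots> = - ((r ^ n / real n) * (2 * (1 + Re v)\<^sup>2))"
      unfolding uminus_complex.sel scaleR_complex.sel plus_complex.sel re by (simp add: algebra_simps power2_eq_square)
    also have "\<dots> \<le> 0" using r by simp
    finally show ?thesis .
  qed
  ultimately have "Re ?z \<le> 0"
    by (metis (no_types, lifting) sums_le sums_zero)
  hence le: "norm (exp ?z) \<le> 1" unfolding norm_exp_eq_Re by (simp only: exp_le_one_iff)
  have eq: "exp ?z = (1 - of_real r) ^ 3 * (1 - of_real r * w) ^ 4 * (1 - of_real r * w^2)"
  proof -
    have el: "exp (Ln (1 - z)) = 1 - z" if "norm z < 1" for z :: complex using that by (intro exp_Ln) auto
    have "exp (of_nat 3 * Ln (1 - of_real r) + of_nat 4 * Ln (1 - of_real r * w) + Ln (1 - of_real r * w^2)) = (1 - of_real r) ^ 3 * (1 - of_real r * w) ^ 4 * (1 - of_real r * w^2)"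
      unfolding exp_add exp_of_nat_mult by (simp only: el[OF nr(1)] el[OF nr(2)] el[OF nr(3)])
    thus ?thesis by simp
  qed
  show ?thesis using le unfolding eq norm_mult norm_power .
qed

definition chi0 :: "nat \<Rightarrow> nat \<Rightarrow> complex" where
  "chi0 N n = (if coprime n N then 1 else 0)"

context dchar
begin

lemma dchar_chi0: "dchar N (chi0 N)"
proof (rule dchar.intro)
  show "chi0 N (m * n) = chi0 N m * chi0 N n" for m n by (auto simp: chi0_def)
  have "coprime (n + N) N \<longleftrightarrow> coprime n N" for n by (simp only: coprime_iff_gcd_eq_1 gcd_add1)
  thus "chi0 N (n + N) = chi0 N n" for n by (simp only: chi0_def)
qed (auto simp: chi0_def N_pos)

lemma dchar_square: "dchar N (\<lambda>n. \<xi> n ^ 2)"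
  by (rule dchar.intro) (auto simp: N_pos mult power_mult_distrib periodic zero_iff)

text \<open>The local inequality is multiplied over the primes up to \<open>y\<close>. By
  \<open>euler_limit\<close> the finite products times the series tend to 1, so the series
  themselves must have a product of at least 1. At primes dividing \<open>N\<close> all local
  factors are 1.\<close>

lemma mertens_product:
  assumes \<sigma>: "\<sigma> > 1"
  shows "norm (dseries (chi0 N) (of_real \<sigma>)) ^ 3 * norm (dseries \<xi> (Complex \<sigma> t)) ^ 4 * norm (dseries (\<lambda>n. \<xi> n ^ 2) (Complex \<sigma> (2*t))) \<ge> 1"
proof -
  let ?P = "\<lambda>y. {p. prime p \<and> p \<le> (y::nat)}"
  let ?s0 = "complex_of_real \<sigma>" and ?s1 = "Complex \<sigma> t" and ?s2 = "Complex \<sigma> (2*t)"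
  let ?E = "\<lambda>f s y. \<Prod>p\<in>?P y. 1 - f p * npow s p"
  interpret c0: dchar N "chi0 N" by (rule dchar_chi0)
  interpret c2: dchar N "\<lambda>n. \<xi> n ^ 2" by (rule dchar_square)
  have "(\<lambda>y. norm (?E (chi0 N) ?s0 y * dseries (chi0 N) ?s0) ^ 3 * norm (?E \<xi> ?s1 y * dseries \<xi> ?s1) ^ 4
       * norm (?E (\<lambda>n. \<xi> n ^ 2) ?s2 y * dseries (\<lambda>n. \<xi> n ^ 2) ?s2)) \<longlonglongrightarrow> norm (1::complex) ^ 3 * norm (1::complex) ^ 4 * norm (1::complex)"
    by (intro tendsto_intros c0.euler_limit euler_limit c2.euler_limit) (use \<sigma> in auto)
  moreover have "norm (?E (chi0 N) ?s0 y * dseries (chi0 N) ?s0) ^ 3 * norm (?E \<xi> ?s1 y * dseries \<xi> ?s1) ^ 4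
       * norm (?E (\<lambda>n. \<xi> n ^ 2) ?s2 y * dseries (\<lambda>n. \<xi> n ^ 2) ?s2) \<le> norm (dseries (chi0 N) ?s0) ^ 3 * norm (dseries \<xi> ?s1) ^ 4 * norm (dseries (\<lambda>n. \<xi> n ^ 2) ?s2)" for y
  proof -
    have loc: "norm (1 - chi0 N p * npow ?s0 p) ^ 3 * norm (1 - \<xi> p * npow ?s1 p) ^ 4 * norm (1 - \<xi> p ^ 2 * npow ?s2 p) \<le> 1" if p: "prime p" for p
    proof (cases "coprime p N")
      case True
      have p1: "p > 1" using prime_gt_1_nat[OF p] .
      define r where "r = real p powr (-\<sigma>)"
      define w where "w = \<xi> p * npow (Complex 0 t) p"
      have "r < 1" using p1 \<sigma> by (auto simp: r_def powr_less_one)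
      moreover have "r \<ge> 0" by (simp add: r_def)
      moreover have "norm w = 1" using p1 norm_chi[OF True] by (simp add: w_def norm_mult norm_npow)
      moreover have e0: "npow ?s0 p = of_real r"
        using p1 by (simp add: npow_def r_def powr_of_real[symmetric])
      moreover have "npow ?s1 p = npow ?s0 p * npow (Complex 0 t) p"
        unfolding npow_def powr_add[symmetric] by (simp add: complex_eq_iff[of "- Complex \<sigma> t"] Complex_eq)
      moreover have "npow ?s2 p = npow ?s0 p * npow (Complex 0 t) p ^ 2"
        unfolding npow_def power2_eq_square powr_add[symmetric] by (simp add: Complex_eq algebra_simps)
      ultimately show ?thesis
        using mertens_ineq[of r w] True by (simp add: chi0_def w_def power_mult_distrib mult_ac)
    next
      case False
      thus ?thesis using zero_iff[of p] by (simp add: chi0_def)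
    qed
    have "norm (?E (chi0 N) ?s0 y) ^ 3 * norm (?E \<xi> ?s1 y) ^ 4 * norm (?E (\<lambda>n. \<xi> n ^ 2) ?s2 y)
      = (\<Prod>p\<in>?P y. norm (1 - chi0 N p * npow ?s0 p) ^ 3 * norm (1 - \<xi> p * npow ?s1 p) ^ 4 * norm (1 - \<xi> p ^ 2 * npow ?s2 p))"
      by (simp add: prod_norm[symmetric] prod.distrib prod_power_distrib)
    also have "\<dots> \<le> 1" by (rule prod_le_1) (use loc in auto)
    finally have le: "norm (?E (chi0 N) ?s0 y) ^ 3 * norm (?E \<xi> ?s1 y) ^ 4 * norm (?E (\<lambda>n. \<xi> n ^ 2) ?s2 y) \<le> 1" .
    show ?thesis
      using mult_right_mono[OF le, of "norm (dseries (chi0 N) ?s0) ^ 3 * norm (dseries \<xi> ?s1) ^ 4 * norm (dseries (\<lambda>n. \<xi> n ^ 2) ?s2)"]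
      by (simp add: norm_mult power_mult_distrib mult_ac)
  qed
  ultimately show ?thesis by (intro LIMSEQ_le_const2) auto
qed

lemma dseries_chi0_bound:
  assumes "\<sigma> > 1"
  shows "norm (dseries (chi0 N) (of_real \<sigma>)) \<le> 1 / (\<sigma> - 1) + 2 * \<sigma>"
proof -
  have "norm (dseries (chi0 N) (of_real \<sigma>)) \<le> (\<Sum>\<^sub>\<infinity>n\<in>{1..}. real n powr (- Re (of_real \<sigma>)))"
    by (rule dseries_norm_le) (use assms in \<open>auto simp: chi0_def\<close>)
  also have "\<dots> = norm (of_real (\<Sum>\<^sub>\<infinity>n\<in>{1..}. real n powr (- \<sigma>)) :: complex)"
    by (subst norm_of_real) (simp add: infsum_nonneg)
  also have "of_real (\<Sum>\<^sub>\<infinity>n\<in>{1..}. real n powr (- \<sigma>)) = dseries (\<lambda>_. 1) (of_real \<sigma>)"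
  proof -
    have "((\<lambda>n. of_real (real n powr (- \<sigma>))) has_sum (of_real (\<Sum>\<^sub>\<infinity>n\<in>{1..}. real n powr (- \<sigma>)) :: complex)) {1..}"
      by (intro has_sum_of_real has_sum_infsum real_npow_summable assms)
    hence "((\<lambda>n. 1 * npow (of_real \<sigma>) n) has_sum (of_real (\<Sum>\<^sub>\<infinity>n\<in>{1..}. real n powr (- \<sigma>)) :: complex)) {1..}"
      by (rule has_sum_cong[THEN iffD1, rotated]) (auto simp: npow_def powr_of_real[symmetric])
    thus ?thesis unfolding dseries_def by (rule infsumI[symmetric])
  qed
  also have "norm (dseries (\<lambda>_. 1) (of_real \<sigma>)) \<le> 1 / norm (complex_of_real \<sigma> - 1) + 2 * norm (complex_of_real \<sigma>)"
    by (rule zeta_bound) (use assms in auto)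
  also have "complex_of_real \<sigma> - 1 = of_real (\<sigma> - 1)" by simp
  finally show ?thesis using assms by (simp del: of_real_diff)
qed

text \<open>With \<open>c\<close> the mean of \<open>chi0 N\<close> over a period, the difference
  has bounded partial sums and extends holomorphically. The behaviour of the principal series near
  the line is thereby reduced to that of zeta.\<close>

lemma chi0_decomp:
  obtains c B where "\<And>n. norm (psum (\<lambda>n. chi0 N n - c) n) \<le> B"
    "\<And>s. Re s > 1 \<Longrightarrow> dseries (chi0 N) s = c * dseries (\<lambda>_. 1) s + Lext (\<lambda>n. chi0 N n - c) s"
proof -
  define c where "c = psum (chi0 N) N / of_nat N"
  interpret c0: dchar N "chi0 N" by (rule dchar_chi0)
  have "psum (\<lambda>n. chi0 N n - c) m = psum (chi0 N) m - of_nat m * c" for m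
    by (induction m) (auto simp: algebra_simps)
  hence "psum (\<lambda>n. chi0 N n - c) N = 0" using N_pos by (simp add: c_def)
  then obtain B where B: "\<And>n. norm (psum (\<lambda>n. chi0 N n - c) n) \<le> B"
    using periodic_psum_bounded[of "\<lambda>n. chi0 N n - c" N] N_pos c0.periodic by auto
  have bd: "norm (chi0 N n - c) \<le> 1 + norm c" for n
    using norm_triangle_ineq4[of "chi0 N n" c] by (auto simp: chi0_def split: if_splits)
  have "dseries (chi0 N) s = c * dseries (\<lambda>_. 1) s + Lext (\<lambda>n. chi0 N n - c) s" if s: "Re s > 1" for s
  proof -
    have "((\<lambda>n. c * (1 * npow s n) + (chi0 N n - c) * npow s n) has_sum c * dseries (\<lambda>_. 1) s + dseries (\<lambda>n. chi0 N n - c) s) {1..}"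
      by (intro has_sum_add has_sum_cmult_right dseries_has_sum[of _ 1] dseries_has_sum[OF bd]) (use s in auto)
    hence "((\<lambda>n. chi0 N n * npow s n) has_sum c * dseries (\<lambda>_. 1) s + dseries (\<lambda>n. chi0 N n - c) s) {1..}"
      by (simp add: algebra_simps)
    hence "dseries (chi0 N) s = c * dseries (\<lambda>_. 1) s + dseries (\<lambda>n. chi0 N n - c) s"
      unfolding dseries_def[of "chi0 N"] by (rule infsumI)
    thus ?thesis using Lext_eq_dseries[OF B bd s] by simp
  qed
  with B show ?thesis using that by blast
qed

text \<open>A zero would make the middle factor \<open>O(h)\<close> at distance \<open>h\<close> to
  the right of the line. Its fourth power outweighs the third power of the bound
  \<open>5 / h\<close> for the principal series, while the third factor stays bounded, so the
  product would tend to 0 against \<open>mertens_product\<close>.\<close>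

lemma nonvanishing_mertens:
  assumes u: "coprime u N" "\<xi> u \<noteq> 1"
    and t: "t \<noteq> 0 \<or> (\<exists>v. coprime v N \<and> \<xi> v ^ 2 \<noteq> 1)"
  shows "Lext \<xi> (Complex 1 t) \<noteq> 0"
proof
  assume zero: "Lext \<xi> (Complex 1 t) = 0"
  define h where "h = (\<lambda>k::nat. 1 / real (Suc k))"
  have h: "h k > 0" "h k \<le> 1" for k by (auto simp: h_def)
  have hlim: "h \<longlonglongrightarrow> 0" unfolding h_def by (rule LIMSEQ_Suc[OF lim_1_over_n])
  obtain B where B: "\<And>n. norm (psum \<xi> n) \<le> B" using psum_bounded[OF u] by blast
  have hol: "Lext \<xi> holomorphic_on {s. Re s > 0}" by (rule Lext_holomorphic[OF B])
  then obtain D where D: "(Lext \<xi> has_field_derivative D) (at (Complex 1 t))"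
    using holomorphic_on_imp_differentiable_at[OF hol open_halfspace_Re_gt, of "Complex 1 t"]
    by (auto simp: field_differentiable_def)
  have seq: "filterlim (\<lambda>k. Complex (1 + h k) \<tau>) (at (Complex 1 \<tau>)) sequentially" for \<tau>
  proof -
    have "(\<lambda>k. Complex (1 + h k) \<tau>) \<longlonglongrightarrow> Complex (1 + 0) \<tau>"
      by (intro tendsto_Complex tendsto_intros hlim)
    thus ?thesis using h by (auto simp: filterlim_at less_imp_neq[symmetric])
  qed
  have "((\<lambda>z. (Lext \<xi> z - Lext \<xi> (Complex 1 t)) / (z - Complex 1 t)) \<longlongrightarrow> D) (at (Complex 1 t))"
    using D by (simp add: has_field_derivative_iff)
  from filterlim_compose[OF this seq]
  have "(\<lambda>k. Lext \<xi> (Complex (1 + h k) t) / (Complex (1 + h k) t - Complex 1 t)) \<longlonglongrightarrow> D" by (simp add: zero)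
  moreover have "Complex (1 + h k) t - Complex 1 t = of_real (h k)" for k by (simp add: complex_eq_iff)
  ultimately have lim1: "(\<lambda>k. norm (Lext \<xi> (Complex (1 + h k) t) / of_real (h k)) ^ 4) \<longlonglongrightarrow> norm D ^ 4"
    by (intro tendsto_intros) simp
  have L1: "Lext \<xi> (Complex (1 + h k) t) = dseries \<xi> (Complex (1 + h k) t)" for k
    by (rule Lext_eq_dseries[OF B norm_chi_le]) (use h in auto)
  obtain K where K: "\<And>k. norm (dseries (\<lambda>n. \<xi> n ^ 2) (Complex (1 + h k) (2*t))) \<le> K"
  proof -
    interpret c2: dchar N "\<lambda>n. \<xi> n ^ 2" by (rule dchar_square)
    have ext_bdd: "\<exists>K. \<forall>k. norm (Lext f (Complex (1 + h k) (2*t))) \<le> K" if "\<And>n. norm (psum f n) \<le> B'" for f B'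
    proof -
      have "isCont (Lext f) (Complex 1 (2*t))"
        using holomorphic_on_imp_continuous_on[OF Lext_holomorphic[OF that]] 
        by (auto simp: continuous_on_eq_continuous_at open_halfspace_Re_gt)
      hence "(\<lambda>k. Lext f (Complex (1 + h k) (2*t))) \<longlonglongrightarrow> Lext f (Complex 1 (2*t))"
        using filterlim_compose[OF _ seq] by (auto simp: isCont_def)
      hence "Bseq (\<lambda>k. Lext f (Complex (1 + h k) (2*t)))"
        by (rule convergent_imp_Bseq[OF convergentI])
      thus ?thesis by (auto simp: Bseq_def)
    qed
    show ?thesis
    proof (cases "\<exists>v. coprime v N \<and> \<xi> v ^ 2 \<noteq> 1")
      case True
      then obtain v where v: "coprime v N" "\<xi> v ^ 2 \<noteq> 1" by auto
      then obtain B' where B': "\<And>n. norm (psum (\<lambda>n. \<xi> n ^ 2) n) \<le> B'" using c2.psum_bounded by blast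
      have "Lext (\<lambda>n. \<xi> n ^ 2) (Complex (1 + h k) (2*t)) = dseries (\<lambda>n. \<xi> n ^ 2) (Complex (1 + h k) (2*t))" for k
        by (rule Lext_eq_dseries[OF B' c2.norm_chi_le]) (use h in auto)
      thus ?thesis using ext_bdd[OF B'] that by auto
    next
      case False
      \<comment> \<open>Here the square of the character is principal and its series has a pole at
        1; \<open>t \<noteq> 0\<close> keeps the points at height \<open>2 * t\<close> away from
        it.\<close>
      hence t0: "t \<noteq> 0" using t by auto
      have eq: "(\<lambda>n. \<xi> n ^ 2) = chi0 N" using False zero_iff by (auto simp: chi0_def fun_eq_iff)
      obtain c B' where c: "\<And>n. norm (psum (\<lambda>n. chi0 N n - c) n) \<le> B'"
         "\<And>s. Re s > 1 \<Longrightarrow> dseries (chi0 N) s = c * dseries (\<lambda>_. 1) s + Lext (\<lambda>n. chi0 N n - c) s"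
        using chi0_decomp by blast
      from ext_bdd[OF c(1)] obtain K where K: "\<And>k. norm (Lext (\<lambda>n. chi0 N n - c) (Complex (1 + h k) (2*t))) \<le> K" by blast
      have "norm (dseries (chi0 N) (Complex (1 + h k) (2*t))) \<le> norm c * (1 / (2 * \<bar>t\<bar>) + 2 * (2 + 2 * \<bar>t\<bar>)) + K" for k
      proof -
        let ?s = "Complex (1 + h k) (2*t)"
        have s: "Re ?s > 1" using h by simp
        have n1: "norm (?s - 1) \<ge> 2 * \<bar>t\<bar>" using abs_Im_le_cmod[of "?s - 1"] by (simp add: abs_mult)
        have n2: "norm ?s \<le> 2 + 2 * \<bar>t\<bar>" using cmod_le[of ?s] h[of k] by (simp add: abs_mult)
        have "norm (dseries (\<lambda>_. 1) ?s) \<le> 1 / norm (?s - 1) + 2 * norm ?s" by (rule zeta_bound[OF s])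
        also have "\<dots> \<le> 1 / (2 * \<bar>t\<bar>) + 2 * (2 + 2 * \<bar>t\<bar>)"
          using n1 n2 t0 by (intro add_mono divide_left_mono mult_left_mono) (auto intro!: mult_pos_pos)
        finally have "norm (c * dseries (\<lambda>_. 1) ?s) \<le> norm c * (1 / (2 * \<bar>t\<bar>) + 2 * (2 + 2 * \<bar>t\<bar>))"
          unfolding norm_mult by (intro mult_left_mono) auto
        thus ?thesis unfolding c(2)[OF s] by (intro order_trans[OF norm_triangle_ineq] add_mono K)
      qed
      thus ?thesis using that unfolding eq by blast
    qed
  qed
  have "1 \<le> 5 ^ 3 * norm (Lext \<xi> (Complex (1 + h k) t) / of_real (h k)) ^ 4 * (h k * K)" for k
  proof -
    let ?\<sigma> = "1 + h k"
    have "1 \<le> norm (dseries (chi0 N) (of_real ?\<sigma>)) ^ 3 * norm (dseries \<xi> (Complex ?\<sigma> t)) ^ 4 * norm (dseries (\<lambda>n. \<xi> n ^ 2) (Complex ?\<sigma> (2*t)))"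
      by (rule mertens_product) (use h in auto)
    also have "\<dots> \<le> (5 / h k) ^ 3 * norm (dseries \<xi> (Complex ?\<sigma> t)) ^ 4 * K"
    proof (intro mult_mono power_mono K)
      have "norm (dseries (chi0 N) (of_real ?\<sigma>)) \<le> 1 / (?\<sigma> - 1) + 2 * ?\<sigma>"
        by (rule dseries_chi0_bound) (use h in auto)
      also have "\<dots> \<le> 1 / h k + 4 * 1" using h[of k] by simp
      also have "\<dots> \<le> 1 / h k + 4 * (1 / h k)" using h[of k] by (intro add_left_mono mult_left_mono) auto
      finally show "norm (dseries (chi0 N) (of_real ?\<sigma>)) \<le> 5 / h k" by simp
    qed (use h in \<open>auto simp: less_imp_le\<close>)
    also have "\<dots> = 5 ^ 3 * norm (Lext \<xi> (Complex (1 + h k) t) / of_real (h k)) ^ 4 * (h k * K)"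
      unfolding L1 using h[of k] by (simp add: norm_divide power_divide field_simps power3_eq_cube power4_eq_xxxx)
    finally show ?thesis .
  qed
  moreover have "(\<lambda>k. 5 ^ 3 * norm (Lext \<xi> (Complex (1 + h k) t) / of_real (h k)) ^ 4 * (h k * K)) \<longlonglongrightarrow> 5 ^ 3 * norm D ^ 4 * (0 * K)"
    by (intro tendsto_mult lim1 hlim tendsto_const)
  ultimately have "1 \<le> 5 ^ 3 * norm D ^ 4 * (0 * K)"
    by (intro LIMSEQ_le_const) auto
  thus False by simp
qed

end

section \<open>Non-vanishing at s = 1 for real characters\<close>

lemma prime_power_decomposition:
  assumes "k > (1::nat)"
  obtains p a m where "prime p" "k = p ^ a * m" "\<not> p dvd m" "0 < m" "m < k"
proof -
  obtain p where p: "prime p" "p dvd k" using prime_factor_nat[of k] assms by auto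
  obtain m where m: "k = p ^ multiplicity p k * m" "\<not> p dvd m"
    by (rule multiplicity_decompose'[of k p]) (use assms prime_gt_1_nat[OF p(1)] in auto)
  have "multiplicity p k > 0" using p assms by (simp add: prime_multiplicity_gt_zero_iff)
  hence "p ^ multiplicity p k > 1" by (intro one_less_power prime_gt_1_nat p)
  moreover have m0: "m > 0" using m assms by (auto intro!: Nat.gr0I)
  ultimately have "m < k" using m by (metis nat_mult_less_cancel1 mult.commute mult_1 n_less_m_mult_n)
  with that[OF p(1) m m0] show ?thesis .
qed

locale real_completely_multiplicative =
  fixes e :: "nat \<Rightarrow> real"
  assumes e_mult: "e (m * n) = e m * e n" and e_1: "e 1 = 1" and e_range: "e n \<in> {-1, 0, 1}"
begin

definition divisor_sum :: "nat \<Rightarrow> real" where "divisor_sum k = (\<Sum>d | d dvd k. e d)"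

lemma e_power: "e (m ^ k) = e m ^ k"
  using e_1 by (induction k) (auto simp: e_mult)

text \<open>Divisors of \<open>p ^ a * m\<close> are uniquely of the form \<open>p ^ j * d\<close>
  with \<open>j \<le> a\<close> and \<open>d dvd m\<close>, and \<open>e\<close> is completely
  multiplicative.\<close>

lemma divisor_sum_prime_power_mult:
  assumes p: "prime p" "\<not> p dvd m" "m > 0"
  shows "divisor_sum (p ^ a * m) = (\<Sum>j\<le>a. e p ^ j) * divisor_sum m"
proof -
  have p0: "p > 0" using p prime_gt_0_nat by blast
  have "(\<Sum>j\<le>a. e p ^ j) * divisor_sum m = (\<Sum>(j,d)\<in>{..a} \<times> {d. d dvd m}. e p ^ j * e d)"
    unfolding divisor_sum_def sum_product by (simp add: sum.cartesian_product)
  also have "\<dots> = (\<Sum>d | d dvd p ^ a * m. e d)"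
  proof (rule sum.reindex_bij_witness[where j = "\<lambda>(j,d). p ^ j * d" and i = "\<lambda>n. (multiplicity p n, n div p ^ multiplicity p n)"])
    fix x assume "x \<in> {..a} \<times> {d. d dvd m}"
    then obtain j d where x: "x = (j, d)" "j \<le> a" "d dvd m" by auto
    hence d: "\<not> p dvd d" "d > 0" using p by (auto dest: dvd_trans intro: Nat.gr0I)
    have "multiplicity p (p ^ j * d) = j"
      using d p by (intro multiplicity_eqI) (auto simp: prime_dvd_mult_iff)
    thus "(multiplicity p (case x of (j, d) \<Rightarrow> p ^ j * d), (case x of (j, d) \<Rightarrow> p ^ j * d) div p ^ multiplicity p (case x of (j, d) \<Rightarrow> p ^ j * d)) = x"
      using x p0 by simp
    show "(case x of (j, d) \<Rightarrow> p ^ j * d) \<in> {d. d dvd p ^ a * m}" using x by (auto intro!: mult_dvd_mono le_imp_power_dvd)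
    show "e (case x of (j, d) \<Rightarrow> p ^ j * d) = (case x of (j, d) \<Rightarrow> e p ^ j * e d)" using x by (simp add: e_mult e_power)
  next
    fix n assume "n \<in> {d. d dvd p ^ a * m}"
    hence n: "n dvd p ^ a * m" by simp
    have n0: "n > 0" using n p p0 by (auto intro!: Nat.gr0I)
    let ?k = "multiplicity p n"
    have dv: "p ^ ?k dvd n" by (rule multiplicity_dvd)
    show "(case (?k, n div p ^ ?k) of (j, d) \<Rightarrow> p ^ j * d) = n" using dv by simp
    have "?k \<le> multiplicity p (p ^ a * m)" using n p p0 by (intro dvd_imp_multiplicity_le) auto
    also have "\<dots> = a" using p by (intro multiplicity_eqI) (auto simp: prime_dvd_mult_iff p0)
    finally have "?k \<le> a" .
    moreover have "n div p ^ ?k dvd m"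
    proof -
      have "\<not> p dvd n div p ^ ?k"
        using multiplicity_decompose[of n p] n0 p by (metis dv dvd_mult_div_cancel less_numeral_extra(3) multiplicity_decompose' not_prime_unit nonzero_mult_div_cancel_left power_not_zero p0)
      hence "coprime (n div p ^ ?k) (p ^ a)" using p
        by (intro coprime_power_right_iff[THEN iffD2] disjI1) (metis coprime_commute prime_imp_coprime)
      moreover have "n div p ^ ?k dvd p ^ a * m" using n dv by (metis dvd_trans dvd_div_mult_self dvd_triv_left)
      ultimately show ?thesis by (simp add: coprime_dvd_mult_right_iff)
    qed
    ultimately show "(?k, n div p ^ ?k) \<in> {..a} \<times> {d. d dvd m}" by simp
  qed
  finally show ?thesis by (simp add: divisor_sum_def)
qed

text \<open>For \<open>e p = -1\<close> the sum alternates between 1 and 0, for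
  \<open>e p = 0\<close> it is 1, and for \<open>e p = 1\<close> it is \<open>a + 1\<close>. These
  are the local factors of \<open>divisor_sum\<close>; at a square all exponents are even, which
  yields the lower bound 1 there.\<close>

lemma geom_nonneg: "(\<Sum>j\<le>a. e p ^ j) \<ge> 0" and geom_even: "even a \<Longrightarrow> (\<Sum>j\<le>a. e p ^ j) \<ge> 1"
proof -
  have 1: "(\<Sum>j\<le>a. (-1::real) ^ j) = (if even a then 1 else 0)" for a by (induction a) auto
  have 0: "(\<Sum>j\<le>a. (0::real) ^ j) = 1" for a by (induction a) auto
  show "(\<Sum>j\<le>a. e p ^ j) \<ge> 0" "even a \<Longrightarrow> (\<Sum>j\<le>a. e p ^ j) \<ge> 1"
    using e_range[of p] by (auto simp: 1 0)
qed

lemma divisor_sum_nonneg: "k > 0 \<Longrightarrow> divisor_sum k \<ge> 0"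
proof (induction k rule: less_induct)
  case (less k)
  show ?case
  proof (cases "k = 1")
    case False
    then obtain p a m where d: "prime p" "k = p ^ a * m" "\<not> p dvd m" "0 < m" "m < k"
      using prime_power_decomposition[of k] less.prems by auto
    thus ?thesis using divisor_sum_prime_power_mult[OF d(1,3,4), of a] less.IH[OF d(5,4)] geom_nonneg by simp
  qed (use e_1 in \<open>simp add: divisor_sum_def\<close>)
qed

lemma divisor_sum_square: "k > 0 \<Longrightarrow> divisor_sum (k^2) \<ge> 1"
proof (induction k rule: less_induct)
  case (less k)
  show ?case
  proof (cases "k = 1")
    case False
    then obtain p a m where d: "prime p" "k = p ^ a * m" "\<not> p dvd m" "0 < m" "m < k"
      using prime_power_decomposition[of k] less.prems by auto
    have "k^2 = p ^ (2 * a) * m^2" unfolding d(2) by (simp add: power_mult_distrib power_mult[symmetric] mult.commute)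
    moreover have "\<not> p dvd m^2" using d by (simp add: prime_dvd_power_iff)
    ultimately show ?thesis
      using divisor_sum_prime_power_mult[OF d(1), of "m^2" "2 * a"] d(4) geom_even[of "2 * a" p] less.IH[OF d(5,4)]
        mult_mono[of 1 "\<Sum>j\<le>2 * a. e p ^ j" 1 "divisor_sum (m^2)"] by simp
  qed (use e_1 in \<open>simp add: divisor_sum_def\<close>)
qed

definition lambert :: "real \<Rightarrow> real" where
  "lambert x = (\<Sum>\<^sub>\<infinity>n\<in>{1..}. e n * (x ^ n / (1 - x ^ n)))"

lemma abs_e_le: "\<bar>e n\<bar> \<le> 1" using e_range[of n] by auto

lemma lambert_summable:
  assumes x: "0 < x" "x < 1"
  shows "(\<lambda>n. norm (e n * (x ^ n / (1 - x ^ n)))) summable_on {1..}"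
proof (rule Infinite_Sum.abs_summable_on_comparison_test')
  have "(\<lambda>n. x ^ n) summable_on UNIV"
    using x by (intro norm_summable_imp_summable_on) (auto intro: summable_geometric)
  hence "(\<lambda>n. x ^ n) summable_on {1..}" by (rule summable_on_subset_banach) auto
  thus "(\<lambda>n. x ^ n / (1 - x)) summable_on {1..}"
    using summable_on_cmult_left[of "\<lambda>n. x ^ n" "{1..}" "1 / (1 - x)"] by simp
  fix n :: nat assume "n \<in> {1..}"
  hence n: "n \<ge> 1" by simp
  have "x ^ n \<le> x ^ 1" using x n by (intro power_decreasing) auto
  hence "x ^ n / (1 - x ^ n) \<le> x ^ n / (1 - x)" using x by (intro divide_left_mono) (auto intro!: mult_pos_pos)
  moreover have "x ^ n / (1 - x ^ n) \<ge> 0" using x by (simp add: power_le_one)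
  moreover from this have "norm (e n * (x ^ n / (1 - x ^ n))) = \<bar>e n\<bar> * (x ^ n / (1 - x ^ n))"
    by (simp only: real_norm_def abs_mult abs_of_nonneg)
  ultimately show "norm (e n * (x ^ n / (1 - x ^ n))) \<le> x ^ n / (1 - x)"
    using mult_left_le_one_le[of "x ^ n / (1 - x ^ n)" "\<bar>e n\<bar>"] abs_e_le[of n] by linarith
qed

lemma lambert_expand:
  assumes x: "0 < x" "x < 1"
  shows "((\<lambda>k. divisor_sum k * x ^ k) has_sum lambert x) {1..}"
proof -
  let ?F = "\<lambda>(n, m). e n * x ^ (n * m)"
  have xn: "x ^ n < 1" "x ^ n > 0" if "n \<ge> 1" for n using x that by (auto intro: power_less_one_iff[THEN iffD2])
  have geo: "((\<lambda>m. c * x ^ (n * m)) has_sum c * (x ^ n / (1 - x ^ n))) {1..}" if "n \<ge> 1" for n c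
  proof -
    have "((\<lambda>m. (x ^ n) ^ m) has_sum (x ^ n / (1 - x ^ n))) {1..}"
      using xn[OF that] by (intro has_sum_geometric_from_1) auto
    from has_sum_cmult_right[OF this] show ?thesis by (simp add: power_mult)
  qed
  have abs: "(\<lambda>p. norm (?F p)) summable_on {1..} \<times> {1..}"
  proof (subst Infinite_Sum.abs_summable_on_Sigma_iff, intro conjI ballI)
    have g: "((\<lambda>m. norm (?F (n, m))) has_sum \<bar>e n\<bar> * (x ^ n / (1 - x ^ n))) {1..}" if "n \<in> {1..}" for n
      using geo[of n "\<bar>e n\<bar>"] that x by (simp add: abs_mult)
    show "(\<lambda>m. norm (?F (n, m))) summable_on {1..}" if "n \<in> {1..}" for n
      using g[OF that] by (rule has_sum_imp_summable)
    have "norm (\<Sum>\<^sub>\<infinity>m\<in>{1..}. norm (?F (n, m))) = norm (e n * (x ^ n / (1 - x ^ n)))" if "n \<in> {1..}" for n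
      using infsumI[OF g[OF that]] xn[of n] that by (simp add: abs_mult)
    thus "(\<lambda>n. norm (\<Sum>\<^sub>\<infinity>m\<in>{1..}. norm (?F (n, m)))) summable_on {1..}"
      by (rule summable_on_cong[THEN iffD2, OF _ lambert_summable[OF x]])
  qed
  have "(?F has_sum lambert x) ({1..} \<times> {1..})"
  proof (rule has_sum_SigmaI)
    show "((\<lambda>m. ?F (n, m)) has_sum e n * (x ^ n / (1 - x ^ n))) {1..}" if "n \<in> {1..}" for n
      using geo[of n "e n"] that by simp
    show "((\<lambda>n. e n * (x ^ n / (1 - x ^ n))) has_sum lambert x) {1..}"
      unfolding lambert_def by (rule has_sum_infsum[OF abs_summable_summable[OF lambert_summable[OF x]]])
  qed (rule abs_summable_summable[OF abs])
  hence "((\<lambda>(n, d). e d * x ^ (d * (n div d))) has_sum lambert x) (SIGMA n:{1..}. {d. d dvd n})"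
    by (simp only: has_sum_divisor_pairs)
  also have "?this \<longleftrightarrow> ((\<lambda>(n, d). e d * x ^ n) has_sum lambert x) (SIGMA n:{1..}. {d. d dvd n})"
    by (rule has_sum_cong) auto
  finally have *: "((\<lambda>(n, d). e d * x ^ n) has_sum lambert x) (SIGMA n:{1..}. {d. d dvd n})" .
  show ?thesis
  proof (rule has_sum_SigmaD[OF *])
    fix n :: nat assume "n \<in> {1..}"
    thus "((\<lambda>d. case (n, d) of (n, d) \<Rightarrow> e d * x ^ n) has_sum divisor_sum n * x ^ n) {d. d dvd n}"
      by (auto simp: sum_distrib_right divisor_sum_def intro!: has_sum_finiteI)
  qed
qed

text \<open>All terms of the expansion in \<open>divisor_sum\<close> are nonnegative, so only the
  squares are kept. As \<open>x\<close> tends to 1 the left side tends to \<open>M\<close>, which is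
  arbitrary; this is the divergence that is contradicted.\<close>

lemma lambert_lower:
  assumes x: "0 < x" "x < 1"
  shows "(\<Sum>m=1..M. x ^ (m^2)) \<le> lambert x"
proof -
  have inj: "inj_on (\<lambda>m::nat. m^2) {1..M}" by (auto simp: inj_on_def)
  have "(\<Sum>m=1..M. x ^ (m^2)) \<le> (\<Sum>m=1..M. divisor_sum (m^2) * x ^ (m^2))"
    using x by (intro sum_mono) (auto intro!: mult_left_le_imp_le[OF _ zero_less_one] mult_right_mono[of 1, simplified] divisor_sum_square)
  also have "\<dots> = (\<Sum>k\<in>(\<lambda>m. m^2) ` {1..M}. divisor_sum k * x ^ k)"
    by (subst sum.reindex[OF inj]) simp
  also have "\<dots> \<le> lambert x"
    by (rule finite_sum_le_has_sum[OF lambert_expand[OF x]]) (use x divisor_sum_nonneg in \<open>auto simp: Suc_le_eq\<close>)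
  finally show ?thesis .
qed

text \<open>The inequality of arithmetic and geometric means for each power paired with its mirror
  image. With \<open>y = sqrt x\<close> it yields the monotonicity of the weights in
  \<open>lambert_upper\<close>.\<close>

lemma geometric_sum_ge:
  fixes y :: real assumes "0 < y"
  shows "real n * y ^ (n - 1) \<le> (\<Sum>i<n. (y^2) ^ i)"
proof -
  have "(\<Sum>i<n. (y^2) ^ i) = (\<Sum>i<n. (y^2) ^ (n - Suc i))" by (rule sum.nat_diff_reindex[symmetric])
  hence "2 * (\<Sum>i<n. (y^2) ^ i) = (\<Sum>i<n. (y^2) ^ i + (y^2) ^ (n - Suc i))" by (simp add: sum.distrib)
  also have "\<dots> \<ge> (\<Sum>i<n. 2 * y ^ (n - 1))"
  proof (rule sum_mono)
    fix i assume i: "i \<in> {..<n}"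
    have "2 * (y ^ i * y ^ (n - Suc i)) \<le> (y ^ i)^2 + (y ^ (n - Suc i))^2"
      using sum_squares_ge_zero[of "y ^ i - y ^ (n - Suc i)" 0] by (simp add: power2_eq_square algebra_simps)
    moreover have "y ^ i * y ^ (n - Suc i) = y ^ (n - 1)" using i by (simp flip: power_add)
    moreover have "(y ^ j)^2 = (y^2) ^ j" for j by (metis power_mult mult.commute)
    ultimately show "2 * y ^ (n - 1) \<le> (y^2) ^ i + (y^2) ^ (n - Suc i)" by simp
  qed
  finally show ?thesis by simp
qed

text \<open>Monsky's argument: if the sum of \<open>e n / n\<close> is zero, then \<open>- lambert x\<close> is the sum of \<open>e n * b n\<close> for weights
  \<open>b\<close> decreasing from 1 and stays bounded as \<open>x\<close> tends to 1, contradicting the bound \<open>lambert_lower\<close>.\<close>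

lemma lambert_upper:
  assumes B: "\<And>n. \<bar>psum e n\<bar> \<le> B" and L0: "(\<lambda>M. psum (\<lambda>n. e n / real n) M) \<longlonglongrightarrow> 0"
    and x: "0 < x" "x < 1"
  shows "\<bar>lambert x\<bar> \<le> B"
proof -
  \<comment> \<open>The singular part of \<open>x ^ n / (1 - x ^ n)\<close> at \<open>x = 1\<close>
    is \<open>1 / (n * (1 - x))\<close>. Subtracting from it leaves a bounded weight, and by
    \<open>L0\<close> the singular parts contribute 0 in total.\<close>
  define b where "b = (\<lambda>n. 1 / (real n * (1 - x)) - x ^ n / (1 - x ^ n))"
  define A where "A = (\<lambda>n. \<Sum>i<n. x ^ i)"
  have B0: "B \<ge> 0" using B[of 0] by simp
  have A: "1 - x ^ n = (1 - x) * A n" for n unfolding A_def by (rule one_diff_power_eq)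
  have An: "A n \<ge> real n * sqrt x ^ (n - 1)" for n
    using geometric_sum_ge[of "sqrt x" n] x by (simp add: A_def)
  have Apos: "A n > 0" if "n \<ge> 1" for n using An[of n] that x by (smt (verit) mult_pos_pos of_nat_0_less_iff real_sqrt_gt_zero zero_less_power less_le_trans zero_less_one Suc_le_eq One_nat_def)
  have bA: "b n = (1 / real n - x ^ n / A n) / (1 - x)" if "n \<ge> 1" for n
    unfolding b_def A by (simp add: diff_divide_distrib mult.commute)
  \<comment> \<open>The claim reduces to \<open>n * (n + 1) * x ^ n \<le> A n * A (n + 1)\<close>.
    Two uses of \<open>An\<close> give the power \<open>2 * n - 1\<close> of \<open>sqrt x\<close>,
    which is at least \<open>x ^ n\<close>.\<close>
  have mono: "b (Suc n) \<le> b n" if n: "n \<ge> 1" for n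
  proof -
    have "real n * real (Suc n) * x ^ n \<le> real n * real (Suc n) * (sqrt x ^ (n - 1) * sqrt x ^ n)"
    proof (intro mult_left_mono)
      have "x ^ n = sqrt x ^ (2 * n)" using x by (simp add: power_mult)
      also have "\<dots> \<le> sqrt x ^ (n - 1 + n)" using x n by (intro power_decreasing) auto
      finally show "x ^ n \<le> sqrt x ^ (n - 1) * sqrt x ^ n" by (simp add: power_add)
    qed auto
    also have "\<dots> = (real n * sqrt x ^ (n - 1)) * (real (Suc n) * sqrt x ^ (Suc n - 1))" by simp
    also have "\<dots> \<le> A n * A (Suc n)" using Apos[OF n] x by (intro mult_mono An) auto
    finally have key: "real n * real (Suc n) * x ^ n \<le> A n * A (Suc n)" .
    have "A (Suc n) - x * A n = 1"
    proof -
      have "A (Suc n) = A n + x ^ n" by (simp add: A_def)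
      thus ?thesis using A[of n] by (simp add: algebra_simps)
    qed
    hence "x ^ n / A n - x ^ Suc n / A (Suc n) = x ^ n / (A n * A (Suc n))"
      using Apos[OF n] Apos[of "Suc n"] by (simp add: field_simps)
    also have "\<dots> \<le> 1 / (real n * real (Suc n))"
      using key n Apos[OF n] Apos[of "Suc n"] by (simp add: divide_simps mult.commute) 
    also have "\<dots> = 1 / real n - 1 / real (Suc n)" using n by (simp add: field_simps)
    finally have "1 / real (Suc n) - x ^ Suc n / A (Suc n) \<le> 1 / real n - x ^ n / A n" by linarith
    thus ?thesis using bA[OF n] bA[of "Suc n"] x by (simp add: divide_right_mono)
  qed
  have nonneg: "b n \<ge> 0" if n: "n \<ge> 1" for n
  proof -
    have "real n * x ^ n = (\<Sum>i<n. x ^ n)" by simp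
    also have "\<dots> \<le> A n" unfolding A_def using x by (intro sum_mono power_decreasing) auto
    finally have "x ^ n / A n \<le> 1 / real n" using n Apos[OF n] by (simp add: field_simps)
    thus ?thesis unfolding bA[OF n] using x by simp
  qed
  have b1: "b (Suc 0) = 1" using x by (simp add: b_def field_simps)
  have bound: "\<bar>psum (\<lambda>n. e n * b n) M\<bar> \<le> B" for M
  proof -
    have "\<bar>psum (\<lambda>n. e n * b n) M\<bar> \<le> \<bar>psum e M * b (Suc M)\<bar> + (\<Sum>n=1..M. \<bar>psum e n * (b n - b (Suc n))\<bar>)"
      unfolding abel_psum by (intro order_trans[OF abs_triangle_ineq] add_mono order_refl sum_abs)
    also have "\<dots> \<le> B * b (Suc M) + (\<Sum>n=1..M. B * (b n - b (Suc n)))"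
    proof (intro add_mono sum_mono)
      show "\<bar>psum e M * b (Suc M)\<bar> \<le> B * b (Suc M)"
        unfolding abs_mult using nonneg[of "Suc M"] B0 by (intro mult_mono B) auto
      show "\<bar>psum e n * (b n - b (Suc n))\<bar> \<le> B * (b n - b (Suc n))" if "n \<in> {1..M}" for n
        unfolding abs_mult using mono[of n] that B0 by (intro mult_mono B) auto
    qed
    also have "\<dots> = B * (b (Suc M) + (\<Sum>n=1..M. b n - b (Suc n)))" by (simp add: sum_distrib_left distrib_left)
    also have "(\<Sum>n=1..M. b n - b (Suc n)) = b (Suc 0) - b (Suc M)" by (induction M) auto
    finally show ?thesis by (simp add: b1)
  qed
  have "(\<lambda>n. e n * (x ^ n / (1 - x ^ n))) summable_on {1..}"
    by (rule abs_summable_summable[OF lambert_summable[OF x]])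
  hence "((\<lambda>n. e n * (x ^ n / (1 - x ^ n))) has_sum lambert x) {1..}" unfolding lambert_def by (rule has_sum_infsum)
  hence "(\<lambda>n. e (Suc n) * (x ^ Suc n / (1 - x ^ Suc n))) sums lambert x" by (rule has_sum_imp_sums_Suc)
  hence l1: "(\<lambda>M. \<Sum>n<M. e (Suc n) * (x ^ Suc n / (1 - x ^ Suc n))) \<longlonglongrightarrow> lambert x" by (simp add: sums_def)
  have eq: "psum (\<lambda>n. e n * b n) M = psum (\<lambda>n. e n / real n) M / (1 - x) - (\<Sum>n<M. e (Suc n) * (x ^ Suc n / (1 - x ^ Suc n)))" for M
    by (induction M) (auto simp: b_def algebra_simps add_divide_distrib divide_divide_eq_left' simp del: power_Suc of_nat_Suc)
  have "(\<lambda>M. psum (\<lambda>n. e n * b n) M) \<longlonglongrightarrow> 0 / (1 - x) - lambert x"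
    unfolding eq using x by (intro tendsto_intros L0 l1) auto
  hence "(\<lambda>M. \<bar>psum (\<lambda>n. e n * b n) M\<bar>) \<longlonglongrightarrow> \<bar>0 / (1 - x) - lambert x\<bar>" by (rule tendsto_rabs)
  hence "\<bar>0 / (1 - x) - lambert x\<bar> \<le> B" by (rule LIMSEQ_le_const2) (use bound in auto)
  thus ?thesis by simp
qed

lemma L1_nonzero:
  assumes B: "\<And>n. \<bar>psum e n\<bar> \<le> B"
  shows "\<not> (\<lambda>M. psum (\<lambda>n. e n / real n) M) \<longlonglongrightarrow> 0"
proof
  assume L0: "(\<lambda>M. psum (\<lambda>n. e n / real n) M) \<longlonglongrightarrow> 0"
  obtain M :: nat where M: "real M > B" using reals_Archimedean2 by blast
  define x where "x = (\<lambda>k::nat. 1 - 1 / real (Suc (Suc k)))"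
  have x: "0 < x k" "x k < 1" for k by (auto simp: x_def field_simps)
  have "(\<lambda>k. 1 - 1 / real (Suc (Suc k))) \<longlonglongrightarrow> 1 - 0"
    by (intro tendsto_intros LIMSEQ_Suc[OF LIMSEQ_Suc[OF lim_1_over_n]])
  hence xl: "x \<longlonglongrightarrow> 1" by (simp add: x_def)
  have "(\<lambda>k. \<Sum>m=1..M. x k ^ (m^2)) \<longlonglongrightarrow> (\<Sum>m=1..M. 1 ^ (m^2))"
    by (intro tendsto_intros xl)
  hence "(\<lambda>k. \<Sum>m=1..M. x k ^ (m^2)) \<longlonglongrightarrow> real M" by simp
  moreover have "(\<Sum>m=1..M. x k ^ (m^2)) \<le> B" for k
    using lambert_lower[of "x k" M] lambert_upper[OF B L0, of "x k"] x[of k] by linarith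
  ultimately have "real M \<le> B" by (intro LIMSEQ_le_const2) auto
  with M show False by simp
qed

end

context dchar
begin

text \<open>What \<open>nonvanishing_mertens\<close> leaves over is \<open>t = 0\<close> with values
  in -1, 0, 1. A zero there would make the series of \<open>e n / n\<close> converge to 0, against
  \<open>L1_nonzero\<close>.\<close>

theorem nonvanishing:
  assumes u: "coprime u N" "\<xi> u \<noteq> 1"
  shows "Lext \<xi> (Complex 1 t) \<noteq> 0"
proof (cases "t \<noteq> 0 \<or> (\<exists>v. coprime v N \<and> \<xi> v ^ 2 \<noteq> 1)")
  case True
  thus ?thesis by (rule nonvanishing_mertens[OF u])
next
  case False
  hence t: "t = 0" and sq: "\<And>v. coprime v N \<Longrightarrow> \<xi> v ^ 2 = 1" by auto
  define e where "e = (\<lambda>n. Re (\<xi> n))"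
  have xi: "\<xi> n = of_real (e n) \<and> e n \<in> {-1, 0, 1}" for n
  proof (cases "coprime n N")
    case True
    hence "\<xi> n = 1 \<or> \<xi> n = -1" using sq by (simp add: power2_eq_1_iff)
    thus ?thesis by (auto simp: e_def)
  next
    case False
    thus ?thesis using zero_iff[of n] by (auto simp: e_def)
  qed
  interpret real_completely_multiplicative e
  proof
    show "e (m * n) = e m * e n" for m n
    proof -
      have "\<xi> (m * n) = of_real (e m * e n)" using xi mult by simp
      thus ?thesis by (simp only: e_def Re_complex_of_real)
    qed
    show "e 1 = 1" by (simp add: e_def)
    show "e n \<in> {-1, 0, 1}" for n using xi by blast
  qed
  obtain B where B: "\<And>n. norm (psum \<xi> n) \<le> B" using psum_bounded[OF u] by blast
  have pe: "psum e n = Re (psum \<xi> n)" for n by (induction n) (auto simp: e_def)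
  have Be: "\<bar>psum e n\<bar> \<le> B" for n using abs_Re_le_cmod[of "psum \<xi> n"] B[of n] by (simp add: pe)
  show ?thesis
  proof
    assume "Lext \<xi> (Complex 1 t) = 0"
    hence "(\<lambda>M. psum (\<lambda>n. \<xi> n * npow 1 n) M) \<longlonglongrightarrow> 0"
      using Lext_limit[OF B, of 1] t by (simp add: one_complex.code)
    hence "(\<lambda>M. Re (psum (\<lambda>n. \<xi> n * npow 1 n) M)) \<longlonglongrightarrow> Re 0" by (rule tendsto_Re)
    moreover have "Re (psum (\<lambda>n. \<xi> n * npow 1 n) M) = psum (\<lambda>n. e n / real n) M" for M
    proof (induction M)
      case (Suc M)
      have "npow 1 (Suc M) = of_real (1 / real (Suc M))" by (simp add: npow_def powr_minus divide_inverse del: of_nat_Suc)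
      thus ?case using Suc xi[of "Suc M"] by (simp del: of_nat_Suc)
    qed auto
    ultimately show False using L1_nonzero[OF Be] by simp
  qed
qed

text \<open>\<open>U\<close> is a half-plane with the zeros of \<open>Lext \<xi> (1 + z)\<close>
  removed. It contains the closed right half-plane: on the boundary by \<open>nonvanishing\<close>,
  and inside because the product with the series of \<open>mu n * \<xi> n\<close> is 1
  there.\<close>

lemma sum_mu_chi_over_n_converges:
  assumes u: "coprime u N" "\<xi> u \<noteq> 1"
  shows "convergent (\<lambda>M. \<Sum>n=1..M. mu n * \<xi> n / of_nat n)"
proof -
  obtain B where B: "\<And>n. norm (psum \<xi> n) \<le> B" using psum_bounded[OF u] by blast
  have b: "norm (mu n * \<xi> n) \<le> 1" for n
    using mult_mono[OF norm_mu_le norm_chi_le, of n n] by (simp add: norm_mult)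
  have L: "dseries (\<lambda>n. mu n * \<xi> n) s * Lext \<xi> s = 1" if "Re s > 1" for s
    using dseries_mu_chi[OF that] Lext_eq_dseries[OF B norm_chi_le that] by simp
  let ?g = "\<lambda>z. Lext \<xi> (1 + z)"
  have hol: "?g holomorphic_on {z. Re z > -1}"
    by (rule holomorphic_on_compose_gen[of "\<lambda>z. 1 + z" _ "Lext \<xi>" "{s. Re s > 0}", unfolded o_def])
       (use Lext_holomorphic[OF B] in \<open>auto intro!: holomorphic_intros\<close>)
  define U where "U = {z. Re z > -1} \<inter> ?g -` (-{0})"
  have "open U" unfolding U_def
    by (rule continuous_open_preimage[OF holomorphic_on_imp_continuous_on[OF hol]]) (auto simp: open_halfspace_Re_gt)
  moreover have "{z. Re z \<ge> 0} \<subseteq> U"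
  proof
    fix z assume z: "z \<in> {z. Re z \<ge> 0}"
    have "?g z \<noteq> 0"
    proof (cases "Re z = 0")
      case True
      hence "1 + z = Complex 1 (Im z)" by (simp add: complex_eq_iff)
      thus ?thesis using nonvanishing[OF u] by simp
    next
      case False
      hence "Re (1 + z) > 1" using z by simp
      from L[OF this] show ?thesis by auto
    qed
    thus "z \<in> U" using z by (auto simp: U_def)
  qed
  moreover have "(\<lambda>z. 1 / ?g z) holomorphic_on U"
    by (intro holomorphic_intros holomorphic_on_subset[OF hol]) (auto simp: U_def)
  moreover have "(\<lambda>n. mu (Suc n) * \<xi> (Suc n) * of_nat (Suc n) powr (-1 - z)) sums (1 / ?g z)" if z: "Re z > 0" for z
  proof -
    have "Re (1 + z) > 1" using z by simp
    hence 1: "(\<lambda>n. mu (Suc n) * \<xi> (Suc n) * npow (1 + z) (Suc n)) sums dseries (\<lambda>n. mu n * \<xi> n) (1 + z)"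
      and 2: "dseries (\<lambda>n. mu n * \<xi> n) (1 + z) * ?g z = 1"
      using dseries_sums[of "\<lambda>n. mu n * \<xi> n" 1, OF b] L by blast+
    from 2 have "dseries (\<lambda>n. mu n * \<xi> n) (1 + z) = 1 / ?g z"
      by (metis divide_self_if mult_zero_right nonzero_eq_divide_eq zero_neq_one)
    moreover have "- (1 + z) = -1 - z" by simp
    ultimately show ?thesis using 1 by (simp only: npow_def)
  qed
  ultimately have "(\<lambda>M. \<Sum>n=1..M. mu n * \<xi> n / of_nat n) \<longlonglongrightarrow> 1 / ?g 0"
    using Newman_tauberian[of "\<lambda>n. mu n * \<xi> n" U "\<lambda>z. 1 / ?g z", OF b] by blast
  thus ?thesis by (rule convergentI)
qed

end

section \<open>Sums of characters over primes\<close>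

lemma cesaro_zero:
  fixes X :: "nat \<Rightarrow> complex"
  assumes "X \<longlonglongrightarrow> 0"
  shows "(\<lambda>M. (\<Sum>n<M. X n) / of_nat M) \<longlonglongrightarrow> 0"
proof (rule LIMSEQ_I)
  fix \<epsilon> :: real assume e: "\<epsilon> > 0"
  obtain n0 where n0: "\<And>n. n \<ge> n0 \<Longrightarrow> norm (X n) < \<epsilon> / 2"
    using LIMSEQ_D[OF assms, of "\<epsilon>/2"] e by auto
  define C where "C = (\<Sum>n<n0. norm (X n))"
  have C0: "C \<ge> 0" unfolding C_def by (intro sum_nonneg) auto
  have b: "norm (\<Sum>n<M. X n) \<le> C + \<epsilon> / 2 * real M" for M
  proof (induction M)
    case (Suc M)
    show ?case
    proof (cases "M < n0")
      case True
      have "norm (\<Sum>n<Suc M. X n) \<le> (\<Sum>n<Suc M. norm (X n))" by (rule norm_sum)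
      also have "\<dots> \<le> C" unfolding C_def using True by (intro sum_mono2) auto
      also have "\<dots> \<le> C + \<epsilon> / 2 * real (Suc M)" using e by simp
      finally show ?thesis .
    next
      case False
      hence "norm (X M) \<le> \<epsilon> / 2" using n0[of M] by simp
      moreover have "\<epsilon> / 2 * real (Suc M) = \<epsilon> / 2 * real M + \<epsilon> / 2" by (simp add: field_simps)
      ultimately show ?thesis using Suc norm_triangle_ineq[of "\<Sum>n<M. X n" "X M"] unfolding sum.lessThan_Suc by linarith
    qed
  qed (use C0 in simp)
  obtain M0 :: nat where M0: "real M0 > 2 * C / \<epsilon>" using reals_Archimedean2 by blast
  show "\<exists>M0. \<forall>M\<ge>M0. norm ((\<Sum>n<M. X n) / of_nat M - 0) < \<epsilon>"
  proof (intro exI[of _ "max 1 M0"] allI impI)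
    fix M assume M: "M \<ge> max 1 M0"
    hence "real M > 2 * C / \<epsilon>" using M0 by linarith
    hence "C < \<epsilon> / 2 * real M" using e by (simp add: field_simps)
    hence "norm (\<Sum>n<M. X n) < \<epsilon> * real M" using b[of M] by linarith
    thus "norm ((\<Sum>n<M. X n) / of_nat M - 0) < \<epsilon>" using M by (simp add: norm_divide field_simps)
  qed
qed

text \<open>Summation by parts writes \<open>psum f M / M\<close> as the partial sum
  \<open>T M\<close> minus the mean of the earlier ones, and both have the same limit.\<close>

lemma psum_o_of_convergent:
  fixes f :: "nat \<Rightarrow> complex"
  assumes "convergent (\<lambda>M. \<Sum>n=1..M. f n / of_nat n)"
  shows "(\<lambda>M. psum f M / of_nat M) \<longlonglongrightarrow> 0"
proof -
  define T where "T = psum (\<lambda>n. f n / of_nat n)"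
  obtain L where L: "T \<longlonglongrightarrow> L" using assms unfolding T_def psum_def[abs_def] convergent_def by blast
  have eq: "psum f M = of_nat M * T M - (\<Sum>n<M. T n)" for M
    by (induction M) (auto simp: T_def algebra_simps add_divide_distrib simp del: of_nat_Suc, simp add: field_simps)
  have "(\<lambda>n. T n - L) \<longlonglongrightarrow> 0" using L by (simp add: LIM_zero)
  from cesaro_zero[OF this] have c: "(\<lambda>M. (\<Sum>n<M. T n - L) / of_nat M) \<longlonglongrightarrow> 0" .
  have "(\<lambda>M. (T M - L) - (\<Sum>n<M. T n - L) / of_nat M) \<longlonglongrightarrow> 0 - 0"
    by (intro tendsto_diff c) (use L in \<open>simp add: LIM_zero\<close>)
  moreover have "eventually (\<lambda>M. (T M - L) - (\<Sum>n<M. T n - L) / of_nat M = psum f M / of_nat M) sequentially"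
    using eventually_gt_at_top[of 0]
    by eventually_elim (simp add: eq sum_subtractf field_simps)
  ultimately show ?thesis by (simp add: tendsto_cong)
qed

lemma psum_linear_bound:
  fixes f :: "nat \<Rightarrow> complex"
  assumes "(\<lambda>M. psum f M / of_nat M) \<longlonglongrightarrow> 0" "\<epsilon> > 0"
  obtains C where "C \<ge> 0" "\<And>n. norm (psum f n) \<le> \<epsilon> * real n + C"
proof -
  obtain n0 where n0: "\<And>n. n \<ge> n0 \<Longrightarrow> norm (psum f n / of_nat n) < \<epsilon>"
    using LIMSEQ_D[OF assms] by auto
  define C where "C = (\<Sum>n\<le>n0. norm (psum f n))"
  have "norm (psum f n) \<le> \<epsilon> * real n + C" for n
  proof (cases "n \<le> n0")
    case True
    have "norm (psum f n) \<le> C" unfolding C_def using True by (intro member_le_sum) auto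
    thus ?thesis using assms(2) by (simp add: add_increasing)
  next
    case False
    hence "norm (psum f n) < \<epsilon> * real n" using n0[of n] by (simp add: norm_divide field_simps)
    moreover have "C \<ge> 0" unfolding C_def by (intro sum_nonneg) auto
    ultimately show ?thesis by simp
  qed
  moreover have "C \<ge> 0" unfolding C_def by (intro sum_nonneg) auto
  ultimately show ?thesis using that by blast
qed

lemma psum_tendsto_zeroI:
  fixes f :: "nat \<Rightarrow> complex"
  assumes "\<And>\<epsilon>. \<epsilon> > 0 \<Longrightarrow> \<exists>C. \<forall>n. norm (psum f n) \<le> \<epsilon> * real n + C"
  shows "(\<lambda>M. psum f M / of_nat M) \<longlonglongrightarrow> 0"
proof (rule LIMSEQ_I)
  fix \<epsilon> :: real assume e: "\<epsilon> > 0"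
  obtain C where C: "\<And>n. norm (psum f n) \<le> \<epsilon>/2 * real n + C" using assms[of "\<epsilon>/2"] e by auto
  obtain M0 :: nat where M0: "real M0 > 2 * C / \<epsilon>" using reals_Archimedean2 by blast
  show "\<exists>M0. \<forall>M\<ge>M0. norm (psum f M / of_nat M - 0) < \<epsilon>"
  proof (intro exI[of _ "max 1 M0"] allI impI)
    fix M assume M: "M \<ge> max 1 M0"
    hence "real M > 2 * C / \<epsilon>" using M0 by linarith
    hence "C < \<epsilon> / 2 * real M" using e by (simp add: field_simps)
    hence "norm (psum f M) < \<epsilon> * real M" using C[of M] by linarith
    thus "norm (psum f M / of_nat M - 0) < \<epsilon>" using M by (simp add: norm_divide field_simps)
  qed
qed

text \<open>Moebius inversion of \<open>mangoldt_sum\<close>: the logarithm is expanded and the two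
  divisors are exchanged, after which the sum of \<open>mu\<close> leaves only
  \<open>e = n\<close>.\<close>

lemma mangoldt_mu_ln:
  assumes "n > 0"
  shows "(\<Sum>d | d dvd n. mu d * of_real (ln (real (n div d)))) = (mangoldt n :: complex)"
proof -
  have sw: "d dvd n \<and> e dvd n div d \<longleftrightarrow> d * e dvd n" for d e
  proof (cases "d = 0")
    case False
    thus ?thesis using dvd_div_iff_mult[of d n e] by (auto simp: mult.commute dest: dvd_mult_left)
  qed (use assms in auto)
  have "(\<Sum>d | d dvd n. mu d * of_real (ln (real (n div d)))) = (\<Sum>d | d dvd n. \<Sum>e | e dvd n div d. mu d * mangoldt e)"
  proof (rule sum.cong)
    fix d assume "d \<in> {d. d dvd n}"
    hence "n div d \<noteq> 0" using assms by (auto simp: dvd_div_eq_0_iff)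
    from mangoldt_sum[OF this, where ?'a = complex] show "mu d * of_real (ln (real (n div d))) = (\<Sum>e | e dvd n div d. mu d * mangoldt e)"
      by (simp flip: sum_distrib_left)
  qed auto
  also have "\<dots> = (\<Sum>(d,e)\<in>(SIGMA d:{d. d dvd n}. {e. e dvd n div d}). mu d * mangoldt e)"
    by (rule sum.Sigma) (use assms in \<open>auto simp: dvd_div_eq_0_iff\<close>)
  also have "\<dots> = (\<Sum>(e,d)\<in>(SIGMA e:{e. e dvd n}. {d. d dvd n div e}). mu d * mangoldt e)"
    by (rule sum.reindex_bij_witness[where i = "\<lambda>(e,d). (d,e)" and j = "\<lambda>(e,d). (d,e)"])
       (use sw mult.commute[where ?'a = nat] in \<open>force+\<close>)
  also have "\<dots> = (\<Sum>e | e dvd n. \<Sum>d | d dvd n div e. mu d * mangoldt e)"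
    by (rule sum.Sigma[symmetric]) (use assms in \<open>auto simp: dvd_div_eq_0_iff\<close>)
  also have "\<dots> = (\<Sum>e | e dvd n. if e = n then mangoldt n else 0)"
  proof (rule sum.cong)
    fix e assume "e \<in> {e. e dvd n}"
    hence e: "e dvd n" "n div e > 0" using assms by (auto simp: dvd_div_eq_0_iff intro!: Nat.gr0I)
    have "(\<Sum>d | d dvd n div e. mu d * mangoldt e) = (if n div e = 1 then 1 else 0) * mangoldt e"
      by (subst sum_mu_divisors[OF e(2), symmetric]) (simp add: sum_distrib_right)
    also have "n div e = 1 \<longleftrightarrow> e = n" using e assms by auto
    finally show "(\<Sum>d | d dvd n div e. mu d * mangoldt e) = (if e = n then mangoldt n else (0::complex))" by auto
  qed auto
  also have "\<dots> = mangoldt n" using assms by simp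
  finally show ?thesis .
qed

text \<open>Pairs with \<open>m * k \<le> x\<close> are split at \<open>k = K\<close>; a pair with
  \<open>k > K\<close> has \<open>m \<le> x div Suc K\<close>. The first sum exploits cancellation
  in \<open>a\<close>, the second cancellation in \<open>g\<close>.\<close>

lemma hyperbola:
  fixes a g :: "nat \<Rightarrow> complex"
  shows "psum (\<lambda>n. \<Sum>d | d dvd n. a d * g (n div d)) x =
    (\<Sum>k=1..K. g k * psum a (x div k)) + (\<Sum>m=1..x div Suc K. a m * (psum g (x div m) - psum g K))"
proof -
  let ?P = "{(m,k). 1 \<le> m \<and> 1 \<le> k \<and> m * k \<le> x}"
  have fin: "finite ?P"
  proof (rule finite_subset)
    show "?P \<subseteq> {..x} \<times> {..x}"
    proof clarify
      fix m k assume h: "1 \<le> m" "1 \<le> k" "m * k \<le> x"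
      have "m * 1 \<le> m * k" "1 * k \<le> m * k" using h by (intro mult_le_mono; simp)+
      hence "m \<le> x" "k \<le> x" using h(3) by linarith+
      thus "m \<in> {..x} \<and> k \<in> {..x}" by auto
    qed
  qed auto
  have "psum (\<lambda>n. \<Sum>d | d dvd n. a d * g (n div d)) x = (\<Sum>(n,d)\<in>(SIGMA n:{1..x}. {d. d dvd n}). a d * g (n div d))"
    unfolding psum_def by (rule sum.Sigma) auto
  also have "\<dots> = (\<Sum>(m,k)\<in>?P. a m * g k)"
  proof (rule sum.reindex_bij_witness[where i = "\<lambda>(m,k). (m * k, m)" and j = "\<lambda>(n,d). (d, n div d)"])
    fix b assume "b \<in> (SIGMA n:{1..x}. {d. d dvd n})"
    then obtain n d where b: "b = (n, d)" "n \<ge> 1" "n \<le> x" "d dvd n" by auto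
    then have "n div d \<ge> 1" "d \<ge> 1" by (auto simp: dvd_div_eq_0_iff Suc_le_eq intro!: Nat.gr0I)
    with b show "(case case b of (n, d) \<Rightarrow> (d, n div d) of (m, n) \<Rightarrow> (m * n, m)) = b"
      "(case b of (n, d) \<Rightarrow> (d, n div d)) \<in> ?P" by auto
  qed auto
  also have "?P = (?P \<inter> {(m,k). k \<le> K}) \<union> (?P \<inter> {(m,k). k > K})" by auto
  also have "(\<Sum>(m,k)\<in>\<dots>. a m * g k) = (\<Sum>(m,k)\<in>?P \<inter> {(m,k). k \<le> K}. a m * g k) + (\<Sum>(m,k)\<in>?P \<inter> {(m,k). k > K}. a m * g k)"
    by (rule sum.union_disjoint) (use fin in auto)
  also have "(\<Sum>(m,k)\<in>?P \<inter> {(m,k). k \<le> K}. a m * g k) = (\<Sum>(k,m)\<in>(SIGMA k:{1..K}. {1..x div k}). g k * a m)"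
    by (rule sum.reindex_bij_witness[where i = "\<lambda>(k,m). (m,k)" and j = "\<lambda>(k,m). (m,k)"])
       (auto simp: less_eq_div_iff_mult_less_eq)
  also have "\<dots> = (\<Sum>k=1..K. \<Sum>m=1..x div k. g k * a m)" by (rule sum.Sigma[symmetric]) auto
  also have "\<dots> = (\<Sum>k=1..K. g k * psum a (x div k))" by (simp add: psum_def sum_distrib_left)
  also have "(\<Sum>(m,k)\<in>?P \<inter> {(m,k). k > K}. a m * g k) = (\<Sum>(m,k)\<in>(SIGMA m:{1..x div Suc K}. {Suc K..x div m}). a m * g k)"
  proof (rule sum.cong)
    show "?P \<inter> {(m,k). k > K} = (SIGMA m:{1..x div Suc K}. {Suc K..x div m})"
    proof (rule subset_antisym; rule subsetI)
      fix p assume "p \<in> ?P \<inter> {(m,k). k > K}"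
      then obtain m k where h: "p = (m, k)" "1 \<le> m" "1 \<le> k" "m * k \<le> x" "K < k" by auto
      have "m * Suc K \<le> m * k" using h by (intro mult_le_mono) auto
      hence "m * Suc K \<le> x" using h by linarith
      thus "p \<in> (SIGMA m:{1..x div Suc K}. {Suc K..x div m})"
        using h by (simp add: less_eq_div_iff_mult_less_eq mult.commute del: mult_Suc_right mult_Suc)
    next
      fix p assume "p \<in> (SIGMA m:{1..x div Suc K}. {Suc K..x div m})"
      then obtain m k where h: "p = (m, k)" "1 \<le> m" "Suc K \<le> k" "k \<le> x div m" by auto
      hence "m * k \<le> x" by (simp add: less_eq_div_iff_mult_less_eq mult.commute)
      thus "p \<in> ?P \<inter> {(m,k). k > K}" using h by auto
    qed
  qed auto
  also have "\<dots> = (\<Sum>m=1..x div Suc K. \<Sum>k=Suc K..x div m. a m * g k)" by (rule sum.Sigma[symmetric]) auto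
  also have "\<dots> = (\<Sum>m=1..x div Suc K. a m * (psum g (x div m) - psum g K))"
  proof (rule sum.cong)
    fix m assume m: "m \<in> {1..x div Suc K}"
    hence "Suc K \<le> x div m" by (auto simp: less_eq_div_iff_mult_less_eq mult.commute simp del: mult_Suc_right)
    hence "{1..x div m} = {1..K} \<union> {Suc K..x div m}" by auto
    hence "psum g (x div m) = psum g K + (\<Sum>k=Suc K..x div m. g k)"
      unfolding psum_def by (simp add: sum.union_disjoint)
    thus "(\<Sum>k=Suc K..x div m. a m * g k) = a m * (psum g (x div m) - psum g K)"
      by (simp add: sum_distrib_left)
  qed auto
  finally show ?thesis .
qed

lemma sum_inverse_sqrt: "(\<Sum>m=1..y. 1 / sqrt (real m)) \<le> 2 * sqrt (real y)"
proof (induction y)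
  case (Suc y)
  have "1 / sqrt (real (Suc y)) \<le> 2 * (sqrt (real (Suc y)) - sqrt (real y))"
  proof -
    have "(sqrt (real (Suc y)) - sqrt (real y)) * (sqrt (real (Suc y)) + sqrt (real y)) = 1"
      by (simp add: algebra_simps)
    moreover have "sqrt (real (Suc y)) + sqrt (real y) \<le> 2 * sqrt (real (Suc y))" by simp
    ultimately have "1 \<le> (sqrt (real (Suc y)) - sqrt (real y)) * (2 * sqrt (real (Suc y)))"
      using mult_left_mono[of "sqrt (real (Suc y)) + sqrt (real y)" "2 * sqrt (real (Suc y))" "sqrt (real (Suc y)) - sqrt (real y)"] by simp
    thus ?thesis by (subst pos_divide_le_eq) (simp_all only: mult_ac of_nat_0_less_iff real_sqrt_gt_0_iff zero_less_Suc)
  qed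
  with Suc show ?case by (simp del: of_nat_Suc)
qed auto

lemma ln_Suc_le_sqrt: "ln (real (Suc y)) \<le> 2 * sqrt (real y)"
proof -
  have "ln (real (Suc y)) = 2 * ln (sqrt (real (Suc y)))" by (simp add: ln_sqrt)
  also have "\<dots> \<le> 2 * (sqrt (real (Suc y)) - 1)" by (intro mult_left_mono ln_le_minus_one) auto
  also have "sqrt (real (Suc y)) \<le> sqrt (real y) + sqrt 1"
    using sqrt_add_le_add_sqrt[of "real y" 1] by (simp add: add.commute)
  finally show ?thesis by simp
qed

context dchar
begin

text \<open>Summation by parts gives the order \<open>ln y\<close>. The weaker square root is
  convenient because \<open>sqrt (x / m)\<close> summed over \<open>m \<le> x / K\<close> is of
  order \<open>x / sqrt K\<close>, linear in \<open>x\<close> with a coefficient that a large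
  \<open>K\<close> makes small.\<close>

lemma psum_chi_ln_bound:
  assumes B: "\<And>n. norm (psum \<xi> n) \<le> B"
  shows "norm (psum (\<lambda>n. \<xi> n * of_real (ln (real n))) y) \<le> 4 * B * sqrt (real y)"
proof -
  have B0: "B \<ge> 0" using B[of 0] by simp
  have "norm (psum (\<lambda>n. \<xi> n * of_real (ln (real n))) y) \<le> norm (psum \<xi> y * of_real (ln (real (Suc y)))) + (\<Sum>n=1..y. norm (psum \<xi> n * (of_real (ln (real n)) - of_real (ln (real (Suc n))))))"
    unfolding abel_psum by (intro order_trans[OF norm_triangle_ineq] add_mono order_refl norm_sum)
  also have "\<dots> \<le> B * ln (real (Suc y)) + (\<Sum>n=1..y. B * (ln (real (Suc n)) - ln (real n)))"
  proof (intro add_mono sum_mono)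
    show "norm (psum \<xi> y * of_real (ln (real (Suc y)))) \<le> B * ln (real (Suc y))"
      unfolding norm_mult norm_of_real using B0 by (intro mult_mono B) auto
    show "norm (psum \<xi> n * (of_real (ln (real n)) - of_real (ln (real (Suc n))))) \<le> B * (ln (real (Suc n)) - ln (real n))" if "n \<in> {1..y}" for n
    proof -
      have "ln (real n) \<le> ln (real (Suc n))" using that by simp
      thus ?thesis unfolding norm_mult of_real_diff[symmetric] norm_of_real using B0 by (intro mult_mono B) auto
    qed
  qed
  also have "(\<Sum>n=1..y. B * (ln (real (Suc n)) - ln (real n))) = B * ln (real (Suc y))"
    by (induction y) (auto simp: algebra_simps)
  also have "B * ln (real (Suc y)) + B * ln (real (Suc y)) \<le> B * (2 * sqrt (real y)) + B * (2 * sqrt (real y))"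
    using B0 by (intro add_mono mult_left_mono ln_Suc_le_sqrt)
  finally show ?thesis by simp
qed

lemma psum_chi_mangoldt:
  assumes u: "coprime u N" "\<xi> u \<noteq> 1"
  shows "(\<lambda>M. psum (\<lambda>n. \<xi> n * mangoldt n) M / of_nat M) \<longlonglongrightarrow> 0"
proof (rule psum_tendsto_zeroI)
  fix \<epsilon> :: real assume e: "\<epsilon> > 0"
  obtain B where B: "\<And>n. norm (psum \<xi> n) \<le> B" using psum_bounded[OF u] by blast
  have B0: "B \<ge> 0" using B[of 0] by simp
  let ?a = "\<lambda>n. mu n * \<xi> n" and ?g = "\<lambda>n. \<xi> n * of_real (ln (real n))"
  have b: "norm (?a n) \<le> 1" for n
    using mult_mono[OF norm_mu_le norm_chi_le, of n n] by (simp add: norm_mult)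
  have M: "(\<lambda>M. psum ?a M / of_nat M) \<longlonglongrightarrow> 0"
    by (rule psum_o_of_convergent[OF sum_mu_chi_over_n_converges[OF u]])
  \<comment> \<open>Makes the second hyperbola sum, at most
    \<open>16 * B * x / sqrt (K + 1)\<close>, no larger than
    \<open>\<epsilon> / 2 * x\<close>.\<close>
  obtain K :: nat where K: "real K > (32 * B / \<epsilon>)^2" using reals_Archimedean2 by blast
  \<comment> \<open>With \<open>K\<close> fixed, \<open>W\<close> bounds the total weight of the
    first sum, so the slope \<open>\<epsilon> / (2 * W)\<close> is small enough for the partial sums
    of \<open>?a\<close>. The added 1 keeps \<open>W\<close> positive.\<close>
  define W where "W = (\<Sum>k=1..K. norm (?g k)) + 1"
  have W: "W > 0" unfolding W_def by (intro add_nonneg_pos sum_nonneg) auto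
  obtain C where C: "C \<ge> 0" "\<And>n. norm (psum ?a n) \<le> \<epsilon> / (2 * W) * real n + C"
    using psum_linear_bound[OF M, of "\<epsilon> / (2 * W)"] e W by auto
  have "norm (psum (\<lambda>n. \<xi> n * mangoldt n) x) \<le> \<epsilon> * real x + W * C" for x
  proof -
    have "psum (\<lambda>n. \<xi> n * mangoldt n) x = psum (\<lambda>n. \<Sum>d | d dvd n. ?a d * ?g (n div d)) x"
      unfolding psum_def
    proof (rule sum.cong)
      fix n assume "n \<in> {1..x}"
      hence n: "n > 0" by auto
      have "\<xi> n * mangoldt n = (\<Sum>d | d dvd n. \<xi> n * (mu d * of_real (ln (real (n div d)))))"
        unfolding mangoldt_mu_ln[OF n, symmetric] by (simp add: sum_distrib_left)
      also have "\<dots> = (\<Sum>d | d dvd n. ?a d * ?g (n div d))"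
      proof (rule sum.cong)
        fix d assume "d \<in> {d. d dvd n}"
        hence "\<xi> n = \<xi> d * \<xi> (n div d)" by (simp flip: mult)
        thus "\<xi> n * (mu d * of_real (ln (real (n div d)))) = ?a d * ?g (n div d)" by simp
      qed auto
      finally show "\<xi> n * mangoldt n = (\<Sum>d | d dvd n. ?a d * ?g (n div d))" .
    qed auto
    also have "\<dots> = (\<Sum>k=1..K. ?g k * psum ?a (x div k)) + (\<Sum>m=1..x div Suc K. ?a m * (psum ?g (x div m) - psum ?g K))"
      by (rule hyperbola)
    finally have le: "norm (psum (\<lambda>n. \<xi> n * mangoldt n) x) \<le> norm (\<Sum>k=1..K. ?g k * psum ?a (x div k)) + norm (\<Sum>m=1..x div Suc K. ?a m * (psum ?g (x div m) - psum ?g K))"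
      by (simp only: norm_triangle_ineq)
    have "norm (\<Sum>k=1..K. ?g k * psum ?a (x div k)) \<le> (\<Sum>k=1..K. norm (?g k) * (\<epsilon> / (2 * W) * real x + C))"
    proof (rule sum_norm_le)
      fix k assume "k \<in> {1..K}"
      have "norm (psum ?a (x div k)) \<le> \<epsilon> / (2 * W) * real (x div k) + C" by (rule C)
      also have "\<dots> \<le> \<epsilon> / (2 * W) * real x + C" using e W by (intro add_right_mono mult_left_mono) auto
      finally show "norm (?g k * psum ?a (x div k)) \<le> norm (?g k) * (\<epsilon> / (2 * W) * real x + C)"
        unfolding norm_mult[of "?g k"] by (intro mult_left_mono) auto
    qed
    also have "\<dots> = (W - 1) * (\<epsilon> / (2 * W) * real x + C)" by (simp add: W_def sum_distrib_right)
    also have "\<dots> \<le> W * (\<epsilon> / (2 * W) * real x + C)" using e W C by (intro mult_right_mono) auto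
    also have "\<dots> = \<epsilon> / 2 * real x + W * C" using W by (simp add: field_simps)
    finally have le1: "norm (\<Sum>k=1..K. ?g k * psum ?a (x div k)) \<le> \<epsilon> / 2 * real x + W * C" .
    have "norm (\<Sum>m=1..x div Suc K. ?a m * (psum ?g (x div m) - psum ?g K)) \<le> (\<Sum>m=1..x div Suc K. 8 * B * sqrt (real x) * (1 / sqrt (real m)))"
    proof (rule sum_norm_le)
      fix m assume m: "m \<in> {1..x div Suc K}"
      hence "Suc K \<le> x div m" by (auto simp: less_eq_div_iff_mult_less_eq mult.commute simp del: mult_Suc_right)
      \<comment> \<open>\<open>K\<close> stays below \<open>x div m\<close>, so the subtracted
        \<open>psum ?g K\<close> obeys the same bound as \<open>psum ?g (x div m)\<close>.\<close>
      hence Kx: "real K \<le> real (x div m)" by linarith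
      have xm: "real (x div m) \<le> real x / real m" by (rule of_nat_div_le_of_nat)
      have "norm (psum ?g (x div m) - psum ?g K) \<le> 4 * B * sqrt (real (x div m)) + 4 * B * sqrt (real K)"
        by (intro order_trans[OF norm_triangle_ineq4] add_mono psum_chi_ln_bound B)
      also have "\<dots> \<le> 4 * B * sqrt (real x / real m) + 4 * B * sqrt (real x / real m)"
        using Kx xm B0 by (intro add_mono mult_left_mono real_sqrt_le_mono) auto
      also have "\<dots> = 8 * B * sqrt (real x) * (1 / sqrt (real m))" by (simp add: real_sqrt_divide)
      finally have "norm (psum ?g (x div m) - psum ?g K) \<le> 8 * B * sqrt (real x) * (1 / sqrt (real m))" .
      thus "norm (?a m * (psum ?g (x div m) - psum ?g K)) \<le> 8 * B * sqrt (real x) * (1 / sqrt (real m))"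
        unfolding norm_mult[of "?a m"] using b[of m] mult_left_le_one_le[of "norm (psum ?g (x div m) - psum ?g K)" "norm (?a m)"] by simp
    qed
    also have "\<dots> = 8 * B * sqrt (real x) * (\<Sum>m=1..x div Suc K. 1 / sqrt (real m))" by (simp add: sum_distrib_left)
    also have "\<dots> \<le> 8 * B * sqrt (real x) * (2 * sqrt (real (x div Suc K)))"
      using B0 by (intro mult_left_mono sum_inverse_sqrt) auto
    also have "\<dots> \<le> 8 * B * sqrt (real x) * (2 * sqrt (real x / real (Suc K)))"
      using B0 by (intro mult_left_mono real_sqrt_le_mono of_nat_div_le_of_nat) auto
    also have "\<dots> = (16 * B / sqrt (real (Suc K))) * real x" by (simp add: real_sqrt_divide)
    also have "\<dots> \<le> \<epsilon> / 2 * real x"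
    proof (rule mult_right_mono)
      have "32 * B / \<epsilon> \<le> sqrt (real (Suc K))" by (rule real_le_rsqrt) (use K in simp)
      thus "16 * B / sqrt (real (Suc K)) \<le> \<epsilon> / 2" using e by (simp add: divide_simps mult_ac)
    qed auto
    finally have le2: "norm (\<Sum>m=1..x div Suc K. ?a m * (psum ?g (x div m) - psum ?g K)) \<le> \<epsilon> / 2 * real x" .
    have "\<epsilon> * real x = \<epsilon> / 2 * real x + \<epsilon> / 2 * real x" by simp
    with le le1 le2 show ?thesis by linarith
  qed
  thus "\<exists>C. \<forall>n. norm (psum (\<lambda>n. \<xi> n * mangoldt n) n) \<le> \<epsilon> * real n + C" by blast
qed

end

section \<open>Chebyshev's lower bound and the passage from prime powers to primes\<close>

definition primes_le :: "nat \<Rightarrow> nat set" where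
  "primes_le x = {p. prime p \<and> p \<le> x}"

lemma finite_primes_le [simp]: "finite (primes_le x)"
  unfolding primes_le_def by (rule finite_subset[of _ "{..x}"]) auto

definition proper_primepows_le :: "nat \<Rightarrow> nat set" where
  "proper_primepows_le x = {n. primepow n \<and> \<not> prime n \<and> n \<le> x}"

text \<open>Such a number is \<open>p ^ k\<close> with \<open>k \<ge> 2\<close>, which forces
  \<open>p \<le> sqrt x\<close> and \<open>k \<le> log 2 x\<close>.\<close>

lemma card_proper_primepows_le:
  assumes "x \<ge> 1"
  shows "real (card (proper_primepows_le x)) \<le> sqrt (real x) * log 2 (real x)"
proof -
  let ?R = "{1..nat \<lfloor>sqrt (real x)\<rfloor>} \<times> {1..nat \<lfloor>log 2 (real x)\<rfloor>}"
  have "proper_primepows_le x \<subseteq> (\<lambda>(p,k). p ^ k) ` ?R"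
  proof
    fix n assume n: "n \<in> proper_primepows_le x"
    then obtain p k where pk: "prime p" "k > 0" "n = p ^ k"
      by (auto simp: proper_primepows_le_def primepow_def)
    have k2: "k \<ge> 2" using n pk by (cases "k = 1") (auto simp: proper_primepows_le_def)
    have p2: "p \<ge> 2" using pk prime_ge_2_nat by blast
    have nx: "n \<le> x" using n by (auto simp: proper_primepows_le_def)
    have "p ^ 2 \<le> p ^ k" using k2 p2 by (intro power_increasing) auto
    hence "real (p ^ 2) \<le> real x" using nx pk by (intro of_nat_mono) auto
    hence "real p \<le> sqrt (real x)" by (intro real_le_rsqrt) simp
    hence "p \<le> nat \<lfloor>sqrt (real x)\<rfloor>" by (simp add: le_nat_floor)
    moreover have "2 ^ k \<le> p ^ k" using p2 by (rule power_mono) auto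
    hence "real (2 ^ k) \<le> real x" using le_trans[of "2 ^ k" "p ^ k" x] nx pk(3) by (intro of_nat_mono) auto
    hence "real k \<le> log 2 (real x)" using assms by (subst le_log_iff) (auto simp: powr_realpow)
    hence "k \<le> nat \<lfloor>log 2 (real x)\<rfloor>" by (simp add: le_nat_floor)
    ultimately have "(p, k) \<in> ?R" using p2 k2 by simp
    thus "n \<in> (\<lambda>(p,k). p ^ k) ` ?R" by (rule image_eqI[rotated]) (simp add: pk(3))
  qed
  hence "card (proper_primepows_le x) \<le> card ((\<lambda>(p,k). p ^ k) ` ?R)" by (intro card_mono) auto
  also have "\<dots> \<le> card ?R" by (rule card_image_le) auto
  also have "\<dots> = nat \<lfloor>sqrt (real x)\<rfloor> * nat \<lfloor>log 2 (real x)\<rfloor>" by simp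
  finally have "real (card (proper_primepows_le x)) \<le> real (nat \<lfloor>sqrt (real x)\<rfloor>) * real (nat \<lfloor>log 2 (real x)\<rfloor>)"
    by (metis of_nat_mono of_nat_mult)
  also have "\<dots> \<le> sqrt (real x) * log 2 (real x)" using assms by (intro mult_mono of_nat_floor) auto
  finally show ?thesis .
qed

lemma sum_mangoldt_split:
  fixes f :: "nat \<Rightarrow> 'a :: comm_semiring_1" and L :: "nat \<Rightarrow> 'a"
  assumes "\<And>n. \<not> primepow n \<Longrightarrow> L n = 0"
  shows "psum (\<lambda>n. f n * L n) x = (\<Sum>p\<in>primes_le x. f p * L p) + (\<Sum>n\<in>proper_primepows_le x. f n * L n)"
proof -
  have "psum (\<lambda>n. f n * L n) x = (\<Sum>n\<in>primes_le x \<union> proper_primepows_le x. f n * L n)"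
    unfolding psum_def
    by (rule sum.mono_neutral_right)
       (auto simp: primes_le_def proper_primepows_le_def assms Suc_le_eq prime_gt_0_nat primepow_gt_0_nat)
  also have "\<dots> = (\<Sum>p\<in>primes_le x. f p * L p) + (\<Sum>n\<in>proper_primepows_le x. f n * L n)"
    by (rule sum.union_disjoint) (auto simp: primes_le_def proper_primepows_le_def)
  finally show ?thesis .
qed

text \<open>The upper limit may exceed \<open>n\<close>, since the extra terms have
  \<open>n div d = 0\<close>; this lets the expansions of \<open>fact (2 * n)\<close> and
  \<open>fact n\<close> share one range.\<close>

lemma ln_fact_mangoldt:
  assumes "n \<le> m"
  shows "ln (fact n) = (\<Sum>d=1..m. mangoldt d * real (n div d))"
proof -
  have "ln (fact n :: real) = (\<Sum>k=1..n. ln (real k))"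
  proof (induction n)
    case (Suc n)
    have "ln (fact (Suc n) :: real) = ln (real (Suc n) * fact n)" by (simp add: mult.commute)
    also have "\<dots> = ln (real (Suc n)) + ln (fact n)" by (simp add: ln_mult del: of_nat_Suc)
    finally show ?case using Suc by simp
  qed auto
  also have "\<dots> = (\<Sum>k=1..n. \<Sum>d | d dvd k. mangoldt d)"
    by (intro sum.cong refl) (simp add: mangoldt_sum)
  also have "\<dots> = (\<Sum>(k,d)\<in>(SIGMA k:{1..n}. {d. d dvd k}). mangoldt d)" by (rule sum.Sigma) auto
  also have "\<dots> = (\<Sum>(d,j)\<in>(SIGMA d:{1..m}. {1..n div d}). mangoldt d)"
  proof (rule sum.reindex_bij_witness[where i = "\<lambda>(d,j). (d * j, d)" and j = "\<lambda>(k,d). (d, k div d)"])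
    fix b assume "b \<in> (SIGMA k:{1..n}. {d. d dvd k})"
    then obtain k d where b: "b = (k, d)" "k \<ge> 1" "k \<le> n" "d dvd k" by auto
    then have "k div d \<ge> 1" "d \<ge> 1" "d \<le> k" by (auto simp: dvd_div_eq_0_iff Suc_le_eq dvd_imp_le intro!: Nat.gr0I)
    with b assms show "(case case b of (k, d) \<Rightarrow> (d, k div d) of (d, j) \<Rightarrow> (d * j, d)) = b"
      "(case b of (k, d) \<Rightarrow> (d, k div d)) \<in> (SIGMA d:{1..m}. {1..n div d})" by (auto intro: div_le_mono)
  qed (auto simp: less_eq_div_iff_mult_less_eq mult.commute)
  also have "\<dots> = (\<Sum>d=1..m. \<Sum>j=1..n div d. mangoldt d)" by (rule sum.Sigma[symmetric]) auto
  also have "\<dots> = (\<Sum>d=1..m. mangoldt d * real (n div d))" by (simp add: mult.commute)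
  finally show ?thesis .
qed

text \<open>Chebyshev's argument with the central binomial coefficient, which is at least
  \<open>2 ^ n\<close>: in the expansion of its logarithm every value of the von Mangoldt function
  has a coefficient of at most 1.\<close>

lemma psi_even_lower: "real n * ln 2 \<le> psum mangoldt (2 * n)"
proof -
  have "2 ^ n * (fact n)^2 \<le> (fact (2 * n) :: real)"
  proof (induction n)
    case (Suc n)
    have "2 ^ Suc n * (fact (Suc n))^2 = (2 ^ n * (fact n)^2) * (2 * real (Suc n) ^ 2)"
      by (simp add: power2_eq_square algebra_simps)
    also have "\<dots> \<le> fact (2 * n) * (2 * real (Suc n) ^ 2)" by (intro mult_right_mono Suc) auto
    also have "\<dots> \<le> fact (2 * n) * (real (2 * n + 1) * real (2 * n + 2))"
      by (intro mult_left_mono) (auto simp: power2_eq_square algebra_simps)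
    also have "\<dots> = fact (2 * Suc n)" by (simp add: algebra_simps)
    finally show ?case .
  qed auto
  hence "ln (2 ^ n * (fact n)^2) \<le> ln (fact (2 * n) :: real)" by (subst ln_le_cancel_iff) auto
  hence "real n * ln 2 \<le> ln (fact (2 * n)) - 2 * ln (fact n)" by (simp add: ln_mult ln_realpow)
  also have "\<dots> = (\<Sum>d=1..2*n. mangoldt d * (real (2 * n div d) - 2 * real (n div d)))"
  proof -
    have f: "ln (fact (2 * n)) = (\<Sum>d=1..2*n. mangoldt d * real (2 * n div d))" "ln (fact n) = (\<Sum>d=1..2*n. mangoldt d * real (n div d))"
      by (rule ln_fact_mangoldt; simp)+
    show ?thesis unfolding f by (simp add: sum_distrib_left right_diff_distrib sum_subtractf mult.left_commute)
  qed
  also have "\<dots> \<le> (\<Sum>d=1..2*n. mangoldt d * 1)"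
  proof (intro sum_mono mult_left_mono mangoldt_nonneg)
    fix d assume "d \<in> {1..2*n}"
    hence d: "d > 0" by auto
    have "n < d * (n div d) + d" using mult_div_mod_eq[of d n] mod_less_divisor[OF d, of n] by linarith
    hence "2 * n < (2 * (n div d) + 2) * d" by (simp add: algebra_simps)
    hence "2 * n div d < 2 * (n div d) + 2" using d by (simp add: div_less_iff_less_mult)
    thus "real (2 * n div d) - 2 * real (n div d) \<le> 1" by linarith
  qed
  finally show ?thesis by (simp add: psum_def)
qed

text \<open>The constant 5 combines \<open>x div 2 \<ge> x / 3\<close> with
  \<open>ln 2 \<ge> 3 / 5\<close>. Every prime or prime power up to \<open>x\<close> adds at most
  \<open>ln x\<close> to the sum of the von Mangoldt function; the subtracted term pays for the
  proper powers.\<close>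

lemma chebyshev_lower:
  assumes x: "x \<ge> 2"
  shows "real x / (5 * ln (real x)) - sqrt (real x) * log 2 (real x) \<le> real (card (primes_le x))"
proof -
  have lnx: "ln (real x) > 0" using x by simp
  have ln2: "ln 2 \<ge> (3/5 :: real)"
  proof -
    have "exp (3/5 :: real) \<le> 1 + 3/5 + (3/5)^2" by (rule exp_bound) auto
    also have "\<dots> \<le> 2" by (simp add: power2_eq_square)
    finally show ?thesis by (subst ln_ge_iff) auto
  qed
  have "x \<le> 3 * (x div 2)" using x by presburger
  hence "real x / 3 \<le> real (x div 2)" by linarith
  hence "real x / 3 * (3/5) \<le> real (x div 2) * ln 2" using ln2 by (intro mult_mono) auto
  hence "real x / 5 \<le> real (x div 2) * ln 2" by simp
  also have "\<dots> \<le> psum mangoldt (2 * (x div 2))" by (rule psi_even_lower)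
  also have "\<dots> \<le> psum mangoldt x"
    unfolding psum_def by (intro sum_mono2) (auto simp: mangoldt_nonneg)
  also have "\<dots> = psum (\<lambda>n. 1 * mangoldt n) x" by simp
  also have "\<dots> = (\<Sum>p\<in>primes_le x. 1 * mangoldt p) + (\<Sum>n\<in>proper_primepows_le x. 1 * mangoldt n)"
    by (rule sum_mangoldt_split) (auto simp: mangoldt_def)
  also have "\<dots> \<le> (\<Sum>p\<in>primes_le x. ln (real x)) + (\<Sum>n\<in>proper_primepows_le x. ln (real x))"
  proof (intro add_mono sum_mono)
    have le: "1 * mangoldt n \<le> ln (real x)" if "n \<le> x" "n > 0" for n
      using mangoldt_le[of n] that by (smt (verit) ln_le_cancel_iff of_nat_0_less_iff of_nat_le_iff)
    show "1 * mangoldt p \<le> ln (real x)" if "p \<in> primes_le x" for p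
      using that by (intro le) (auto simp: primes_le_def prime_gt_0_nat)
    show "1 * mangoldt p \<le> ln (real x)" if "p \<in> proper_primepows_le x" for p
      using that by (intro le) (auto simp: proper_primepows_le_def primepow_gt_0_nat)
  qed
  also have "\<dots> = (real (card (primes_le x)) + real (card (proper_primepows_le x))) * ln (real x)" by (simp add: algebra_simps)
  also have "\<dots> \<le> (real (card (primes_le x)) + sqrt (real x) * log 2 (real x)) * ln (real x)"
    using lnx x by (intro mult_right_mono add_left_mono card_proper_primepows_le) auto
  finally have "real x / 5 / ln (real x) \<le> real (card (primes_le x)) + sqrt (real x) * log 2 (real x)"
    using lnx by (simp add: pos_divide_le_eq)
  thus ?thesis by simp
qed

text \<open>The weight \<open>1 / ln n\<close> turns the von Mangoldt function into the indicator of
  the primes. The maximum with 2 makes it nonnegative and decreasing from 0 on.\<close>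

definition ln_weight :: "nat \<Rightarrow> real" where "ln_weight n = 1 / ln (real (max 2 n))"

lemma ln_weight_nonneg: "ln_weight n \<ge> 0" and ln_weight_le: "ln_weight n \<le> 1 / ln 2" and ln_weight_mono: "m \<le> n \<Longrightarrow> ln_weight n \<le> ln_weight m"
  unfolding ln_weight_def by (auto intro!: divide_left_mono mult_pos_pos)

text \<open>The sum is split at the square root of \<open>x\<close>: at most \<open>sqrt x\<close>
  indices lie below it, and above it \<open>ln n\<close> is at least
  \<open>ln x / 2\<close>.\<close>

lemma psum_ln_weight_bound:
  assumes x: "x \<ge> 2"
  shows "psum ln_weight x \<le> sqrt (real x) / ln 2 + 2 * real x / ln (real x)"
proof -
  have lnx: "ln (real x) > 0" using x by simp
  let ?A = "{n\<in>{1..x}. n^2 \<le> x}"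
  have "psum ln_weight x \<le> (\<Sum>n=1..x. (if n^2 \<le> x then 1 / ln 2 else 0) + 2 / ln (real x))"
    unfolding psum_def
  proof (rule sum_mono)
    fix n assume n: "n \<in> {1..x}"
    show "ln_weight n \<le> (if n^2 \<le> x then 1 / ln 2 else 0) + 2 / ln (real x)"
    proof (cases "n^2 \<le> x")
      case True
      thus ?thesis using ln_weight_le[of n] lnx by (simp add: add_increasing2)
    next
      case False
      hence n2: "n \<ge> 2" using n x by (cases "n = 1") auto
      have "real x \<le> real n ^ 2" using False by (metis of_nat_mono of_nat_power nat_le_linear)
      hence "ln (real x) \<le> ln (real n ^ 2)" using x n2 by (subst ln_le_cancel_iff) auto
      also have "\<dots> = 2 * ln (real n)" using n2 by (simp add: ln_realpow)
      finally have "ln (real x) \<le> 2 * ln (real n)" .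
      hence "1 / ln (real n) \<le> 2 / ln (real x)" using lnx n2 by (simp add: divide_simps)
      thus ?thesis using False n2 by (simp add: ln_weight_def max_def)
    qed
  qed
  also have "\<dots> = (\<Sum>n=1..x. if n^2 \<le> x then 1 / ln 2 else 0) + 2 * real x / ln (real x)"
    by (simp add: sum.distrib)
  also have "(\<Sum>n=1..x. if n^2 \<le> x then 1 / ln 2 else (0::real)) = (\<Sum>n\<in>?A. 1 / ln 2)"
    by (rule sum.mono_neutral_cong_right) auto
  also have "\<dots> = real (card ?A) / ln 2" by simp
  also have "real (card ?A) \<le> sqrt (real x)"
  proof -
    have "?A \<subseteq> {1..nat \<lfloor>sqrt (real x)\<rfloor>}"
    proof
      fix n assume "n \<in> ?A"
      hence "real (n^2) \<le> real x" "n \<ge> 1" by (auto simp del: of_nat_power)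
      hence "real n \<le> sqrt (real x)" by (intro real_le_rsqrt) simp
      thus "n \<in> {1..nat \<lfloor>sqrt (real x)\<rfloor>}" using \<open>n \<ge> 1\<close> by (simp add: le_nat_floor)
    qed
    hence "card ?A \<le> card {1..nat \<lfloor>sqrt (real x)\<rfloor>}" by (intro card_mono) auto
    hence "card ?A \<le> nat \<lfloor>sqrt (real x)\<rfloor>" by simp
    hence "real (card ?A) \<le> real (nat \<lfloor>sqrt (real x)\<rfloor>)" by (rule of_nat_mono)
    also have "\<dots> \<le> sqrt (real x)" by (intro of_nat_floor) auto
    finally show ?thesis .
  qed
  finally show ?thesis by (simp add: divide_right_mono)
qed

text \<open>After summation by parts all differences of \<open>w\<close> are nonnegative, so the
  partial sums may be replaced by \<open>\<epsilon> * n + C\<close>; undoing the summation by parts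
  for this sequence gives the right side.\<close>

lemma psum_weighted_bound:
  fixes f :: "nat \<Rightarrow> complex" and w :: "nat \<Rightarrow> real"
  assumes f: "\<And>n. norm (psum f n) \<le> \<epsilon> * real n + C" and w: "\<And>n. w n \<ge> 0" "\<And>n. w (Suc n) \<le> w n"
  shows "norm (psum (\<lambda>n. f n * of_real (w n)) x) \<le> \<epsilon> * psum w x + C * w 1"
proof -
  have "norm (psum (\<lambda>n. f n * of_real (w n)) x) \<le> norm (psum f x * of_real (w (Suc x))) + (\<Sum>n=1..x. norm (psum f n * (of_real (w n) - of_real (w (Suc n)))))"
    unfolding abel_psum by (intro order_trans[OF norm_triangle_ineq] add_mono order_refl norm_sum)
  also have "\<dots> \<le> (\<epsilon> * real x + C) * w (Suc x) + (\<Sum>n=1..x. (\<epsilon> * real n + C) * (w n - w (Suc n)))"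
  proof (intro add_mono sum_mono)
    show "norm (psum f x * of_real (w (Suc x))) \<le> (\<epsilon> * real x + C) * w (Suc x)"
      unfolding norm_mult norm_of_real using w by (simp add: mult_right_mono f)
    show "norm (psum f n * (of_real (w n) - of_real (w (Suc n)))) \<le> (\<epsilon> * real n + C) * (w n - w (Suc n))" for n
      unfolding norm_mult of_real_diff[symmetric] norm_of_real using w(2)[of n] by (simp add: mult_right_mono f)
  qed
  also have "\<dots> = \<epsilon> * psum w x + C * w 1"
    by (induction x) (auto simp: algebra_simps)
  finally show ?thesis .
qed

context dchar
begin

theorem prime_sum_nonprincipal:
  assumes u: "coprime u N" "\<xi> u \<noteq> 1"
  shows "(\<lambda>x. (\<Sum>p\<in>primes_le x. \<xi> p) / of_nat (card (primes_le x))) \<longlonglongrightarrow> 0"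
proof (rule LIMSEQ_I)
  fix \<epsilon> :: real assume e: "\<epsilon> > 0"
  \<comment> \<open>The character sum will be below \<open>3 * \<delta> * G\<close> with
    \<open>G = x / ln x\<close>, and the number of primes above \<open>G / 6\<close>; with 36 the
    quotient stays below \<open>\<epsilon>\<close>.\<close>
  define \<delta> where "\<delta> = \<epsilon> / 36"
  have d: "\<delta> > 0" using e by (simp add: \<delta>_def)
  obtain C where C: "C \<ge> 0" "\<And>n. norm (psum (\<lambda>n. \<xi> n * mangoldt n) n) \<le> \<delta> * real n + C"
    using psum_linear_bound[OF psum_chi_mangoldt[OF u] d] by blast
  have bound: "norm (\<Sum>p\<in>primes_le x. \<xi> p) \<le> \<delta> * (sqrt (real x) / ln 2 + 2 * real x / ln (real x)) + C * (1 / ln 2) + sqrt (real x) * log 2 (real x)"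
    if x: "x \<ge> 2" for x
  proof -
    \<comment> \<open>Equal to 1 at primes and of norm at most 1 at the other prime powers, whose
      contribution is therefore at most their number.\<close>
    let ?L = "\<lambda>n. mangoldt n * of_real (ln_weight n) :: complex"
    have "psum (\<lambda>n. \<xi> n * ?L n) x = (\<Sum>p\<in>primes_le x. \<xi> p * ?L p) + (\<Sum>n\<in>proper_primepows_le x. \<xi> n * ?L n)"
      by (rule sum_mangoldt_split) (auto simp: mangoldt_def)
    also have "(\<Sum>p\<in>primes_le x. \<xi> p * ?L p) = (\<Sum>p\<in>primes_le x. \<xi> p)"
    proof (rule sum.cong)
      fix p assume "p \<in> primes_le x"
      hence "prime p" by (simp add: primes_le_def)
      thus "\<xi> p * ?L p = \<xi> p" using prime_ge_2_nat[of p] by (simp add: ln_weight_def max_def)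
    qed auto
    finally have "(\<Sum>p\<in>primes_le x. \<xi> p) = psum (\<lambda>n. (\<xi> n * mangoldt n) * of_real (ln_weight n)) x - (\<Sum>n\<in>proper_primepows_le x. \<xi> n * ?L n)"
      by (simp add: mult.assoc)
    also have "norm \<dots> \<le> norm (psum (\<lambda>n. (\<xi> n * mangoldt n) * of_real (ln_weight n)) x) + norm (\<Sum>n\<in>proper_primepows_le x. \<xi> n * ?L n)"
      by (rule norm_triangle_ineq4)
    also have "\<dots> \<le> (\<delta> * psum ln_weight x + C * ln_weight 1) + (\<Sum>n\<in>proper_primepows_le x. 1)"
    proof (intro add_mono psum_weighted_bound C sum_norm_le)
      fix n assume "n \<in> proper_primepows_le x"
      hence n: "n \<ge> 2" using primepow_gt_Suc_0[of n] by (auto simp: proper_primepows_le_def)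
      have "norm (?L n) = mangoldt n * ln_weight n" using ln_weight_nonneg[of n] by (simp add: norm_mult)
      also have "\<dots> \<le> ln (real n) * ln_weight n" using mangoldt_le[of n] n by (intro mult_right_mono ln_weight_nonneg) auto
      also have "\<dots> = 1" using n by (simp add: ln_weight_def max_def)
      finally have "norm (?L n) \<le> 1" .
      thus "norm (\<xi> n * ?L n) \<le> 1"
        unfolding norm_mult[of "\<xi> n"] by (intro mult_le_one norm_chi_le) auto
    qed (auto intro: ln_weight_nonneg ln_weight_mono)
    also have "\<dots> \<le> (\<delta> * (sqrt (real x) / ln 2 + 2 * real x / ln (real x)) + C * (1 / ln 2)) + sqrt (real x) * log 2 (real x)"
      using d C x card_proper_primepows_le[of x] by (intro add_mono mult_left_mono psum_ln_weight_bound ln_weight_le) auto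
    finally show ?thesis by simp
  qed
  let ?g = "\<lambda>x. real x / ln (real x)"
  have l1: "(\<lambda>x::nat. \<delta> * ((sqrt (real x) / ln 2) / (real x / ln (real x)) + 2) + C * (1 / ln 2) * (1 / (real x / ln (real x))) + sqrt (real x) * log 2 (real x) / (real x / ln (real x))) \<longlonglongrightarrow> \<delta> * (0 + 2) + C * (1 / ln 2) * 0 + 0"
  proof (intro tendsto_intros)
    show "(\<lambda>x::nat. (sqrt (real x) / ln 2) / (real x / ln (real x))) \<longlonglongrightarrow> 0" by real_asymp
    show "(\<lambda>x::nat. 1 / (real x / ln (real x))) \<longlonglongrightarrow> 0" by real_asymp
    show "(\<lambda>x::nat. sqrt (real x) * log 2 (real x) / (real x / ln (real x))) \<longlonglongrightarrow> 0" by real_asymp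
  qed
  have "eventually (\<lambda>x::nat. \<delta> * ((sqrt (real x) / ln 2) / (real x / ln (real x)) + 2) + C * (1 / ln 2) * (1 / (real x / ln (real x))) + sqrt (real x) * log 2 (real x) / (real x / ln (real x)) < 3 * \<delta>) sequentially"
    by (rule order_tendstoD[OF l1]) (use d in auto)
  moreover have "eventually (\<lambda>x::nat. sqrt (real x) * log 2 (real x) < (real x / ln (real x)) * (1/30)) sequentially" by real_asymp
  \<comment> \<open>The fraction is \<open>1/5 - 1/6\<close>, so that Chebyshev's bound leaves
    \<open>G / 6\<close>.\<close>
  moreover have "eventually (\<lambda>x::nat. x \<ge> 3) sequentially" by (rule eventually_ge_at_top)
  ultimately have "eventually (\<lambda>x. norm ((\<Sum>p\<in>primes_le x. \<xi> p) / of_nat (card (primes_le x))) < \<epsilon>) sequentially"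
  proof eventually_elim
    case (elim x)
    define G where "G = real x / ln (real x)"
    have G: "G > 0" using elim(3) by (simp add: G_def)
    have "G / 5 - G * (1/30) < real (card (primes_le x))"
      using chebyshev_lower[of x] elim(2,3) by (simp add: G_def)
    hence pi: "real (card (primes_le x)) > G / 6" by simp
    have "norm (\<Sum>p\<in>primes_le x. \<xi> p) / G \<le> (\<delta> * (sqrt (real x) / ln 2 + 2 * real x / ln (real x)) + C * (1 / ln 2) + sqrt (real x) * log 2 (real x)) / G"
      using bound[of x] elim(3) G by (intro divide_right_mono) auto
    also have "\<dots> = \<delta> * ((sqrt (real x) / ln 2) / G + 2) + C * (1 / ln 2) * (1 / G) + sqrt (real x) * log 2 (real x) / G"
    proof -
      have "2 * real x / ln (real x) = 2 * G" by (simp add: G_def)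
      thus ?thesis using G by (simp only: add_divide_distrib distrib_left) (simp add: field_simps)
    qed
    also have "\<dots> < 3 * \<delta>" using elim(1) by (simp only: G_def)
    finally have "norm (\<Sum>p\<in>primes_le x. \<xi> p) < 3 * \<delta> * G" using G by (simp add: pos_divide_less_eq)
    also have "\<dots> = \<epsilon> / 2 * (G / 6)" by (simp add: \<delta>_def)
    also have "\<dots> \<le> \<epsilon> * real (card (primes_le x))" using pi e G by (intro mult_mono) auto
    finally show ?case using pi G by (simp add: norm_divide pos_divide_less_eq)
  qed
  thus "\<exists>x0. \<forall>x\<ge>x0. norm ((\<Sum>p\<in>primes_le x. \<xi> p) / of_nat (card (primes_le x)) - 0) < \<epsilon>"
    by (simp add: eventually_sequentially)
qed

end

section \<open>Equidistribution of primes in residue classes\<close>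

lemma card_primes_le_at_top: "filterlim (\<lambda>x. real (card (primes_le x))) at_top sequentially"
proof (rule filterlim_at_top_mono)
  show "filterlim (\<lambda>x::nat. real x / (5 * ln (real x)) - sqrt (real x) * log 2 (real x)) at_top sequentially"
    by real_asymp
  show "eventually (\<lambda>x. real x / (5 * ln (real x)) - sqrt (real x) * log 2 (real x) \<le> real (card (primes_le x))) sequentially"
    using eventually_ge_at_top[of 2] by eventually_elim (rule chebyshev_lower)
qed

definition prime_mean :: "(nat \<Rightarrow> complex) \<Rightarrow> complex \<Rightarrow> bool" where
  "prime_mean h l \<longleftrightarrow> (\<lambda>x. (\<Sum>p\<in>primes_le x. h p) / of_nat (card (primes_le x))) \<longlonglongrightarrow> l"

lemma prime_mean_add: "prime_mean h l \<Longrightarrow> prime_mean h' l' \<Longrightarrow> prime_mean (\<lambda>n. h n + h' n) (l + l')"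
  unfolding prime_mean_def by (drule (1) tendsto_add) (simp add: sum.distrib add_divide_distrib)

lemma prime_mean_cmult: "prime_mean h l \<Longrightarrow> prime_mean (\<lambda>n. c * h n) (c * l)"
  unfolding prime_mean_def by (drule tendsto_mult_left[of _ _ _ c]) (simp add: sum_distrib_left)

lemma prime_mean_0: "prime_mean (\<lambda>n. 0) 0"
  by (simp add: prime_mean_def)

lemma prime_mean_sum:
  "(\<And>i. i \<in> A \<Longrightarrow> prime_mean (h i) (l i)) \<Longrightarrow> prime_mean (\<lambda>n. \<Sum>i\<in>A. h i n) (\<Sum>i\<in>A. l i)"
  by (induction A rule: infinite_finite_induct) (simp_all add: prime_mean_0 prime_mean_add)

lemma prime_mean_unique: "prime_mean h l \<Longrightarrow> prime_mean h l' \<Longrightarrow> l = l'"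
  unfolding prime_mean_def by (rule LIMSEQ_unique)

lemma prime_mean_1: "prime_mean (\<lambda>_. 1) 1"
proof -
  have "eventually (\<lambda>x. real (card (primes_le x)) > 0) sequentially"
    using card_primes_le_at_top unfolding filterlim_at_top_dense by blast
  hence "eventually (\<lambda>x. 1 = (\<Sum>p\<in>primes_le x. 1) / complex_of_nat (card (primes_le x))) sequentially"
    by eventually_elim auto
  thus ?thesis unfolding prime_mean_def by (rule Lim_transform_eventually[OF tendsto_const])
qed

lemma prime_mean_finite_change:
  assumes h: "prime_mean h l" and fin: "finite {p. prime p \<and> h p \<noteq> h' p}"
  shows "prime_mean h' l"
proof -
  let ?F = "{p. prime p \<and> h p \<noteq> h' p}"
  define C where "C = (\<Sum>p\<in>?F. norm (h' p - h p))"
  have b: "norm ((\<Sum>p\<in>primes_le x. h' p - h p) / of_nat (card (primes_le x))) \<le> C / real (card (primes_le x))" for x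
  proof -
    have "norm (\<Sum>p\<in>primes_le x. h' p - h p) \<le> (\<Sum>p\<in>primes_le x. norm (h' p - h p))" by (rule norm_sum)
    also have "\<dots> = (\<Sum>p\<in>primes_le x \<inter> ?F. norm (h' p - h p))"
      by (rule sum.mono_neutral_right) (auto simp: primes_le_def)
    also have "\<dots> \<le> C" unfolding C_def by (rule sum_mono2[OF fin]) auto
    finally show ?thesis by (simp add: norm_divide divide_right_mono)
  qed
  have c: "(\<lambda>x. C / real (card (primes_le x))) \<longlonglongrightarrow> 0"
    by (rule real_tendsto_divide_at_top[OF tendsto_const card_primes_le_at_top])
  have "(\<lambda>x. (\<Sum>p\<in>primes_le x. h' p - h p) / of_nat (card (primes_le x))) \<longlonglongrightarrow> 0"
    by (rule Lim_null_comparison[OF _ c], rule always_eventually, rule allI, rule b)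
  hence "prime_mean (\<lambda>n. h' n - h n) 0" by (simp add: prime_mean_def)
  from prime_mean_add[OF h this] show ?thesis by simp
qed

text \<open>The functions on the unit group modulo \<open>N\<close>, extended by zero.\<close>

definition unit_periodic :: "nat \<Rightarrow> (nat \<Rightarrow> complex) \<Rightarrow> bool" where
  "unit_periodic N h \<longleftrightarrow> (\<forall>n. h (n + N) = h n) \<and> (\<forall>n. \<not> coprime n N \<longrightarrow> h n = 0)"

lemma unit_periodicD:
  assumes "unit_periodic N h"
  shows "h (n + N) = h n" "\<not> coprime n N \<Longrightarrow> h n = 0" "[m = n] (mod N) \<Longrightarrow> h m = h n"
proof -
  show per: "h (n + N) = h n" for n using assms by (simp add: unit_periodic_def)
  show "\<not> coprime n N \<Longrightarrow> h n = 0" using assms by (simp add: unit_periodic_def)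
  show "[m = n] (mod N) \<Longrightarrow> h m = h n"
    using periodic_mod[of h N, OF per] by (metis cong_mod_def)
qed

text \<open>For a function supported on the units, this is its average over the unit group.\<close>

definition class_mean :: "nat \<Rightarrow> (nat \<Rightarrow> complex) \<Rightarrow> complex" where
  "class_mean N h = (\<Sum>k<N. h k) / of_nat (totient N)"

lemma sum_chi0: "N > 0 \<Longrightarrow> (\<Sum>k<N. chi0 N k) = of_nat (totient N)"
proof -
  assume N: "N > 0"
  have "chi0 N (n + N) = chi0 N n" for n
    unfolding chi0_def by (simp only: coprime_iff_gcd_eq_1 gcd_add1)
  hence "(\<Sum>k<N. chi0 N k) = psum (chi0 N) N" using N by (intro psum_period[symmetric])
  also have "\<dots> = (\<Sum>k\<in>totatives N. 1)"
    unfolding psum_def by (rule sum.mono_neutral_cong_right) (auto simp: chi0_def totatives_def)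
  finally show ?thesis by (simp add: totient_def)
qed

lemma (in dchar) prime_mean_dchar: "prime_mean \<xi> (class_mean N \<xi>)"
proof (cases "\<exists>u. coprime u N \<and> \<xi> u \<noteq> 1")
  case True
  then obtain u where u: "coprime u N" "\<xi> u \<noteq> 1" by blast
  have "(\<Sum>k<N. \<xi> k) = 0"
    using psum_zero[OF u] psum_period[of \<xi> N, OF periodic N_pos] by simp
  thus ?thesis using prime_sum_nonprincipal[OF u] by (simp add: prime_mean_def class_mean_def)
next
  case False
  hence eq: "\<xi> = chi0 N" using zero_iff by (auto simp: chi0_def fun_eq_iff)
  have "prime_mean (chi0 N) 1"
  proof (rule prime_mean_finite_change[OF prime_mean_1])
    have "{p. prime p \<and> 1 \<noteq> chi0 N p} \<subseteq> {..N}"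
      using N_pos by (auto simp: chi0_def split: if_splits dest!: prime_imp_coprime[of _ N] intro: dvd_imp_le)
    thus "finite {p. prime p \<and> 1 \<noteq> chi0 N p}" by (rule finite_subset) auto
  qed
  thus ?thesis unfolding eq class_mean_def sum_chi0[OF N_pos] using N_pos by simp
qed

text \<open>Simultaneous eigenvectors of the translations by elements of \<open>B\<close>. The empty
  \<open>B\<close> allows every function on the units, while a full set of representatives allows
  only multiples of characters.\<close>

definition eigen_units :: "nat \<Rightarrow> nat set \<Rightarrow> (nat \<Rightarrow> complex) set" where
  "eigen_units N B = {h. unit_periodic N h \<and> (\<forall>g\<in>B. \<exists>c. \<forall>n. h (g * n) = c * h n)}"

text \<open>The eigenvalue of translation by \<open>m\<close> can be read off at 1 as
  \<open>h m / h 1\<close>, so \<open>h\<close> divided by \<open>h 1\<close> is multiplicative. If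
  \<open>h 1 = 0\<close> then \<open>h\<close> vanishes.\<close>

lemma prime_mean_eigen_all:
  assumes N: "N > 0" and h: "h \<in> eigen_units N {g. g < N \<and> coprime g N}"
  shows "prime_mean h (class_mean N h)"
proof -
  have up: "unit_periodic N h" using h by (simp add: eigen_units_def)
  have eig: "\<exists>c. \<forall>n. h (g * n) = c * h n" if g: "coprime g N" for g
  proof -
    have "g mod N \<in> {g. g < N \<and> coprime g N}" using N g by simp
    then obtain c where c: "\<And>n. h ((g mod N) * n) = c * h n" using h by (auto simp: eigen_units_def)
    have "h (g * n) = h ((g mod N) * n)" for n
      by (rule unit_periodicD(3)[OF up]) (simp add: cong_mod_def mod_mult_left_eq)
    thus ?thesis using c by auto
  qed
  show ?thesis
  proof (cases "h 1 = 0")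
    case True
    have "h g = 0" for g
    proof (cases "coprime g N")
      case c: True
      from eig[OF c] obtain c where "\<And>n. h (g * n) = c * h n" by blast
      from this[of 1] show ?thesis using True by simp
    qed (use unit_periodicD(2)[OF up] in auto)
    hence "h = (\<lambda>_. 0)" by auto
    thus ?thesis by (simp add: class_mean_def prime_mean_0)
  next
    case False
    define \<xi> where "\<xi> = (\<lambda>n. h n / h 1)"
    have mult: "\<xi> (m * n) = \<xi> m * \<xi> n" for m n
    proof (cases "coprime m N")
      case True
      then obtain c where c: "\<And>n. h (m * n) = c * h n" using eig by blast
      from c[of 1] have "c = h m / h 1" using False by simp
      thus ?thesis using c[of n] by (simp add: \<xi>_def)
    next
      case nc: False
      hence "\<not> coprime (m * n) N" by simp
      thus ?thesis using unit_periodicD(2)[OF up] nc by (simp add: \<xi>_def)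
    qed
    have nz: "\<xi> n \<noteq> 0" if n: "coprime n N" for n
    proof
      assume z: "\<xi> n = 0"
      have "\<xi> (n ^ totient N) = \<xi> (n * n ^ (totient N - 1))" using N by (cases "totient N") auto
      hence "\<xi> (n ^ totient N) = 0" by (simp add: mult z)
      moreover have "\<xi> (n ^ totient N) = \<xi> 1"
        unfolding \<xi>_def using unit_periodicD(3)[OF up euler_theorem[OF n]] by simp
      ultimately show False using False by (simp add: \<xi>_def)
    qed
    interpret dchar N \<xi>
    proof
      show "\<xi> (m * n) = \<xi> m * \<xi> n" for m n by (rule mult)
      show "\<xi> (n + N) = \<xi> n" for n by (simp add: \<xi>_def unit_periodicD(1)[OF up])
      show "\<xi> n = 0 \<longleftrightarrow> \<not> coprime n N" for n using nz[of n] unit_periodicD(2)[OF up, of n] by (auto simp: \<xi>_def)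
    qed (rule N)
    have "prime_mean (\<lambda>n. h 1 * \<xi> n) (h 1 * class_mean N \<xi>)" by (rule prime_mean_cmult[OF prime_mean_dchar])
    moreover have "(\<lambda>n. h 1 * \<xi> n) = h" using False by (auto simp: \<xi>_def)
    moreover have "h 1 * class_mean N \<xi> = class_mean N h"
      using False by (simp add: class_mean_def \<xi>_def flip: sum_divide_distrib)
    ultimately show ?thesis by simp
  qed
qed

text \<open>A function on the units is the sum of its projections to the eigenspaces of translation by \<open>g\<close>,
  because \<open>g\<close> has finite order; iterating over all \<open>g\<close> replaces the decomposition into characters.\<close>

lemma eigen_projection:
  assumes N: "N > 0" and g: "coprime g N" and h: "h \<in> eigen_units N B"
  obtains H where "\<And>j. j < totient N \<Longrightarrow> H j \<in> eigen_units N (insert g B)"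
    "\<And>n. h n = (\<Sum>j<totient N. H j n)"
proof -
  define m where "m = totient N"
  have m: "m > 0" using N by (simp add: m_def)
  define \<omega> where "\<omega> = (\<lambda>i::nat. cis (2 * pi * real i / real m))"
  have \<omega>_pow: "\<omega> i ^ j = \<omega> j ^ i" for i j
    unfolding \<omega>_def Complex.DeMoivre by (simp add: mult_ac)
  have \<omega>_m: "\<omega> i ^ m = 1" for i
    unfolding \<omega>_def Complex.DeMoivre using m cis_multiple_2pi[of "real i"] by simp
  have \<omega>0: "\<omega> 0 = 1" by (simp add: \<omega>_def)
  have \<omega>_ne: "\<omega> i \<noteq> 1" if "0 < i" "i < m" for i
  proof -
    have "inj_on \<omega> {..<m}"
      using Complex.bij_betw_roots_unity[OF m] unfolding \<omega>_def bij_betw_def by blast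
    from inj_onD[OF this, of i 0] show ?thesis using that \<omega>0 by auto
  qed
  have up: "unit_periodic N h" using h by (simp add: eigen_units_def)
  \<comment> \<open>The projection to the eigenvalue \<open>inverse (\<omega> j)\<close> of
    translation by \<open>g\<close>. Averaging over \<open>m = totient N\<close> powers is
    legitimate since \<open>g ^ m\<close> acts trivially by Euler's theorem.\<close>
  define H where "H = (\<lambda>j n. (\<Sum>i<m. \<omega> j ^ i * h (g ^ i * n)) / of_nat m)"
  have root_sum: "(\<Sum>j<m. \<omega> j ^ i) = (if i = 0 then of_nat m else 0)" if "i < m" for i
  proof (cases "i = 0")
    case False
    have "(\<Sum>j<m. \<omega> j ^ i) = (\<Sum>j<m. \<omega> i ^ j)" by (simp add: \<omega>_pow)
    also have "\<dots> = (\<omega> i ^ m - 1) / (\<omega> i - 1)" using \<omega>_ne[of i] that False by (intro geometric_sum) auto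
    finally show ?thesis using False by (simp add: \<omega>_m)
  qed auto
  have "h n = (\<Sum>j<m. H j n)" for n
  proof -
    have "(\<Sum>j<m. H j n) = (\<Sum>i<m. \<Sum>j<m. \<omega> j ^ i * h (g ^ i * n)) / of_nat m"
      unfolding H_def sum_divide_distrib[symmetric] by (subst sum.swap) simp
    also have "(\<Sum>i<m. \<Sum>j<m. \<omega> j ^ i * h (g ^ i * n)) = (\<Sum>i<m. if i = 0 then of_nat m * h n else 0)"
      by (intro sum.cong refl) (auto simp: root_sum simp flip: sum_distrib_right)
    also have "\<dots> = of_nat m * h n" using m by (simp add: sum.delta)
    finally show ?thesis using m by simp
  qed
  moreover have "H j \<in> eigen_units N (insert g B)" for j
    unfolding eigen_units_def
  proof (intro CollectI conjI ballI)
    show "unit_periodic N (H j)"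
      unfolding unit_periodic_def
    proof (intro conjI allI impI)
      fix n
      have "h (g ^ i * (n + N)) = h (g ^ i * n)" for i
        by (rule unit_periodicD(3)[OF up]) (simp add: cong_mod_def algebra_simps)
      thus "H j (n + N) = H j n" by (simp add: H_def)
      assume "\<not> coprime n N"
      hence "h (g ^ i * n) = 0" for i by (intro unit_periodicD(2)[OF up]) simp
      thus "H j n = 0" by (simp add: H_def)
    qed
  next
    fix b assume "b \<in> insert g B"
    then consider "b = g" | "b \<in> B" by blast
    thus "\<exists>c. \<forall>n. H j (b * n) = c * H j n"
    proof cases
      case 1
      have "\<omega> j * H j (g * n) = H j n" for n
      proof -
        let ?F = "\<lambda>i. \<omega> j ^ i * h (g ^ i * n)"
        have "h (g ^ m * n) = h (1 * n)"
          unfolding m_def by (rule unit_periodicD(3)[OF up]) (intro cong_mult euler_theorem g cong_refl)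
        hence F: "?F m = ?F 0" by (simp add: \<omega>_m)
        have "\<omega> j * (\<Sum>i<m. \<omega> j ^ i * h (g ^ i * (g * n))) = (\<Sum>i<m. ?F (Suc i))"
          by (simp add: sum_distrib_left mult_ac)
        also have "\<dots> = (\<Sum>i<m. ?F i)"
          using sum.lessThan_Suc_shift[of ?F m] sum.lessThan_Suc[of ?F m] F by simp
        finally show ?thesis by (simp add: H_def)
      qed
      moreover have "\<omega> j \<noteq> 0" by (simp add: \<omega>_def)
      ultimately have "H j (g * n) = inverse (\<omega> j) * H j n" for n by (metis mult.assoc left_inverse mult_1)
      thus ?thesis using 1 by blast
    next
      case 2
      then obtain c where c: "\<And>n. h (b * n) = c * h n" using h by (auto simp: eigen_units_def)
      \<comment> \<open>Translations commute, so \<open>H j\<close> keeps the eigenvalue of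
        \<open>h\<close> under \<open>b\<close>.\<close>
      have e: "h (g ^ i * (b * n)) = c * h (g ^ i * n)" for i n
        using c[of "g ^ i * n"] by (simp add: mult_ac)
      have "H j (b * n) = c * H j n" for n
        unfolding H_def e by (simp add: sum_distrib_left mult.left_commute)
      thus ?thesis by blast
    qed
  qed
  ultimately show ?thesis using that unfolding m_def by blast
qed

theorem prime_mean_unit_periodic:
  assumes N: "N > 0" and h: "unit_periodic N h"
  shows "prime_mean h (class_mean N h)"
proof -
  \<comment> \<open>The claim is carried down from a full set of units to the empty set; the
    induction step drops one unit from the eigenvector condition by
    \<open>eigen_projection\<close>.\<close>
  have "\<forall>h\<in>eigen_units N {}. prime_mean h (class_mean N h)"
    if "finite A" "A \<subseteq> {g. coprime g N}" "\<forall>h\<in>eigen_units N A. prime_mean h (class_mean N h)" for A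
    using that
  proof (induction A rule: finite_induct)
    case (insert g A)
    have "prime_mean h (class_mean N h)" if h: "h \<in> eigen_units N A" for h
    proof -
      obtain H where H: "\<And>j. j < totient N \<Longrightarrow> H j \<in> eigen_units N (insert g A)"
        "\<And>n. h n = (\<Sum>j<totient N. H j n)"
        using eigen_projection[OF N _ h, of g] insert.prems by blast
      have "prime_mean (\<lambda>n. \<Sum>j<totient N. H j n) (\<Sum>j<totient N. class_mean N (H j))"
        by (rule prime_mean_sum) (use insert.prems H in blast)
      moreover have "h = (\<lambda>n. \<Sum>j<totient N. H j n)" using H(2) by blast
      moreover have "(\<Sum>j<totient N. class_mean N (H j)) = class_mean N h"
        unfolding class_mean_def H(2) by (subst sum.swap) (simp add: sum_divide_distrib)
      ultimately show ?thesis by simp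
    qed
    thus ?case using insert by blast
  qed auto
  from this[of "{g. g < N \<and> coprime g N}"] prime_mean_eigen_all[OF N] h show ?thesis
    by (auto simp: eigen_units_def)
qed

section \<open>The Kronecker symbol as a Dirichlet character\<close>

lemma Legendre_range: "Legendre a p \<in> {-1, 0, 1}"
  by (simp add: Legendre_def)

text \<open>Euler's criterion determines the symbol because -1, 0 and 1 are pairwise incongruent
  modulo a prime above 2.\<close>

lemma Legendre_eqI:
  assumes p: "prime p" "2 < p" and x: "x \<in> {-1, 0, 1}" "[x = a ^ ((p - 1) div 2)] (mod int p)"
  shows "Legendre a (int p) = x"
proof -
  have "[Legendre a (int p) = x] (mod int p)"
    using euler_criterion[OF p, of a] x(2) by (blast intro: cong_trans cong_sym)
  hence "int p dvd Legendre a (int p) - x" by (simp add: cong_iff_dvd_diff)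
  moreover have "\<bar>Legendre a (int p) - x\<bar> < int p"
    using Legendre_range[of a "int p"] x(1) p(2) by auto
  ultimately have "Legendre a (int p) - x = 0" using dvd_imp_le_int[of "Legendre a (int p) - x" "int p"] by linarith
  thus ?thesis by simp
qed

lemma Legendre_mult:
  assumes p: "prime p" "2 < p"
  shows "Legendre (a * b) (int p) = Legendre a (int p) * Legendre b (int p)"
proof (rule Legendre_eqI[OF p])
  show "Legendre a (int p) * Legendre b (int p) \<in> {-1, 0, 1}"
    using Legendre_range[of a "int p"] Legendre_range[of b "int p"] by auto
  show "[Legendre a (int p) * Legendre b (int p) = (a * b) ^ ((p - 1) div 2)] (mod int p)"
    unfolding power_mult_distrib by (intro cong_mult euler_criterion p)
qed

lemma Legendre_cong: "[a = b] (mod m) \<Longrightarrow> Legendre a m = Legendre b m"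
  unfolding Legendre_def QuadRes_def cong_mod_def by simp

lemma Legendre_1: "m > 1 \<Longrightarrow> Legendre 1 m = 1"
  unfolding Legendre_def QuadRes_def
  by (auto simp: cong_iff_dvd_diff intro: exI[of _ 1] dest: zdvd_imp_le)

lemma Legendre_nonzero: "prime m \<Longrightarrow> coprime a m \<Longrightarrow> Legendre a m \<noteq> 0"
  unfolding Legendre_def by (auto simp: cong_0_iff coprime_commute dest: coprime_common_divisor not_prime_unit)

lemma Legendre_unit: "prime m \<Longrightarrow> coprime a m \<Longrightarrow> Legendre a m = 1 \<or> Legendre a m = -1"
  using Legendre_nonzero[of m a] Legendre_range[of a m] by auto

text \<open>Squaring identifies 1 with \<open>r - 1\<close>, so it is not injective on the nonzero
  residues and hence, the set being finite, not surjective.\<close>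

lemma exists_nonresidue:
  assumes r: "prime r" "2 < r"
  obtains t :: nat where "t > 0" "Legendre (int t) (int r) = -1"
proof -
  let ?A = "{1..<r}"
  let ?f = "\<lambda>x::nat. x\<^sup>2 mod r"
  have nd: "\<not> r dvd x" if "x \<in> ?A" for x using that by (auto dest: dvd_imp_le)
  have sub: "?f ` ?A \<subseteq> ?A"
  proof
    fix y assume "y \<in> ?f ` ?A"
    then obtain x where x: "x \<in> ?A" "y = ?f x" by auto
    hence "\<not> r dvd x\<^sup>2" using nd r by (simp add: prime_dvd_power_iff)
    hence "y \<noteq> 0" using x by (simp add: dvd_eq_mod_eq_0)
    thus "y \<in> ?A" using x r by auto
  qed
  have "\<not> inj_on ?f ?A"
  proof
    assume inj: "inj_on ?f ?A"
    have "(r - 1)\<^sup>2 = 1 + r * (r - 2)"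
    proof -
      obtain k where k: "r = k + 3" using r by (metis add.commute le_Suc_ex less_iff_Suc_add numeral_3_eq_3 Suc_leI numeral_2_eq_2)
      show ?thesis unfolding k by (simp add: power2_eq_square algebra_simps)
    qed
    hence "?f (r - 1) = 1 mod r" by (simp only: mod_mult_self2)
    hence "?f (r - 1) = ?f 1" by simp
    hence "r - 1 = 1" by (rule inj_onD[OF inj]) (use r in auto)
    thus False using r by simp
  qed
  hence "?f ` ?A \<noteq> ?A" using eq_card_imp_inj_on[of ?A ?f] by auto
  then obtain t where t: "t \<in> ?A" "t \<notin> ?f ` ?A" using sub by blast
  have "\<not> QuadRes (int r) (int t)"
  proof
    assume "QuadRes (int r) (int t)"
    then obtain y where y: "[y\<^sup>2 = int t] (mod int r)" by (auto simp: QuadRes_def)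
    define x where "x = nat (y mod int r)"
    have xr: "x < r" using r by (simp add: x_def nat_less_iff)
    have xi: "int x = y mod int r" using r by (simp add: x_def)
    have "[int x ^ 2 = int t] (mod int r)"
      unfolding xi using y by (simp add: cong_mod_def power_mod)
    hence "[x\<^sup>2 = t] (mod r)" by (simp flip: of_nat_power add: cong_int_iff)
    hence f: "?f x = t" using t by (simp add: cong_mod_def)
    hence "x \<noteq> 0" using t by (intro notI) auto
    thus False using t f xr by force
  qed
  moreover have "\<not> [int t = 0] (mod int r)" using nd[OF t(1)] by (simp add: cong_0_iff)
  ultimately show ?thesis using that[of t] t by (simp add: Legendre_def)
qed

section \<open>The characters modulo 4 and 8 and the laws for -1, 2 and odd primes\<close>

definition chi4 :: "int \<Rightarrow> int" where
  "chi4 n = (if n mod 4 = 1 then 1 else if n mod 4 = 3 then -1 else 0)"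

text \<open>As \<open>mod\<close> yields nonnegative remainders, negative arguments are covered as
  well: \<open>chi4\<close> is odd and \<open>chi8\<close> is even, which is how signs enter
  reciprocity.\<close>

definition chi8 :: "int \<Rightarrow> int" where
  "chi8 n = (if n mod 8 = 1 \<or> n mod 8 = 7 then 1 else if n mod 8 = 3 \<or> n mod 8 = 5 then -1 else 0)"

lemma chi4_mult: "chi4 (m * n) = chi4 m * chi4 n"
proof -
  have e: "(m * n) mod 4 = ((m mod 4) * (n mod 4)) mod 4" by (simp add: mod_mult_eq)
  have "m mod 4 \<in> {0, 1, 2, 3}" "n mod 4 \<in> {0, 1, 2, 3}" by auto
  thus ?thesis unfolding chi4_def e by (elim insertE emptyE) simp_all
qed

lemma chi8_mult: "chi8 (m * n) = chi8 m * chi8 n"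
proof -
  have e: "(m * n) mod 8 = ((m mod 8) * (n mod 8)) mod 8" by (simp add: mod_mult_eq)
  have "m mod 8 \<in> {0, 1, 2, 3, 4, 5, 6, 7}" "n mod 8 \<in> {0, 1, 2, 3, 4, 5, 6, 7}" by auto
  thus ?thesis unfolding chi8_def e by (elim insertE emptyE) simp_all
qed

lemma chi4_1 [simp]: "chi4 1 = 1" and chi8_1 [simp]: "chi8 1 = 1"
  by (simp_all add: chi4_def chi8_def)

lemma chi4_prod: "chi4 (\<Prod>x\<in>A. f x) = (\<Prod>x\<in>A. chi4 (f x))"
  by (induction A rule: infinite_finite_induct) (simp_all add: chi4_mult)

lemma chi8_prod: "chi8 (\<Prod>x\<in>A. f x) = (\<Prod>x\<in>A. chi8 (f x))"
  by (induction A rule: infinite_finite_induct) (simp_all add: chi8_mult)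

lemma chi4_odd: "odd n \<Longrightarrow> chi4 n = 1 \<or> chi4 n = -1"
  unfolding chi4_def by presburger

lemma chi8_uminus: "chi8 (-n) = chi8 n"
  unfolding chi8_def by presburger

lemma odd_prime_nat: "prime p \<Longrightarrow> 2 < p \<Longrightarrow> odd (p::nat)"
  by (rule prime_odd_nat) auto

lemma Legendre_minus_one:
  assumes p: "prime p" "2 < p"
  shows "Legendre (-1) (int p) = chi4 (int p)"
proof (rule Legendre_eqI[OF p])
  have odd: "odd p" by (rule odd_prime_nat[OF p])
  show "chi4 (int p) \<in> {-1, 0, 1}" by (simp add: chi4_def)
  have "chi4 (int p) = (-1) ^ ((p - 1) div 2)"
  proof (cases "p mod 4 = 1")
    case True
    hence "even ((p - 1) div 2)" by presburger
    moreover have "int p mod 4 = 1" using True by presburger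
    ultimately show ?thesis by (simp add: chi4_def)
  next
    case False
    hence 3: "p mod 4 = 3" using odd by presburger
    hence "odd ((p - 1) div 2)" by presburger
    moreover have "int p mod 4 = 3" using 3 by presburger
    ultimately show ?thesis by (simp add: chi4_def)
  qed
  thus "[chi4 (int p) = (-1) ^ ((p - 1) div 2)] (mod int p)" by simp
qed

text \<open>In Gauss's lemma for 2 the multiples \<open>2 * x\<close> with \<open>x\<close> up to
  \<open>?h = (p - 1) / 2\<close> need no reduction. Those exceeding \<open>?h\<close> number
  \<open>?h - ?h div 2\<close>, whose parity depends on \<open>p\<close> modulo 8.\<close>

lemma Legendre_two:
  assumes p: "prime p" "2 < p"
  shows "Legendre 2 (int p) = chi8 (int p)"
proof -
  have odd: "odd p" by (rule odd_prime_nat[OF p])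
  interpret GAUSS p 2
    by unfold_locales (use p in \<open>auto simp: cong_0_iff dest: zdvd_imp_le\<close>)
  let ?h = "(int p - 1) div 2"
  have C: "C = (\<lambda>x. 2 * x) ` {0<..?h}"
    unfolding C_def B_def A_def image_image
  proof (rule image_cong)
    fix x assume "x \<in> {0<..?h}"
    hence "0 < 2 * x" "2 * x < int p" by auto
    thus "x * 2 mod int p = 2 * x" by simp
  qed auto
  have "E = (\<lambda>x. 2 * x) ` {?h div 2<..?h}"
    unfolding E_def C using p by auto
  hence "card E = nat (?h - ?h div 2)"
    by (simp add: card_image inj_on_def)
  hence L: "Legendre 2 (int p) = (-1) ^ nat (?h - ?h div 2)" using gauss_lemma by simp
  have nn: "?h - ?h div 2 \<ge> 0" using p by presburger
  have "int p mod 8 \<in> {1, 3, 5, 7}" using odd by (simp, presburger)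
  moreover have "even (?h - ?h div 2)" if "int p mod 8 = 1 \<or> int p mod 8 = 7" using that by presburger
  moreover have "odd (?h - ?h div 2)" if "int p mod 8 = 3 \<or> int p mod 8 = 5" using that by presburger
  ultimately show ?thesis unfolding L using nn by (auto simp: chi8_def even_nat_iff)
qed

text \<open>The usual sign is written through \<open>chi4\<close> because this form is
  multiplicative in \<open>q\<close>, so it passes to products of primes and to the factor
  -1.\<close>

lemma Legendre_swap:
  assumes p: "prime p" "2 < p" and q: "prime q" "2 < q" and ne: "p \<noteq> q"
  shows "Legendre (int q) (int p) = Legendre (int p) (int q) * (if chi4 (int p) = -1 then chi4 (int q) else 1)"
proof -
  have odd: "odd p" "odd q" using odd_prime_nat p q by auto
  have "coprime (int p) (int q)" using primes_coprime[of p q] p q ne by simp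
  hence u: "Legendre (int p) (int q) = 1 \<or> Legendre (int p) (int q) = -1" using q by (intro Legendre_unit) auto
  have pq: "p mod 4 = 1 \<or> p mod 4 = 3" "q mod 4 = 1 \<or> q mod 4 = 3" using odd by presburger+
  have e: "even ((p - 1) div 2) \<longleftrightarrow> p mod 4 = 1" "even ((q - 1) div 2) \<longleftrightarrow> q mod 4 = 1" using odd by presburger+
  have c: "chi4 (int p) = (if p mod 4 = 1 then 1 else -1)" "chi4 (int q) = (if q mod 4 = 1 then 1 else -1)"
    using pq unfolding chi4_def by presburger+
  have "Legendre p q * Legendre q p = (-1::int) ^ ((p - 1) div 2 * ((q - 1) div 2))"
    by (rule Quadratic_Reciprocity) (use p q ne in auto)
  hence "Legendre p q * Legendre q p = (if chi4 (int p) = -1 then chi4 (int q) else 1)"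
    unfolding c using e by (simp add: minus_one_power_iff)
  thus ?thesis using u by auto
qed

section \<open>The Kronecker symbol and reciprocity for squarefree upper arguments\<close>

lemma kronecker_prod_mset:
  "kronecker a n = (\<Prod>q\<in>#prime_factorization n. kronecker_prime a q)"
  unfolding kronecker_def image_prod_mset_multiplicity
  by (intro prod.cong refl) (auto simp: count_prime_factorization in_prime_factors_iff)

lemma kronecker_1: "kronecker a 1 = 1"
  by (simp add: kronecker_prod_mset)

lemma kronecker_mult: "m > 0 \<Longrightarrow> n > 0 \<Longrightarrow> kronecker a (m * n) = kronecker a m * kronecker a n"
  by (simp add: kronecker_prod_mset prime_factorization_mult)

lemma kronecker_of_prime: "prime q \<Longrightarrow> kronecker a q = kronecker_prime a q"
  by (simp add: kronecker_prod_mset prime_factorization_prime)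

lemma kronecker_odd_prime: "prime p \<Longrightarrow> p \<noteq> 2 \<Longrightarrow> kronecker a p = Legendre a (int p)"
  by (simp add: kronecker_of_prime kronecker_prime_def)

text \<open>Multiplicativity of \<open>g\<close> is asked for only on divisors of \<open>n\<close>,
  since the sign in \<open>kronecker_reciprocity\<close> need not be multiplicative across even
  numbers.\<close>

lemma kronecker_eqI:
  assumes "n > 0" "g 1 = 1" "\<And>m k. m * k dvd n \<Longrightarrow> g (m * k) = g m * g k"
    and "\<And>q. prime q \<Longrightarrow> q dvd n \<Longrightarrow> kronecker_prime a q = g q"
  shows "kronecker a n = g n"
  using assms(1,3,4)
proof (induction n rule: less_induct)
  case (less n)
  show ?case
  proof (cases "n = 1")
    case True
    thus ?thesis using assms(2) by (simp add: kronecker_prod_mset)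
  next
    case False
    then obtain p where p: "prime p" "p dvd n" using prime_factor_nat by blast
    then obtain m where m: "n = p * m" by blast
    have m0: "m > 0" "p > 0" using m less.prems(1) by (auto intro!: Nat.gr0I)
    have "m < n" using m m0 prime_gt_1_nat[OF p(1)] by simp
    have "kronecker a m = g m"
    proof (rule less.IH[OF \<open>m < n\<close> m0(1)])
      show "g (j * k) = g j * g k" if "j * k dvd m" for j k
        using that by (intro less.prems(2)) (simp add: m)
      show "kronecker_prime a q = g q" if "prime q" "q dvd m" for q
        using that by (intro less.prems(3)) (simp_all add: m)
    qed
    moreover have "kronecker a p = g p" using p less.prems(3) by (simp add: kronecker_of_prime)
    moreover have "g (p * m) = g p * g m" by (rule less.prems(2)) (simp add: m)
    ultimately show ?thesis unfolding m using m0 by (simp add: kronecker_mult)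
  qed
qed

lemma squarefree_int_decomp:
  fixes a :: int assumes "squarefree a" "a \<noteq> 0"
  shows "a = sgn a * \<Prod>(prime_factors a)"
proof -
  have "(\<Prod>p\<in>prime_factors a. p ^ multiplicity p a) = \<bar>a\<bar>" using assms prod_prime_factors[of a] by simp
  moreover have "(\<Prod>p\<in>prime_factors a. p ^ multiplicity p a) = \<Prod>(prime_factors a)"
    by (rule prod.cong) (use assms squarefree_factorial_semiring'[of a] in auto)
  ultimately show ?thesis by (simp add: sgn_mult_abs)
qed

text \<open>For odd squarefree \<open>a\<close> this is the Jacobi symbol of \<open>n\<close> over
  the absolute value of \<open>a\<close>: the first argument is the lower one, as it becomes after
  reciprocity. The product over the set of primes is right because \<open>a\<close> is
  squarefree.\<close>

definition jacobi :: "int \<Rightarrow> nat \<Rightarrow> int" where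
  "jacobi a n = (\<Prod>r\<in>prime_factors a. Legendre (int n) r)"

lemma odd_prime_factor:
  fixes a :: int assumes "odd a" "r \<in> prime_factors a"
  shows "prime (nat r)" "2 < nat r" "int (nat r) = r"
proof -
  have r: "prime r" "r dvd a" using assms by (auto simp: in_prime_factors_iff)
  show "prime (nat r)" "int (nat r) = r" using r(1) by (auto simp: prime_ge_0_int)
  have "r \<noteq> 2" using assms r by auto
  thus "2 < nat r" using prime_ge_2_int[OF r(1)] by simp
qed

lemma jacobi_mult:
  assumes "odd a" shows "jacobi a (m * n) = jacobi a m * jacobi a n"
proof -
  have "Legendre (int (m * n)) r = Legendre (int m) r * Legendre (int n) r" if "r \<in> prime_factors a" for r
    using Legendre_mult[OF odd_prime_factor(1,2)[OF assms that]] odd_prime_factor(3)[OF assms that] by simp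
  thus ?thesis by (simp add: jacobi_def prod.distrib)
qed

lemma jacobi_cong:
  assumes "\<And>r. r \<in> prime_factors a \<Longrightarrow> [int m = int n] (mod r)"
  shows "jacobi a m = jacobi a n"
  unfolding jacobi_def using assms by (intro prod.cong refl Legendre_cong)

lemma jacobi_1: "jacobi a 1 = 1"
  unfolding jacobi_def by (rule prod.neutral) (auto simp: in_prime_factors_iff prime_gt_1_int Legendre_1)

lemma Legendre_prod:
  assumes p: "prime p" "2 < p"
  shows "Legendre (\<Prod>x\<in>A. f x) (int p) = (\<Prod>x\<in>A. Legendre (f x) (int p))"
  using p by (induction A rule: infinite_finite_induct) (simp_all add: Legendre_mult Legendre_1)

text \<open>The law for -1 has the same shape as the sign in \<open>Legendre_swap\<close>, because
  \<open>chi4 (-1) = -1\<close>. So the signs from \<open>sgn a\<close> and from the prime factors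
  combine to one sign for \<open>a\<close>.\<close>

lemma Legendre_reciprocity:
  fixes a :: int
  assumes a: "squarefree a" "odd a" and q: "prime q" "2 < q" "\<not> int q dvd a"
  shows "Legendre a (int q) = (if chi4 (int q) = -1 then chi4 a else 1) * jacobi a q"
proof -
  have a0: "a \<noteq> 0" using a by auto
  let ?P = "prime_factors a" and ?t = "\<lambda>x. if chi4 (int q) = -1 then chi4 x else 1"
  have tp: "?t (x * y) = ?t x * ?t y" for x y by (simp add: chi4_mult)
  have sg: "Legendre (sgn a) (int q) = ?t (sgn a)"
  proof (cases "a > 0")
    case True
    thus ?thesis using q by (simp add: Legendre_1)
  next
    case False
    hence "sgn a = -1" using a0 by simp
    moreover have "chi4 (-1) = -1" by (simp add: chi4_def)
    moreover have "chi4 (int q) = 1 \<or> chi4 (int q) = -1" using odd_prime_nat[OF q(1,2)] by (intro chi4_odd) simp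
    ultimately show ?thesis using Legendre_minus_one[OF q(1,2)] by auto
  qed
  have "Legendre (\<Prod>?P) (int q) = (\<Prod>r\<in>?P. Legendre r (int q))"
    using Legendre_prod[OF q(1,2), of "\<lambda>x. x" ?P] by simp
  also have "\<dots> = (\<Prod>r\<in>?P. Legendre (int q) r * ?t r)"
  proof (rule prod.cong)
    fix r assume r: "r \<in> ?P"
    have "nat r \<noteq> q" using r q odd_prime_factor(3)[OF a(2) r] by (auto simp: in_prime_factors_iff)
    thus "Legendre r (int q) = Legendre (int q) r * ?t r"
      using Legendre_swap[OF q(1,2) odd_prime_factor(1,2)[OF a(2) r]] odd_prime_factor(3)[OF a(2) r] by auto
  qed auto
  also have "\<dots> = jacobi a q * ?t (\<Prod>?P)"
    using chi4_prod[of "\<lambda>x. x" ?P] by (simp add: jacobi_def prod.distrib)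
  finally have 1: "Legendre (\<Prod>?P) (int q) = jacobi a q * ?t (\<Prod>?P)" .
  have "Legendre a (int q) = Legendre (sgn a) (int q) * Legendre (\<Prod>?P) (int q)"
    by (subst squarefree_int_decomp[OF a(1) a0]) (rule Legendre_mult[OF q(1,2)])
  also have "\<dots> = ?t (sgn a * \<Prod>?P) * jacobi a q" unfolding sg 1 tp by simp
  also have "sgn a * \<Prod>?P = a" by (rule squarefree_int_decomp[OF a(1) a0, symmetric])
  finally show ?thesis .
qed

text \<open>The right side visibly depends only on \<open>n\<close> modulo 4 and modulo the primes
  of \<open>a\<close>. Its sign is multiplicative on odd numbers, and it is identically 1 if
  \<open>chi4 a = 1\<close>; hence the hypothesis \<open>par\<close>.\<close>

lemma kronecker_reciprocity:
  fixes a :: int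
  assumes a: "squarefree a" "odd a" and n: "n > 0" "coprime (int n) a" and par: "odd n \<or> chi4 a = 1"
  shows "kronecker a n = (if chi4 (int n) = -1 then chi4 a else 1) * jacobi a n"
proof (rule kronecker_eqI[where g = "\<lambda>n. (if chi4 (int n) = -1 then chi4 a else 1) * jacobi a n"])
  have a0: "a \<noteq> 0" using a by auto
  have ca: "chi4 a = 1 \<or> chi4 a = -1" by (rule chi4_odd[OF a(2)])
  show "(if chi4 (int 1) = -1 then chi4 a else 1) * jacobi a 1 = 1" using jacobi_1 by simp
  show "(if chi4 (int (m * k)) = -1 then chi4 a else 1) * jacobi a (m * k) =
     (if chi4 (int m) = -1 then chi4 a else 1) * jacobi a m * ((if chi4 (int k) = -1 then chi4 a else 1) * jacobi a k)"
    if mk: "m * k dvd n" for m k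
  proof (cases "chi4 a = 1")
    case True
    thus ?thesis by (simp add: jacobi_mult[OF a(2)])
  next
    case False
    hence "odd n" using par by simp
    hence "odd (m * k)" using mk dvd_trans by blast
    hence "odd m" "odd k" by auto
    hence "chi4 (int m) = 1 \<or> chi4 (int m) = -1" "chi4 (int k) = 1 \<or> chi4 (int k) = -1"
      by (auto intro!: chi4_odd)
    thus ?thesis using False ca by (auto simp: jacobi_mult[OF a(2)] chi4_mult)
  qed
  fix q assume q: "prime q" "q dvd n"
  have nd: "\<not> int q dvd a"
  proof
    assume "int q dvd a"
    moreover have "int q dvd int n" using q by simp
    ultimately have "is_unit (int q)" using n(2) coprime_common_divisor by blast
    thus False using q(1) by simp
  qed
  show "kronecker_prime a q = (if chi4 (int q) = -1 then chi4 a else 1) * jacobi a q"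
  proof (cases "q = 2")
    case False
    hence "2 < q" using prime_ge_2_nat[OF q(1)] by simp
    thus ?thesis using Legendre_reciprocity[OF a q(1) _ nd] False by (simp add: kronecker_prime_def)
  next
    case True
    \<comment> \<open>At 2 the sign is 1, and the claim becomes
      \<open>kronecker_prime a 2 = chi8 a\<close>, obtained by multiplying the law for 2 over the
      prime factors of \<open>a\<close>.\<close>
    have c: "chi4 (int q) = 0" using True by (simp add: chi4_def)
    have "jacobi a q = (\<Prod>r\<in>prime_factors a. chi8 r)"
      unfolding jacobi_def
    proof (rule prod.cong)
      fix r assume r: "r \<in> prime_factors a"
      show "Legendre (int q) r = chi8 r"
        using Legendre_two[OF odd_prime_factor(1,2)[OF a(2) r]] odd_prime_factor(3)[OF a(2) r] True by simp
    qed auto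
    also have "\<dots> = chi8 (\<Prod>(prime_factors a))" by (simp add: chi8_prod)
    also have "\<dots> = chi8 a"
    proof -
      have "sgn a = 1 \<or> sgn a = -1" using a0 by (auto simp: sgn_if)
      thus ?thesis using squarefree_int_decomp[OF a(1) a0] chi8_uminus by (metis mult_1 mult_minus1)
    qed
    also have "\<dots> = kronecker_prime a q"
    proof -
      have "odd (a mod 8)" using a(2) by presburger
      hence "a mod 8 \<in> {1, 3, 5, 7}" by (simp, presburger)
      thus ?thesis using True a(2) by (auto simp: kronecker_prime_def chi8_def)
    qed
    finally show ?thesis using c by simp
  qed
qed (rule n)

lemma kronecker_mult_left:
  assumes n: "n > 0" "odd n"
  shows "kronecker (a * b) n = kronecker a n * kronecker b n"
proof (rule kronecker_eqI[where g = "\<lambda>n. kronecker a n * kronecker b n"])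
  show "kronecker a (m * k) * kronecker b (m * k) = kronecker a m * kronecker b m * (kronecker a k * kronecker b k)"
    if "m * k dvd n" for m k
  proof -
    have "m > 0" "k > 0" using that n by (auto intro!: Nat.gr0I)
    thus ?thesis by (simp add: kronecker_mult)
  qed
  show "kronecker_prime (a * b) q = kronecker a q * kronecker b q" if "prime q" "q dvd n" for q
  proof -
    have "q \<noteq> 2" using that n by auto
    moreover from this have "2 < q" using prime_ge_2_nat[OF that(1)] by simp
    ultimately show ?thesis using that Legendre_mult[OF that(1)] by (simp add: kronecker_of_prime kronecker_prime_def)
  qed
qed (use n in \<open>simp_all add: kronecker_1[unfolded One_nat_def]\<close>)

lemma kronecker_two:
  assumes n: "n > 0" "odd n"
  shows "kronecker 2 n = chi8 (int n)"
proof (rule kronecker_eqI[where g = "\<lambda>n. chi8 (int n)"])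
  show "kronecker_prime 2 q = chi8 (int q)" if "prime q" "q dvd n" for q
  proof -
    have "q \<noteq> 2" using that n by auto
    moreover from this have "2 < q" using prime_ge_2_nat[OF that(1)] by simp
    ultimately show ?thesis using that Legendre_two[OF that(1)] by (simp add: kronecker_prime_def)
  qed
qed (use n in \<open>simp_all add: chi8_mult\<close>)

text \<open>\<open>admissible a d\<close> says that the conductor of the quadratic character \<open>(a/\<cdot>)\<close>, for squarefree \<open>a\<close>,
  divides \<open>d\<close>.\<close>

definition admissible :: "int \<Rightarrow> nat \<Rightarrow> bool" where
  "admissible a d \<longleftrightarrow> a dvd int d \<and> (a mod 4 = 3 \<longrightarrow> 4 dvd d) \<and> (even a \<longrightarrow> 8 dvd d)"

lemma squarefree_even_half:
  fixes a :: int assumes "squarefree a" "even a"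
  obtains b where "a = 2 * b" "squarefree b" "odd b"
proof -
  from assms obtain b where b: "a = 2 * b" by blast
  have "odd b"
  proof
    assume "even b"
    then obtain c where "b = 2 * c" by blast
    hence "2 ^ 2 dvd a" using b by simp
    from squarefreeD[OF assms(1) this] show False by simp
  qed
  moreover have "squarefree b" using assms(1) unfolding b by (rule squarefree_multD)
  ultimately show ?thesis using that b by blast
qed

lemma chi4_cong: "m mod 4 = n mod 4 \<Longrightarrow> chi4 m = chi4 n"
  and chi8_cong: "m mod 8 = n mod 8 \<Longrightarrow> chi8 m = chi8 n"
  by (simp_all add: chi4_def chi8_def)

text \<open>For \<open>a\<close> congruent to 1 modulo 4 the symbol equals \<open>jacobi a\<close>,
  also at even arguments. For 3 modulo 4 the sign needs \<open>4 dvd d\<close>, which makes the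
  arguments odd. For even \<open>a\<close> the factor 2 contributes \<open>chi8\<close>, which needs
  \<open>8 dvd d\<close>.\<close>

lemma kronecker_periodic:
  fixes a :: int
  assumes a: "squarefree a" and adm: "admissible a d" and mn: "[m = n] (mod d)" "m > 0" "n > 0" "coprime m d"
  shows "kronecker a m = kronecker a n"
proof -
  have cn: "coprime n d" using mn cong_imp_coprime by blast
  have imn: "[int m = int n] (mod int d)" using mn by (simp add: cong_int_iff)
  have dv: "a dvd int d" using adm by (simp add: admissible_def)
  have ca: "coprime (int k) b" if "coprime k d" "b dvd a" for k b
    using that dv by (metis coprime_divisors coprime_int_iff dvd_refl dvd_trans)
  have jc: "jacobi b m = jacobi b n" if "b dvd a" for b
  proof (rule jacobi_cong)
    fix r assume "r \<in> prime_factors b"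
    hence "r dvd int d" using that dv by (auto simp: in_prime_factors_iff dest: dvd_trans)
    thus "[int m = int n] (mod r)" using imn cong_dvd_modulus by blast
  qed
  have m4: "chi4 (int m) = chi4 (int n)" if "4 dvd d"
  proof -
    have "int 4 dvd int d" using that int_dvd_int_iff by blast
    hence "[int m = int n] (mod 4)" using imn cong_dvd_modulus by simp
    thus ?thesis by (intro chi4_cong) (simp add: cong_mod_def)
  qed
  have oddk: "odd k" if "even d" "coprime k d" for k
    using that by (meson coprime_common_divisor dvd_refl odd_one)
  show ?thesis
  proof (cases "even a")
    case False
    show ?thesis
    proof (cases "a mod 4 = 3")
      case True
      hence d4: "4 dvd d" using adm by (simp add: admissible_def)
      hence "even d" using dvd_trans[of 2 4 d] by simp
      thus ?thesis
        using kronecker_reciprocity[OF a False mn(2) ca] kronecker_reciprocity[OF a False mn(3) ca]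
          oddk[of m] oddk[of n] mn(4) cn m4[OF d4] jc[of a] by simp
    next
      case False2: False
      hence "chi4 a = 1" using False unfolding chi4_def by presburger
      thus ?thesis
        using kronecker_reciprocity[OF a False mn(2) ca] kronecker_reciprocity[OF a False mn(3) ca]
          mn(4) cn jc[of a] by simp
    qed
  next
    case True
    hence d8: "8 dvd d" using adm by (simp add: admissible_def)
    hence d4: "4 dvd d" "even d" using dvd_trans[of 4 8 d] dvd_trans[of 2 8 d] by simp_all
    have o: "odd m" "odd n" using oddk d4 mn(4) cn by auto
    obtain b where b: "a = 2 * b" "squarefree b" "odd b" using squarefree_even_half[OF a True] by blast
    have "int 8 dvd int d" using d8 int_dvd_int_iff by blast
    hence "[int m = int n] (mod 8)" using imn cong_dvd_modulus by simp
    hence m8: "chi8 (int m) = chi8 (int n)" by (intro chi8_cong) (simp add: cong_mod_def)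
    have "kronecker b m = kronecker b n"
      using kronecker_reciprocity[OF b(2,3) mn(2) ca] kronecker_reciprocity[OF b(2,3) mn(3) ca]
        o mn(4) cn m4[OF d4(1)] jc[of b] b(1) by simp
    thus ?thesis unfolding b(1) using kronecker_mult_left[of m 2 b] kronecker_mult_left[of n 2 b] o mn
      by (simp add: kronecker_two m8)
  qed
qed

section \<open>Symbols that are not periodic modulo d\<close>

lemma kronecker_via_odd_part:
  fixes a b :: int
  assumes b: "squarefree b" "odd b" "a = b \<or> a = 2 * b" and v: "v > 0" "odd v" "coprime (int v) b"
  shows "kronecker a v = (if a = b then 1 else chi8 (int v)) * (if chi4 (int v) = -1 then chi4 b else 1) * jacobi b v"
proof -
  have k: "kronecker b v = (if chi4 (int v) = -1 then chi4 b else 1) * jacobi b v"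
    using b v by (intro kronecker_reciprocity) auto
  show ?thesis
  proof (cases "a = b")
    case False
    hence "a = 2 * b" using b by auto
    thus ?thesis using kronecker_mult_left[OF v(1,2), of 2 b] kronecker_two[OF v(1,2)] k False by simp
  qed (use k in simp)
qed

lemma odd_part_exists:
  fixes a :: int assumes "squarefree a"
  obtains b where "squarefree b" "odd b" "a = b \<and> odd a \<or> a = 2 * b \<and> even a"
proof (cases "even a")
  case True
  from squarefree_even_half[OF assms this] obtain b where "a = 2 * b" "squarefree b" "odd b" by blast
  thus ?thesis using that True by blast
qed (use that assms in blast)

lemma coprime_via_primes:
  fixes v b :: int
  assumes "b \<noteq> 0" "\<And>r. r \<in> prime_factors b \<Longrightarrow> \<not> r dvd v"
  shows "coprime v b"
proof (rule ccontr)
  assume "\<not> coprime v b"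
  then obtain c where c: "c dvd v" "c dvd b" "\<not> is_unit c" by (rule not_coprimeE)
  moreover have "c \<noteq> 0" using c assms(1) by auto
  ultimately obtain r where "prime r" "r dvd c" using prime_divisor_exists[of c] by blast
  hence "r \<in> prime_factors b" "r dvd v" using c assms(1) by (auto simp: in_prime_factors_iff dest: dvd_trans)
  thus False using assms(2) by blast
qed

text \<open>If an odd prime \<open>r\<close> divides \<open>a\<close> but not \<open>d\<close>,
  \<open>v\<close> is a nonresidue modulo \<open>r\<close> and 1 modulo everything else relevant.
  Otherwise the obstruction sits at 2, and \<open>v\<close> is 1 modulo the odd part of
  \<open>d\<close> with a suitable residue modulo 8.\<close>

lemma nonadmissible_witness:
  fixes a :: int
  assumes a: "squarefree a" "a \<noteq> 0" and d: "d > 0" and nadm: "\<not> admissible a d"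
  obtains v where "v > 0" "[v = 1] (mod d)" "coprime v (8 * nat \<bar>a\<bar> * d)" "kronecker a v = -1"
proof -
  obtain b where b: "squarefree b" "odd b" "a = b \<and> odd a \<or> a = 2 * b \<and> even a"
    using odd_part_exists[OF a(1)] by blast
  have b0: "b \<noteq> 0" using b by auto
  have fin: "\<exists>v. v > 0 \<and> [v = 1] (mod d) \<and> coprime v (8 * nat \<bar>a\<bar> * d) \<and> kronecker a v = -1"
    if v: "v > 0" "odd v" "[v = 1] (mod d)" and L: "\<And>r. r \<in> prime_factors b \<Longrightarrow> Legendre (int v) r \<noteq> 0"
      and val: "(if a = b then 1 else chi8 (int v)) * (if chi4 (int v) = -1 then chi4 b else 1) * jacobi b v = -1" for v
  proof -
    have cb: "coprime (int v) b"
    proof (rule coprime_via_primes[OF b0])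
      fix r assume r: "r \<in> prime_factors b"
      show "\<not> r dvd int v" using L[OF r] by (auto simp: Legendre_def cong_0_iff)
    qed
    have c2: "coprime (int v) 2" using v(2) by simp
    have "coprime (int v) a" using b(3) cb c2 by auto
    hence "coprime (int v) \<bar>a\<bar>" by simp
    hence "coprime (int v) (int (nat \<bar>a\<bar>))" by simp
    hence ca: "coprime v (nat \<bar>a\<bar>)" by (simp only: coprime_int_iff)
    have "coprime v (2 ^ 3)" using v(2) by (simp only: coprime_power_right_iff) simp
    hence c8: "coprime v 8" by simp
    have "coprime v d" using cong_imp_coprime[OF cong_sym[OF v(3)]] by simp
    hence "coprime v (8 * nat \<bar>a\<bar> * d)" using ca c8 by simp
    moreover have "kronecker a v = -1"
      using kronecker_via_odd_part[OF b(1,2) _ v(1,2) cb, of a] b(3) val by auto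
    ultimately show ?thesis using v by blast
  qed
  have "\<exists>v. v > 0 \<and> [v = 1] (mod d) \<and> coprime v (8 * nat \<bar>a\<bar> * d) \<and> kronecker a v = -1"
  proof (cases "\<exists>r\<in>prime_factors b. \<not> r dvd int d")
    case True
    then obtain r where r: "r \<in> prime_factors b" "\<not> r dvd int d" by blast
    note rn = odd_prime_factor[OF b(2) r(1)]
    obtain c where c: "b = r * c" using r(1) by (auto simp: in_prime_factors_iff)
    have rc: "\<not> r dvd c"
    proof
      assume "r dvd c"
      hence "r ^ 2 dvd b" unfolding c power2_eq_square by (intro mult_dvd_mono) auto
      hence "is_unit r" using squarefreeD[OF b(1)] by blast
      thus False using r(1) by (auto simp: in_prime_factors_iff)
    qed
    \<comment> \<open>Being 1 modulo \<open>M\<close> silences \<open>chi4\<close>,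
      \<open>chi8\<close> and all prime factors of \<open>b\<close> other than \<open>r\<close>, and
      it implies being 1 modulo \<open>d\<close>.\<close>
    define M where "M = 8 * d * nat \<bar>c\<bar>"
    have c0: "c \<noteq> 0" using b0 c by auto
    have M0: "M > 0" using d c0 by (simp add: M_def)
    have "\<not> nat r dvd M"
    proof
      assume "nat r dvd M"
      hence "nat r dvd 2 ^ 3 \<or> nat r dvd d \<or> nat r dvd nat \<bar>c\<bar>"
        using rn(1) by (auto simp: M_def prime_dvd_mult_iff)
      thus False
      proof (elim disjE)
        assume "nat r dvd 2 ^ 3"
        hence "nat r dvd 2" using rn(1) prime_dvd_power_nat by blast
        thus False using rn(2) by (auto dest: dvd_imp_le)
      next
        assume "nat r dvd d"
        hence "int (nat r) dvd int d" by (simp only: int_dvd_int_iff)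
        thus False using r rn by simp
      next
        assume "nat r dvd nat \<bar>c\<bar>"
        hence "int (nat r) dvd int (nat \<bar>c\<bar>)" by (simp only: int_dvd_int_iff)
        thus False using rc rn by simp
      qed
    qed
    hence cop: "coprime M (nat r)" using prime_imp_coprime[OF rn(1)] by (simp add: coprime_commute)
    obtain t where t: "t > 0" "Legendre (int t) (int (nat r)) = -1" using exists_nonresidue[OF rn(1,2)] by blast
    obtain v0 where v0: "[v0 = 1] (mod M)" "[v0 = t] (mod nat r)"
      using binary_chinese_remainder_nat[OF cop] by blast
    define v where "v = v0 + M * nat r"
    have vM: "[v = 1] (mod M)" and vr: "[v = t] (mod nat r)"
      using v0 by (simp_all add: v_def cong_mod_def)
    have v8: "[v = 1] (mod 8)" by (rule cong_dvd_modulus_nat[OF vM]) (simp add: M_def)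
    have vd: "[v = 1] (mod d)" by (rule cong_dvd_modulus_nat[OF vM]) (simp add: M_def)
    have v8': "v mod 8 = 1" using v8 by (simp add: cong_mod_def)
    have odd: "odd v" using v8' by presburger
    have c4: "chi4 (int v) = 1"
    proof -
      have "int v mod 4 = 1" using v8' by presburger
      thus ?thesis by (simp add: chi4_def)
    qed
    have c8: "chi8 (int v) = 1"
    proof -
      have "int v mod 8 = 1" using v8' by presburger
      thus ?thesis by (simp add: chi8_def)
    qed
    have "[int v = int t] (mod int (nat r))" using vr by (simp only: cong_int_iff)
    hence Lr: "Legendre (int v) r = -1" using t Legendre_cong rn(3) by metis
    have Lo: "Legendre (int v) r' = 1" if r': "r' \<in> prime_factors b" "r' \<noteq> r" for r'
    proof -
      have p: "prime r'" "r' dvd r * c" using r' c by (auto simp: in_prime_factors_iff)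
      have "\<not> r' dvd r" using p(1) r'(2) r(1) primes_dvd_imp_eq[of r' r] by (auto simp: in_prime_factors_iff)
      hence "r' dvd c" using p by (simp add: prime_dvd_mult_iff)
      hence "r' dvd int (nat \<bar>c\<bar>)" by simp
      hence "r' dvd int M" unfolding M_def of_nat_mult by (rule dvd_mult)
      moreover have "[int v = int 1] (mod int M)" using vM by (simp only: cong_int_iff)
      ultimately have "[int v = 1] (mod r')" using cong_dvd_modulus by force
      thus ?thesis using Legendre_cong Legendre_1 prime_gt_1_int[OF p(1)] by metis
    qed
    have "jacobi b v = Legendre (int v) r * (\<Prod>r'\<in>prime_factors b - {r}. Legendre (int v) r')"
      unfolding jacobi_def by (rule prod.remove[OF _ r(1)]) auto
    also have "(\<Prod>r'\<in>prime_factors b - {r}. Legendre (int v) r') = 1" by (rule prod.neutral) (use Lo in auto)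
    finally have "jacobi b v = -1" using Lr by simp
    hence val: "(if a = b then 1 else chi8 (int v)) * (if chi4 (int v) = -1 then chi4 b else 1) * jacobi b v = -1"
      using c4 c8 by simp
    have vpos: "v > 0" using odd by (cases v) auto
    have "Legendre (int v) r' \<noteq> 0" if "r' \<in> prime_factors b" for r'
      using Lo[OF that] Lr by (cases "r' = r") auto
    thus ?thesis by (rule fin[OF vpos odd vd _ val])
  next
    case False
    hence rd: "r dvd int d" if "r \<in> prime_factors b" for r using that by blast
    have bd: "b dvd int d"
    proof (rule multiplicity_le_imp_dvd[OF b0])
      fix p :: int assume p: "prime p"
      show "multiplicity p b \<le> multiplicity p (int d)"
      proof (cases "p dvd b")
        case True
        hence "p \<in> prime_factors b" using p b0 by (simp add: in_prime_factors_iff)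
        hence "p dvd int d" by (rule rd)
        hence "multiplicity p (int d) \<ge> 1"
          using p d prime_multiplicity_gt_zero_iff[of p "int d"] prime_imp_prime_elem[OF p] by auto
        moreover have "multiplicity p b \<le> 1" using b(1) b0 p by (simp add: squarefree_factorial_semiring'')
        ultimately show ?thesis by simp
      qed (simp add: not_dvd_imp_multiplicity_0)
    qed
    define k where "k = multiplicity 2 d"
    obtain d' where d': "d = 2 ^ k * d'" "odd d'"
      using multiplicity_decompose'[of d 2] d unfolding k_def by auto
    have d'0: "d' > 0" using d' by (auto intro!: Nat.gr0I)
    have cop: "coprime 8 d'"
    proof -
      have "coprime (2 ^ 3) d'" using d'(2) by (simp only: coprime_power_left_iff) simp
      thus ?thesis by simp
    qed
    \<comment> \<open>For odd \<open>a\<close>, which is then 3 modulo 4, the residue 3 has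
      \<open>chi4\<close> equal to -1 and is 1 modulo 2, enough as \<open>4 dvd d\<close> fails. For
      even \<open>a\<close>, 5 has \<open>chi4\<close> equal to 1, \<open>chi8\<close> equal to -1
      and is 1 modulo 4, enough as \<open>8 dvd d\<close> fails.\<close>
    define c :: nat where "c = (if odd a then 3 else 5)"
    obtain v0 where v0: "[v0 = c] (mod 8)" "[v0 = 1] (mod d')"
      using binary_chinese_remainder_nat[OF cop] by blast
    define v where "v = v0 + 8 * d'"
    have v8: "[v = c] (mod 8)" and v1: "[v = 1] (mod d')"
      using v0 by (simp_all add: v_def cong_mod_def)
    have v8': "v mod 8 = c" using v8 by (auto simp: cong_mod_def c_def)
    have odd: "odd v" using v8' by (cases "odd a") (auto simp: c_def, presburger+)
    have vpos: "v > 0" using d'0 by (simp add: v_def)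
    have Lr: "Legendre (int v) r = 1" if r: "r \<in> prime_factors b" for r
    proof -
      have "odd r" using b(2) r dvd_trans[of 2 r b] by (auto simp: in_prime_factors_iff)
      hence "coprime r 2" by simp
      hence "coprime r (2 ^ k)" by simp
      moreover have "r dvd 2 ^ k * int d'" using rd[OF r] by (simp add: d'(1))
      ultimately have "r dvd int d'" by (simp add: coprime_dvd_mult_right_iff)
      moreover have "[int v = int 1] (mod int d')" using v1 by (simp only: cong_int_iff)
      ultimately have "[int v = 1] (mod r)" using cong_dvd_modulus by force
      thus ?thesis using Legendre_cong Legendre_1 prime_gt_1_int[of r] r in_prime_factors_iff[of r b] by metis
    qed
    have jacobi: "jacobi b v = 1" unfolding jacobi_def by (rule prod.neutral) (use Lr in auto)
    show ?thesis
    proof (cases "odd a")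
      case True
      hence ab: "a = b" using b(3) by auto
      have "a mod 4 = 3 \<and> \<not> 4 dvd d" using nadm bd True unfolding admissible_def ab by auto
      hence a3: "a mod 4 = 3" and nd: "\<not> 4 dvd d" by auto
      have "k < 2"
      proof (rule ccontr)
        assume "\<not> k < 2"
        hence "(2::nat) ^ 2 dvd 2 ^ k" by (intro le_imp_power_dvd) auto
        hence "4 dvd d" unfolding d'(1) by simp
        thus False using nd by simp
      qed
      hence "(2::nat) ^ k dvd 2" by (cases k) (auto simp: less_Suc_eq numeral_2_eq_2)
      hence "d dvd 2 * d'" unfolding d'(1) by (intro mult_dvd_mono) auto
      moreover have "[v = 1] (mod 2)" using odd by (simp add: cong_mod_def odd_iff_mod_2_eq_one)
      hence "[v = 1] (mod 2 * d')" using v1 d'(2) by (intro coprime_cong_mult_nat) auto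
      ultimately have vd: "[v = 1] (mod d)" using cong_dvd_modulus_nat by blast
      have "int v mod 4 = 3" using v8' True unfolding c_def by presburger
      hence "chi4 (int v) = -1" by (simp add: chi4_def)
      moreover have "chi4 b = -1" using a3 ab by (simp add: chi4_def)
      ultimately show ?thesis by (intro fin[OF vpos odd vd]) (use Lr jacobi ab in auto)
    next
      case False
      hence ab: "a = 2 * b" using b(3) by auto
      have nd: "\<not> 8 dvd d"
      proof
        assume d8: "8 dvd d"
        hence "2 dvd d" using dvd_trans[of 2 8 d] by simp
        hence "2 dvd int d" by simp
        hence "2 * b dvd int d" using bd b(2) by (intro divides_mult) auto
        moreover have "a mod 4 \<noteq> 3" using False by presburger
        ultimately show False using nadm d8 unfolding admissible_def ab by auto
      qed
      have "k < 3"
      proof (rule ccontr)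
        assume "\<not> k < 3"
        hence "(2::nat) ^ 3 dvd 2 ^ k" by (intro le_imp_power_dvd) auto
        hence "8 dvd d" unfolding d'(1) by simp
        thus False using nd by simp
      qed
      hence "(2::nat) ^ k dvd 2 ^ 2" by (intro le_imp_power_dvd) auto
      hence "d dvd 4 * d'" unfolding d'(1) by (intro mult_dvd_mono) auto
      moreover have "[v = 1] (mod 4)" using v8' False unfolding c_def cong_mod_def by presburger
      moreover have "coprime 4 d'"
      proof -
        have "coprime (2 ^ 2) d'" using d'(2) by (simp only: coprime_power_left_iff) simp
        thus ?thesis by simp
      qed
      ultimately have vd: "[v = 1] (mod d)" using v1 coprime_cong_mult_nat cong_dvd_modulus_nat by metis
      have "int v mod 4 = 1" using v8' False unfolding c_def by presburger
      hence c4: "chi4 (int v) = 1" by (simp add: chi4_def)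
      have "int v mod 8 = 5" using v8' False unfolding c_def by presburger
      hence c8: "chi8 (int v) = -1" by (simp add: chi8_def)
      show ?thesis by (rule fin[OF vpos odd vd]) (use Lr jacobi ab b0 c4 c8 in auto)
    qed
  qed
  thus ?thesis using that by blast
qed

text \<open>\<open>N\<close> is a common period for the class of \<open>f\<close> and the symbol.
  Translation by the witness \<open>v\<close> preserves the class and the units but flips the
  symbol, so the sum over a period equals its own negative.\<close>

lemma prime_mean_nonadmissible:
  fixes a :: int
  assumes a: "squarefree a" "a \<noteq> 0" and d: "d > 0" and nadm: "\<not> admissible a d"
  defines "N \<equiv> 8 * nat \<bar>a\<bar> * d"
  shows "prime_mean (\<lambda>n. if [n = f] (mod d) \<and> coprime n N then of_int (kronecker a n) else 0) 0"
proof -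
  let ?h = "\<lambda>n. if [n = f] (mod d) \<and> coprime n N then complex_of_int (kronecker a n) else 0"
  have N: "N \<ge> 8" using a d by (simp add: N_def Suc_le_eq)
  have N0: "N > 0" using N by simp
  have pos: "n > 0" if "coprime n N" for n using that N by (intro Nat.gr0I) auto
  have aN: "a dvd int N" unfolding N_def by simp
  have admN: "admissible a N" unfolding admissible_def using aN by (auto simp: N_def)
  have dN: "d dvd N" by (simp add: N_def)
  have hc: "?h m = ?h n" if mn: "[m = n] (mod N)" for m n
  proof -
    have "coprime m N \<longleftrightarrow> coprime n N" using mn cong_imp_coprime cong_sym by blast
    moreover have "[m = f] (mod d) \<longleftrightarrow> [n = f] (mod d)"
      using cong_dvd_modulus_nat[OF mn dN] cong_trans cong_sym by blast
    moreover have "kronecker a m = kronecker a n" if "coprime m N" "coprime n N"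
      using kronecker_periodic[OF a(1) admN mn] pos that by blast
    ultimately show ?thesis by auto
  qed
  have up: "unit_periodic N ?h"
    unfolding unit_periodic_def
  proof (intro conjI allI impI)
    show "?h (n + N) = ?h n" for n by (rule hc) (simp add: cong_mod_def)
  qed auto
  obtain v where v: "v > 0" "[v = 1] (mod d)" "coprime v N" "kronecker a v = -1"
    using nonadmissible_witness[OF a d nadm] unfolding N_def by blast
  have neg: "?h (v * n) = - ?h n" for n
  proof -
    have "[v * n = 1 * n] (mod d)" by (intro cong_mult v(2) cong_refl)
    hence "[v * n = f] (mod d) \<longleftrightarrow> [n = f] (mod d)" using cong_trans cong_sym by (metis mult_1)
    moreover have "coprime (v * n) N \<longleftrightarrow> coprime n N" using v(3) by simp
    moreover have "kronecker a (v * n) = - kronecker a n" if "coprime n N"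
      using kronecker_mult[OF v(1) pos[OF that]] v(4) by simp
    ultimately show ?thesis by auto
  qed
  have "(\<Sum>k<N. ?h k) = (\<Sum>k<N. ?h (v * k mod N))" by (rule sum_mod_permute[OF v(3) N0, symmetric])
  also have "\<dots> = (\<Sum>k<N. - ?h k)"
  proof (rule sum.cong)
    fix k
    have "?h (v * k mod N) = ?h (v * k)" by (rule hc) (simp add: cong_mod_def)
    thus "?h (v * k mod N) = - ?h k" using neg by simp
  qed auto
  finally have "(\<Sum>k<N. ?h k) = - (\<Sum>k<N. ?h k)" by (simp only: sum_negf)
  hence "(\<Sum>k<N. ?h k) = 0" by (simp only: eq_neg_iff_add_eq_0 mult_2[symmetric]) simp
  hence "class_mean N ?h = 0" by (simp only: class_mean_def) simp
  with prime_mean_unit_periodic[OF N0 up] show ?thesis by simp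
qed

lemma prime_mean_residue_class:
  assumes "d > 0" "coprime f d"
  shows "prime_mean (\<lambda>n. if [n = f] (mod d) then c else 0) (c / of_nat (totient d))"
proof -
  let ?h = "\<lambda>n. if [n = f] (mod d) then c else 0"
  have cop: "coprime n d" if "[n = f] (mod d)" for n
    using that assms(2) cong_imp_coprime cong_sym by blast
  have "unit_periodic d ?h"
    unfolding unit_periodic_def by (auto simp: cong_mod_def dest: cop[unfolded cong_mod_def])
  from prime_mean_unit_periodic[OF assms(1) this] have "prime_mean ?h (class_mean d ?h)" .
  moreover have "(\<Sum>k<d. ?h k) = (\<Sum>k<d. if k = f mod d then c else 0)"
    by (rule sum.cong) (auto simp: cong_mod_def)
  hence "class_mean d ?h = c / of_nat (totient d)"
    using assms(1) by (simp add: class_mean_def)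
  ultimately show ?thesis by simp
qed

lemma Legendre_squarefree_part:
  assumes p: "prime p" "2 < p" and n: "\<not> int p dvd n"
  shows "Legendre n (int p) = Legendre (squarefree_part n) (int p)"
proof -
  have dec: "n = squarefree_part n * (square_part n)\<^sup>2" by (rule squarefree_decompose)
  have "\<not> int p dvd square_part n"
  proof
    assume "int p dvd square_part n"
    hence "int p dvd squarefree_part n * (square_part n)\<^sup>2" by (simp add: power2_eq_square)
    thus False using n dec by simp
  qed
  hence "coprime (square_part n) (int p)" using p prime_imp_coprime[of "int p" "square_part n"] by (simp add: coprime_commute)
  hence "Legendre (square_part n) (int p) = 1 \<or> Legendre (square_part n) (int p) = -1"
    using p by (intro Legendre_unit) auto
  hence "Legendre ((square_part n)\<^sup>2) (int p) = 1"
    unfolding power2_eq_square Legendre_mult[OF p] by auto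
  thus ?thesis using Legendre_mult[OF p, of "squarefree_part n" "(square_part n)\<^sup>2"] dec by simp
qed

lemma has_prime_density_of_prime_mean:
  assumes P: "\<And>p. p \<in> P \<Longrightarrow> prime p" and m: "prime_mean (\<lambda>n. if n \<in> P then 1 else 0) (of_real \<delta>)"
  shows "has_prime_density P \<delta>"
proof -
  have "(\<Sum>p\<in>primes_le x. if p \<in> P then 1 else 0) = complex_of_real (real (card {p\<in>P. p \<le> x}))" for x
  proof -
    have "(\<Sum>p\<in>primes_le x. if p \<in> P then 1 else (0::complex)) = (\<Sum>p\<in>{p\<in>P. p \<le> x}. 1)"
      by (rule sum.mono_neutral_cong_right) (use P in \<open>auto simp: primes_le_def\<close>)
    thus ?thesis by simp
  qed
  hence "(\<lambda>x. complex_of_real (real (card {p\<in>P. p \<le> x}) / real (card (primes_le x)))) \<longlonglongrightarrow> of_real \<delta>"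
    using m by (simp add: prime_mean_def)
  hence "(\<lambda>x. real (card {p\<in>P. p \<le> x}) / real (card (primes_le x))) \<longlonglongrightarrow> \<delta>"
    by (simp only: tendsto_of_real_iff)
  moreover have "filterlim (\<lambda>x::real. nat \<lfloor>x\<rfloor>) sequentially at_top"
    by (rule filterlim_compose[OF filterlim_nat_sequentially filterlim_floor_sequentially])
  ultimately have lim: "((\<lambda>x::real. real (card {p\<in>P. p \<le> nat \<lfloor>x\<rfloor>}) / real (card (primes_le (nat \<lfloor>x\<rfloor>)))) \<longlongrightarrow> \<delta>) at_top"
    by (rule filterlim_compose)
  show ?thesis
    unfolding has_prime_density_def
  proof (rule Lim_transform_eventually[OF lim])
    show "eventually (\<lambda>x::real. real (card {p\<in>P. p \<le> nat \<lfloor>x\<rfloor>}) / real (card (primes_le (nat \<lfloor>x\<rfloor>)))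
       = real (card {p \<in> P. real p \<le> x}) / real (card {p :: nat. prime p \<and> real p \<le> x})) at_top"
      using eventually_ge_at_top[of 0]
    proof eventually_elim
      case (elim x)
      hence "p \<le> nat \<lfloor>x\<rfloor> \<longleftrightarrow> real p \<le> x" for p by (simp add: le_nat_iff le_floor_iff)
      thus ?case by (simp add: primes_le_def)
    qed
  qed
qed

section \<open>Residue patterns\<close>

lemma sqf_facts:
  assumes "0 \<notin> T"  "finite T"
  shows "squarefree (sqf T)" "sqf T \<noteq> 0"
proof -
  have "\<Prod>T \<noteq> 0" using assms by auto
  thus "squarefree (sqf T)" "sqf T \<noteq> 0" by (auto simp: sqf_def)
qed

text \<open>The three choices of \<open>D\<close> state one condition: the sets whose
  \<open>sqf\<close> is 3 modulo 4 drop out when 4 does not divide \<open>d\<close>, and those with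
  even \<open>sqf\<close> when 8 does not.\<close>

lemma D_cases_iff_admissible:
  "(T \<in> (if \<not> 4 dvd d then D2 S d else if \<not> 8 dvd d then D1 S d else D0 S d)) \<longleftrightarrow>
     T \<subseteq> S \<and> admissible (sqf T) d"
proof -
  have m: "[x = 1] (mod 4) \<longleftrightarrow> x mod 4 = 1" "[x = 3] (mod 4) \<longleftrightarrow> x mod 4 = 3" for x :: int
    by (simp_all add: cong_mod_def)
  have "4 dvd d" if "8 dvd d" using dvd_trans[of 4 8 d] that by simp
  moreover have "odd (sqf T) \<longleftrightarrow> sqf T mod 4 = 1 \<or> sqf T mod 4 = 3" by presburger
  ultimately show ?thesis
    unfolding D0_def D1_def D2_def admissible_def by (auto simp: m)
qed

lemma Legendre_eq_kronecker_sqf: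
  assumes p: "prime p" "2 < p" and T: "\<not> int p dvd \<Prod>T"
  shows "Legendre (\<Prod>T) (int p) = kronecker (sqf T) p"
  using Legendre_squarefree_part[OF p T] kronecker_odd_prime[OF p(1), of "sqf T"] p(2)
  by (simp add: sqf_def)

theorem corollary4p1:
  fixes S :: "int set" and \<theta> :: "int \<Rightarrow> int" and f d :: nat
    and D :: "int set set" and P :: "nat set"
  assumes "finite S" and "0 \<notin> S"
    and "\<And>s. s \<in> S \<Longrightarrow> \<theta> s \<in> {-1, 1}"
    and "1 \<le> f" and "f \<le> d" and "coprime f d"
    and "D = (if \<not> 4 dvd d then D2 S d else if \<not> 8 dvd d then D1 S d else D0 S d)"
    and "P = {p. prime p \<and> [p = f] (mod d) \<and> residue_pattern S \<theta> p}"
  shows "(infinite P \<longleftrightarrow> (\<forall>T\<in>D. (\<Prod>s\<in>T. \<theta> s) = kronecker (sqf T) f)) \<and>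
         ((\<forall>T\<in>D. (\<Prod>s\<in>T. \<theta> s) = kronecker (sqf T) f) \<longrightarrow>
           has_prime_density P (real (card D) / (real (totient d) * 2 ^ card S)))"
proof -
  have d0: "d > 0" using assms by simp
  have D: "T \<in> D \<longleftrightarrow> T \<subseteq> S \<and> admissible (sqf T) d" for T
    unfolding assms(7) by (rule D_cases_iff_admissible)
  have fD: "finite D" by (rule finite_subset[of D "Pow S"]) (use D assms(1) in auto)
  have T0: "0 \<notin> T" "finite T" if "T \<subseteq> S" for T using that assms(1,2) finite_subset by auto
  \<comment> \<open>Primes beyond \<open>B\<close> are odd and divide neither \<open>d\<close> nor
    any element of \<open>S\<close>; the finitely many others affect neither density nor
    infinitude.\<close>
  define B where "B = 2 + d + 8 * nat \<bar>\<Prod>S\<bar>"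
  have S0: "\<Prod>S \<noteq> 0" using assms(1,2) by auto
  have big: "\<not> p dvd d" "2 < p" "\<not> int p dvd \<Prod>S" if "prime p" "p > B" for p
  proof -
    show "2 < p" using that by (simp add: B_def)
    show "\<not> p dvd d" using that d0 by (auto simp: B_def dest: dvd_imp_le)
    show "\<not> int p dvd \<Prod>S"
    proof
      assume "int p dvd \<Prod>S"
      hence "int p \<le> \<bar>\<Prod>S\<bar>" using S0 by (intro zdvd_imp_le) auto
      thus False using that(2) by (simp add: B_def)
    qed
  qed
  have ndT: "\<not> int p dvd \<Prod>T" if "prime p" "p > B" "T \<subseteq> S" for p T
  proof
    assume "int p dvd \<Prod>T"
    moreover have "\<Prod>T dvd \<Prod>S" using assms(1) that(3) by (intro prod_dvd_prod_subset) auto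
    ultimately show False using big(3)[OF that(1,2)] dvd_trans by blast
  qed
  have Leg: "Legendre (\<Prod>T) (int p) = kronecker (sqf T) p" if "prime p" "p > B" "T \<subseteq> S" for p T
    by (rule Legendre_eq_kronecker_sqf[OF that(1) big(2)[OF that(1,2)] ndT[OF that]])
  have kf: "kronecker (sqf T) p = kronecker (sqf T) f" if "prime p" "[p = f] (mod d)" "T \<in> D" for p T
  proof (rule kronecker_periodic[of _ d])
    show "squarefree (sqf T)" using sqf_facts(1)[OF T0] D that(3) by blast
    show "coprime p d" using that(2) assms(6) cong_imp_coprime cong_sym by blast
  qed (use that D assms(4) prime_gt_0_nat in auto)
  define cond where "cond \<longleftrightarrow> (\<forall>T\<in>D. (\<Prod>s\<in>T. \<theta> s) = kronecker (sqf T) f)"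

  \<comment> \<open>One large prime in \<open>P\<close> suffices: multiplying the pattern over
    \<open>T\<close> gives the symbol of \<open>sqf T\<close> at \<open>p\<close>, which for
    \<open>T \<in> D\<close> equals its value at \<open>f\<close>.\<close>
  have imp: "cond" if inf: "infinite P"
    unfolding cond_def
  proof
    fix T assume T: "T \<in> D"
    hence TS: "T \<subseteq> S" using D by blast
    obtain p where p: "p \<in> P" "p > B" using inf by (meson finite_nat_set_iff_bounded_le not_le)
    hence pp: "prime p" "[p = f] (mod d)" "\<And>s. s \<in> S \<Longrightarrow> Legendre s (int p) = \<theta> s"
      by (auto simp: assms(8) residue_pattern_def)
    have "(\<Prod>s\<in>T. \<theta> s) = (\<Prod>s\<in>T. Legendre s (int p))" using pp(3) TS by (intro prod.cong) auto
    also have "\<dots> = Legendre (\<Prod>T) (int p)"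
      using Legendre_prod[OF pp(1) big(2)[OF pp(1) p(2)], of "\<lambda>x. x" T] by simp
    also have "\<dots> = kronecker (sqf T) f" using Leg[OF pp(1) p(2) TS] kf[OF pp(1,2) T] by simp
    finally show "(\<Prod>s\<in>T. \<theta> s) = kronecker (sqf T) f" .
  qed

  have dens: "has_prime_density P (real (card D) / (real (totient d) * 2 ^ card S)) \<and> infinite P" if cond
  proof -
    \<comment> \<open>Up to finitely many primes, \<open>g T\<close> is constant on the class of
      \<open>f\<close> if \<open>T \<in> D\<close>, and otherwise the function treated in
      \<open>prime_mean_nonadmissible\<close>.\<close>
    define g where "g = (\<lambda>T n. if [n = f] (mod d) then complex_of_int (Legendre (\<Prod>T) (int n)) else 0)"
    have gm: "prime_mean (g T) (if T \<in> D then of_int (\<Prod>s\<in>T. \<theta> s) / of_nat (totient d) else 0)" if TS: "T \<subseteq> S" for T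
    proof (cases "T \<in> D")
      case True
      have "prime_mean (\<lambda>n. if [n = f] (mod d) then complex_of_int (\<Prod>s\<in>T. \<theta> s) else 0) (of_int (\<Prod>s\<in>T. \<theta> s) / of_nat (totient d))"
        by (rule prime_mean_residue_class[OF d0 assms(6)])
      moreover have "{p. prime p \<and> (if [p = f] (mod d) then complex_of_int (\<Prod>s\<in>T. \<theta> s) else 0) \<noteq> g T p} \<subseteq> {..B}"
      proof (rule subsetI, rule ccontr)
        fix p assume p: "p \<in> {p. prime p \<and> (if [p = f] (mod d) then complex_of_int (\<Prod>s\<in>T. \<theta> s) else 0) \<noteq> g T p}" "p \<notin> {..B}"
        hence pf: "[p = f] (mod d)" "prime p" "p > B" by (auto simp: g_def split: if_splits)
        have "Legendre (\<Prod>T) (int p) = (\<Prod>s\<in>T. \<theta> s)"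
          using Leg[OF pf(2,3) TS] kf[OF pf(2,1) True] \<open>cond\<close> True by (simp add: cond_def)
        thus False using p pf by (simp add: g_def)
      qed
      ultimately show ?thesis using True by (simp only: if_True) (rule prime_mean_finite_change, auto intro: finite_subset)
    next
      case False
      define N where "N = 8 * nat \<bar>sqf T\<bar> * d"
      have sf: "squarefree (sqf T)" "sqf T \<noteq> 0" using sqf_facts[OF T0[OF TS]] by auto
      have na: "\<not> admissible (sqf T) d" using False TS D by blast
      have "prime_mean (\<lambda>n. if [n = f] (mod d) \<and> coprime n N then of_int (kronecker (sqf T) n) else 0) 0"
        unfolding N_def by (rule prime_mean_nonadmissible[OF sf d0 na])
      moreover have "{p. prime p \<and> (if [p = f] (mod d) \<and> coprime p N then of_int (kronecker (sqf T) p) else 0) \<noteq> g T p} \<subseteq> {..B + N}"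
      proof (rule subsetI, rule ccontr)
        fix p assume p: "p \<in> {p. prime p \<and> (if [p = f] (mod d) \<and> coprime p N then of_int (kronecker (sqf T) p) else 0) \<noteq> g T p}" "p \<notin> {..B + N}"
        hence pp: "prime p" "p > B" "p > N" by auto
        have "N > 0" using sf d0 by (simp add: N_def)
        hence "coprime p N" using pp by (intro prime_imp_coprime) (auto dest: dvd_imp_le)
        thus False using p Leg[OF pp(1,2) TS] by (auto simp: g_def split: if_splits)
      qed
      ultimately show ?thesis using False by (simp only: if_False) (rule prime_mean_finite_change, auto intro: finite_subset)
    qed
    define \<delta> where "\<delta> = real (card D) / (real (totient d) * 2 ^ card S)"
    define F where "F = (\<lambda>n. 1 / 2 ^ card S * (\<Sum>T\<in>Pow S. of_int (\<Prod>s\<in>T. \<theta> s) * g T n))"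
    have "prime_mean F (1 / 2 ^ card S * (\<Sum>T\<in>Pow S. of_int (\<Prod>s\<in>T. \<theta> s) * (if T \<in> D then of_int (\<Prod>s\<in>T. \<theta> s) / of_nat (totient d) else 0)))"
      unfolding F_def by (intro prime_mean_cmult prime_mean_sum gm) auto
    also have "(\<Sum>T\<in>Pow S. complex_of_int (\<Prod>s\<in>T. \<theta> s) * (if T \<in> D then of_int (\<Prod>s\<in>T. \<theta> s) / of_nat (totient d) else 0))
       = (\<Sum>T\<in>D. 1 / of_nat (totient d))"
    proof (rule sum.mono_neutral_cong_right)
      fix T assume T: "T \<in> D"
      \<comment> \<open>Since \<theta> squares to 1, every \<open>T\<close> in \<open>D\<close>
        contributes the same amount, whence the count \<open>card D\<close> in the density.\<close>
      have sq: "(\<Prod>s\<in>T. \<theta> s) * (\<Prod>s\<in>T. \<theta> s) = 1"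
        unfolding prod.distrib[symmetric] using T D assms(3) by (intro prod.neutral) force
      have "complex_of_int (\<Prod>s\<in>T. \<theta> s) * of_int (\<Prod>s\<in>T. \<theta> s) = 1"
        unfolding of_int_mult[symmetric] sq by simp
      thus "complex_of_int (\<Prod>s\<in>T. \<theta> s) * (if T \<in> D then of_int (\<Prod>s\<in>T. \<theta> s) / of_nat (totient d) else 0) = 1 / of_nat (totient d)"
        using T by (simp only: if_True times_divide_eq_right)
    qed (use assms(1) D in auto)
    also have "1 / 2 ^ card S * (\<Sum>T\<in>D. 1 / of_nat (totient d)) = complex_of_real \<delta>"
      by (simp add: \<delta>_def)
    finally have Fm: "prime_mean F (of_real \<delta>)" .
    have FP: "F p = (if p \<in> P then 1 else 0)" if p: "prime p" "p > B" for p
    proof (cases "[p = f] (mod d)")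
      case True
      have L: "Legendre s (int p) = 1 \<or> Legendre s (int p) = -1" if s: "s \<in> S" for s
      proof (rule Legendre_unit)
        show "prime (int p)" using p by simp
        have "\<not> int p dvd s" using ndT[OF p, of "{s}"] s by simp
        thus "coprime s (int p)" using p prime_imp_coprime[of "int p" s] by (simp add: coprime_commute)
      qed
      \<comment> \<open>The empty-looking factor over \<open>S - T\<close> gives the sum the shape
        of \<open>prod_add\<close>. It collapses to a product of factors that are 2 where the symbol
        agrees with \<theta> and 0 where it does not.\<close>
      have "(\<Sum>T\<in>Pow S. of_int (\<Prod>s\<in>T. \<theta> s) * g T p) = complex_of_int (\<Sum>T\<in>Pow S. (\<Prod>s\<in>T. \<theta> s * Legendre s (int p)) * (\<Prod>s\<in>S - T. 1))"
        using True Legendre_prod[OF p(1) big(2)[OF p], of "\<lambda>x. x"]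
        by (simp add: g_def prod.distrib)
      also have "(\<Sum>T\<in>Pow S. (\<Prod>s\<in>T. \<theta> s * Legendre s (int p)) * (\<Prod>s\<in>S - T. 1)) = (\<Prod>s\<in>S. \<theta> s * Legendre s (int p) + 1)"
        by (rule prod_add[OF assms(1), symmetric])
      also have "\<dots> = (if residue_pattern S \<theta> p then 2 ^ card S else 0)"
      proof (cases "residue_pattern S \<theta> p")
        case res: True
        have "(\<Prod>s\<in>S. \<theta> s * Legendre s (int p) + 1) = (\<Prod>s\<in>S. 2)"
          using res assms(3) by (intro prod.cong refl) (force simp: residue_pattern_def)
        thus ?thesis using res by simp
      next
        case nres: False
        then obtain s where s: "s \<in> S" "Legendre s (int p) \<noteq> \<theta> s" by (auto simp: residue_pattern_def)
        hence "\<theta> s * Legendre s (int p) + 1 = 0" using L[OF s(1)] assms(3)[OF s(1)] by auto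
        thus ?thesis using nres s assms(1) by (simp only: if_False) (rule prod_zero, auto)
      qed
      finally show ?thesis using True p by (simp add: F_def assms(8))
    next
      case False
      thus ?thesis by (simp add: F_def g_def assms(8))
    qed
    have Pm: "prime_mean (\<lambda>n. if n \<in> P then 1 else 0) (of_real \<delta>)"
    proof (rule prime_mean_finite_change[OF Fm])
      have "{p. prime p \<and> F p \<noteq> (if p \<in> P then 1 else 0)} \<subseteq> {..B}"
        using FP leI by blast
      thus "finite {p. prime p \<and> F p \<noteq> (if p \<in> P then 1 else 0)}" by (rule finite_subset) auto
    qed
    have "infinite P"
    proof
      assume "finite P"
      hence "finite {p. prime p \<and> (0::complex) \<noteq> (if p \<in> P then 1 else 0)}"
        by (rule finite_subset[rotated]) (auto split: if_splits)
      from prime_mean_finite_change[OF prime_mean_0 this] Pm have "complex_of_real \<delta> = 0"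
        by (metis prime_mean_unique)
      hence "\<delta> = 0" by simp
      hence "card D = 0" using d0 by (simp add: \<delta>_def)
      \<comment> \<open>The empty set has \<open>sqf\<close> equal to 1 and always lies in
        \<open>D\<close>, so the density is positive and \<open>P\<close> cannot be finite.\<close>
      moreover have "{} \<in> D" unfolding D by (simp add: sqf_def admissible_def)
      ultimately show False using fD by auto
    qed
    moreover have "has_prime_density P \<delta>"
      by (rule has_prime_density_of_prime_mean[OF _ Pm]) (simp add: assms(8))
    ultimately show ?thesis by (simp add: \<delta>_def)
  qed
  show ?thesis using imp dens unfolding cond_def by blast
qed

end
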